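(* Let $R$ be a ring with unit, let $C$ be a (possibly unbounded) cochain complex of finitely presented right $R$-modules, and let $h \colon C \to C$ be an arbitrary cochain map, with mapping torus $T(h)$. Then the negative Novikov cohomology of $T(h)$ is trivial, i.e., the cochain complex $T(h) \otimes_{R[z,z^{-1}]} R((z^{-1}))$ is acyclic. If $h$ is a quasi-isomorphism, then the positive Novikov cohomology of $T(h)$ is trivial as well, i.e., the cochain complex $T(h) \otimes_{R[z,z^{-1}]} R((z))$ is acyclic in this case.
   Context: $R$ is a ring with unit (not assumed commutative), and $R[z,z^{-1}]$ is the Laurent polynomial ring in an indeterminate $z$ that commutes with the elements of $R$. The Novikov rings are the rings of formal Laurent series $$R((z)) = R[[z]][z^{-1}] = \Big\{ \sum_{i \geq k} r_i z^i \,\Big|\, k \in \mathbb{Z},\ r_i \in R \Big\}, \qquad R((z^{-1})) = R[[z^{-1}]][z] = \Big\{ \sum_{i \leq k} r_i z^i \,\Big|\, k \in \mathbb{Z},\ r_i \in R \Big\},$$ with the usual multiplication of formal Laurent series; both contain $R[z,z^{-1}]$ as a subring. For a cochain complex $B$ of (right) $R[z,z^{-1}]$-modules, the positive Novikov cohomology of $B$ is the cohomology of the cochain complex $B \otimes_{R[z,z^{-1}]} R((z))$, and the negative Novikov cohomology of $B$ is the cohomology of the cochain complex $B \otimes_{R[z,z^{-1}]} R((z^{-1}))$. For a map of cochain complexes $f \colon X \to Y$, the algebraic mapping cone $\mathrm{Cone}(f)$ is the cochain complex with $\mathrm{Cone}(f)^n = X^{n+1} \oplus Y^n$ and differential $(x,y)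 \mapsto (-d(x),\, f(x) + d(y))$. For a cochain complex $C$ of right $R$-modules and a cochain map $h \colon C \to C$, the mapping torus of $h$ is the cochain complex of $R[z,z^{-1}]$-modules $$T(h) = \mathrm{Cone}\Big( C \otimes_R R[z,z^{-1}] \xrightarrow{\ h \otimes \mathrm{id} - \mathrm{id} \otimes z\ } C \otimes_R R[z,z^{-1}] \Big),$$ where $z$ denotes the self map of $R[z,z^{-1}]$ given by multiplication by the indeterminate $z$. *)

theory Defs
  imports "HOL-Algebra.Algebra"
begin

section \<open>Right modules over a ring that need not be commutative\<close>

text \<open>
  As for the library's modules, the record extends the ring record, whose fields
  \<open>mult\<close> and \<open>one\<close> play no role for a module; the constructions below leave them undefined.
\<close>

record ('r, 'm) rmodule = "'m ring" +
  ract :: "'m \<Rightarrow> 'r \<Rightarrow> 'm"  (infixl \<open>\<triangleleft>\<index>\<close> 70)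

locale right_module = R?: ring R + M?: abelian_group M
    for R :: "('r, 'e) ring_scheme" (structure) and M :: "('r, 'm) rmodule" (structure) +
  assumes ract_closed:
      "\<lbrakk>x \<in> carrier M; r \<in> carrier R\<rbrakk> \<Longrightarrow> x \<triangleleft>\<^bsub>M\<^esub> r \<in> carrier M"
    and ract_add_left:
      "\<lbrakk>x \<in> carrier M; y \<in> carrier M; r \<in> carrier R\<rbrakk>
        \<Longrightarrow> (x \<oplus>\<^bsub>M\<^esub> y) \<triangleleft>\<^bsub>M\<^esub> r = x \<triangleleft>\<^bsub>M\<^esub> r \<oplus>\<^bsub>M\<^esub> y \<triangleleft>\<^bsub>M\<^esub> r"
    and ract_add_right:
      "\<lbrakk>x \<in> carrier M; r \<in> carrier R; s \<in> carrier R\<rbrakk>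
        \<Longrightarrow> x \<triangleleft>\<^bsub>M\<^esub> (r \<oplus>\<^bsub>R\<^esub> s) = x \<triangleleft>\<^bsub>M\<^esub> r \<oplus>\<^bsub>M\<^esub> x \<triangleleft>\<^bsub>M\<^esub> s"
    and ract_assoc:
      "\<lbrakk>x \<in> carrier M; r \<in> carrier R; s \<in> carrier R\<rbrakk>
        \<Longrightarrow> x \<triangleleft>\<^bsub>M\<^esub> (r \<otimes>\<^bsub>R\<^esub> s) = (x \<triangleleft>\<^bsub>M\<^esub> r) \<triangleleft>\<^bsub>M\<^esub> s"
    and ract_one: "x \<in> carrier M \<Longrightarrow> x \<triangleleft>\<^bsub>M\<^esub> \<one>\<^bsub>R\<^esub> = x"

definition rmod_hom ::
    "('r, 'e) ring_scheme \<Rightarrow> ('r, 'm) rmodule \<Rightarrow> ('r, 'n) rmodule \<Rightarrow> ('m \<Rightarrow> 'n) set" where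
  "rmod_hom R M N = {f \<in> carrier M \<rightarrow> carrier N.
     (\<forall>x\<in>carrier M. \<forall>y\<in>carrier M. f (x \<oplus>\<^bsub>M\<^esub> y) = f x \<oplus>\<^bsub>N\<^esub> f y) \<and>
     (\<forall>x\<in>carrier M. \<forall>r\<in>carrier R. f (x \<triangleleft>\<^bsub>M\<^esub> r) = f x \<triangleleft>\<^bsub>N\<^esub> r)}"

definition free_rmodule :: "('r, 'e) ring_scheme \<Rightarrow> nat \<Rightarrow> ('r, nat \<Rightarrow> 'r) rmodule" where
  "free_rmodule R n = \<lparr>carrier = {..<n} \<rightarrow>\<^sub>E carrier R, monoid.mult = undefined, one = undefined,
     ring.zero = (\<lambda>i\<in>{..<n}. \<zero>\<^bsub>R\<^esub>), ring.add = (\<lambda>x y. \<lambda>i\<in>{..<n}. x i \<oplus>\<^bsub>R\<^esub> y i),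
     ract = (\<lambda>x r. \<lambda>i\<in>{..<n}. x i \<otimes>\<^bsub>R\<^esub> r)\<rparr>"

text \<open>Existence of an exact sequence \<open>R\<^sup>m \<rightarrow> R\<^sup>n \<rightarrow> M \<rightarrow> 0\<close> of right modules.\<close>

definition finitely_presented :: "('r, 'e) ring_scheme \<Rightarrow> ('r, 'm) rmodule \<Rightarrow> bool" where
  "finitely_presented R M \<longleftrightarrow> (\<exists>m n. \<exists>f \<in> rmod_hom R (free_rmodule R m) (free_rmodule R n).
     \<exists>g \<in> rmod_hom R (free_rmodule R n) M.
       g ` carrier (free_rmodule R n) = carrier M \<and>
       {x \<in> carrier (free_rmodule R n). g x = \<zero>\<^bsub>M\<^esub>} = f ` carrier (free_rmodule R m))"

definition rmod_sum :: "('r, 'm) rmodule \<Rightarrow> ('r, 'n) rmodule \<Rightarrow> ('r, 'm \<times> 'n) rmodule" where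
  "rmod_sum M N = \<lparr>carrier = carrier M \<times> carrier N, monoid.mult = undefined, one = undefined,
     ring.zero = (\<zero>\<^bsub>M\<^esub>, \<zero>\<^bsub>N\<^esub>), ring.add = (\<lambda>(x, y) (x', y'). (x \<oplus>\<^bsub>M\<^esub> x', y \<oplus>\<^bsub>N\<^esub> y')),
     ract = (\<lambda>(x, y) r. (x \<triangleleft>\<^bsub>M\<^esub> r, y \<triangleleft>\<^bsub>N\<^esub> r))\<rparr>"


section \<open>Tensor products over a ring that need not be commutative\<close>

text \<open>
  In \<open>('r, 's, 'n) bimodule\<close> the ring with elements in \<open>'r\<close> acts from the left,
  the ring with elements in \<open>'s\<close> from the right.
\<close>

record ('r, 's, 'n) bimodule = "('s, 'n) rmodule" +
  lact :: "'r \<Rightarrow> 'n \<Rightarrow> 'n"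

text \<open>The ring \<open>S\<close> as a bimodule, the left action coming from a ring homomorphism \<open>\<phi>\<close> into \<open>S\<close>.\<close>

definition ring_bimodule :: "('r \<Rightarrow> 's) \<Rightarrow> ('s, 'e) ring_scheme \<Rightarrow> ('r, 's, 's) bimodule" where
  "ring_bimodule \<phi> S = \<lparr>carrier = carrier S, monoid.mult = undefined, one = undefined,
     ring.zero = \<zero>\<^bsub>S\<^esub>, ring.add = ring.add S, ract = (\<lambda>x s. x \<otimes>\<^bsub>S\<^esub> s), lact = (\<lambda>r x. \<phi> r \<otimes>\<^bsub>S\<^esub> x)\<rparr>"

definition tensor_free ::
    "('r, 'm) rmodule \<Rightarrow> ('r, 's, 'n) bimodule \<Rightarrow> ('m \<times> 'n \<Rightarrow>\<^sub>0 int) monoid" where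
  "tensor_free M N = free_Abelian_group (carrier M \<times> carrier N)"

definition tensor_relators ::
    "('r, 'e) ring_scheme \<Rightarrow> ('r, 'm) rmodule \<Rightarrow> ('r, 's, 'n) bimodule \<Rightarrow> ('m \<times> 'n \<Rightarrow>\<^sub>0 int) set" where
  "tensor_relators R M N =
     {frag_of (x \<oplus>\<^bsub>M\<^esub> x', y) - frag_of (x, y) - frag_of (x', y) | x x' y.
        x \<in> carrier M \<and> x' \<in> carrier M \<and> y \<in> carrier N} \<union>
     {frag_of (x, y \<oplus>\<^bsub>N\<^esub> y') - frag_of (x, y) - frag_of (x, y') | x y y'.
        x \<in> carrier M \<and> y \<in> carrier N \<and> y' \<in> carrier N} \<union>
     {frag_of (x \<triangleleft>\<^bsub>M\<^esub> r, y) - frag_of (x, lact N r y) | x r y.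
        x \<in> carrier M \<and> r \<in> carrier R \<and> y \<in> carrier N}"

definition tensor_null ::
    "('r, 'e) ring_scheme \<Rightarrow> ('r, 'm) rmodule \<Rightarrow> ('r, 's, 'n) bimodule \<Rightarrow> ('m \<times> 'n \<Rightarrow>\<^sub>0 int) set" where
  "tensor_null R M N = generate (tensor_free M N) (tensor_relators R M N)"

text \<open>
  The map \<open>f \<otimes> g\<close> from \<open>M \<otimes>\<^sub>R N\<close> to \<open>M' \<otimes>\<^sub>R N'\<close>.  Elements of the tensor products are cosets;
  if \<open>f\<close> and \<open>g\<close> respect the relators, then adding the subgroup \<open>tensor_null R M' N'\<close> to the
  image of a coset yields a single coset.
\<close>

definition tensor_map ::
    "('r, 'e) ring_scheme \<Rightarrow> ('r, 'm') rmodule \<Rightarrow> ('r, 's, 'n') bimodule \<Rightarrow> ('m \<Rightarrow> 'm') \<Rightarrow> ('n \<Rightarrow> 'n')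
      \<Rightarrow> ('m \<times> 'n \<Rightarrow>\<^sub>0 int) set \<Rightarrow> ('m' \<times> 'n' \<Rightarrow>\<^sub>0 int) set" where
  "tensor_map R M' N' f g K =
     tensor_null R M' N' <#>\<^bsub>tensor_free M' N'\<^esub> frag_extend (\<lambda>(x, y). frag_of (f x, g y)) ` K"

definition tensor ::
    "('r, 'e) ring_scheme \<Rightarrow> ('r, 'm) rmodule \<Rightarrow> ('r, 's, 'n) bimodule
      \<Rightarrow> ('s, ('m \<times> 'n \<Rightarrow>\<^sub>0 int) set) rmodule" where
  "tensor R M N = (let Q = tensor_free M N Mod tensor_null R M N in
     \<lparr>carrier = carrier Q, monoid.mult = undefined, one = undefined, ring.zero = \<one>\<^bsub>Q\<^esub>,
      ring.add = monoid.mult Q, ract = (\<lambda>K s. tensor_map R M N (\<lambda>x. x) (\<lambda>y. y \<triangleleft>\<^bsub>N\<^esub> s) K)\<rparr>)"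


section \<open>Cochain complexes\<close>

record ('r, 'm) cochain =
  obj :: "int \<Rightarrow> ('r, 'm) rmodule"
  diff :: "int \<Rightarrow> 'm \<Rightarrow> 'm"

locale cochain_complex =
  fixes R :: "('r, 'e) ring_scheme" and A :: "('r, 'm) cochain"
  assumes obj_module: "right_module R (obj A n)"
    and diff_hom: "diff A n \<in> rmod_hom R (obj A n) (obj A (n + 1))"
    and diff_diff: "x \<in> carrier (obj A n) \<Longrightarrow> diff A (n + 1) (diff A n x) = \<zero>\<^bsub>obj A (n + 2)\<^esub>"

definition cochain_map ::
    "('r, 'e) ring_scheme \<Rightarrow> ('r, 'm) cochain \<Rightarrow> ('r, 'n) cochain \<Rightarrow> (int \<Rightarrow> 'm \<Rightarrow> 'n) \<Rightarrow> bool" where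
  "cochain_map R A B f \<longleftrightarrow>
     (\<forall>n. f n \<in> rmod_hom R (obj A n) (obj B n)) \<and>
     (\<forall>n. \<forall>x\<in>carrier (obj A n). f (n + 1) (diff A n x) = diff B n (f n x))"

definition cocycles :: "('r, 'm) cochain \<Rightarrow> int \<Rightarrow> 'm set" where
  "cocycles A n = {x \<in> carrier (obj A n). diff A n x = \<zero>\<^bsub>obj A (n + 1)\<^esub>}"

definition coboundaries :: "('r, 'm) cochain \<Rightarrow> int \<Rightarrow> 'm set" where
  "coboundaries A n = diff A (n - 1) ` carrier (obj A (n - 1))"

definition cohomology :: "('r, 'm) cochain \<Rightarrow> int \<Rightarrow> 'm set monoid" where
  "cohomology A n = (add_monoid (obj A n))\<lparr>carrier := cocycles A n\<rparr> Mod coboundaries A n"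

definition acyclic_complex :: "('r, 'e) ring_scheme \<Rightarrow> ('r, 'm) cochain \<Rightarrow> bool" where
  "acyclic_complex R A \<longleftrightarrow> cochain_complex R A \<and> (\<forall>n. trivial_group (cohomology A n))"

text \<open>The map sending the class of a cocycle \<open>x\<close> to the class of \<open>f x\<close>; again classes are cosets.\<close>

definition cohomology_map ::
    "('r, 'n) cochain \<Rightarrow> (int \<Rightarrow> 'm \<Rightarrow> 'n) \<Rightarrow> int \<Rightarrow> 'm set \<Rightarrow> 'n set" where
  "cohomology_map B f n K = coboundaries B n <#>\<^bsub>add_monoid (obj B n)\<^esub> f n ` K"

definition quasi_isomorphism ::
    "('r, 'e) ring_scheme \<Rightarrow> ('r, 'm) cochain \<Rightarrow> ('r, 'n) cochain \<Rightarrow> (int \<Rightarrow> 'm \<Rightarrow> 'n) \<Rightarrow> bool" where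
  "quasi_isomorphism R A B f \<longleftrightarrow> cochain_map R A B f \<and>
     (\<forall>n. cohomology_map B f n \<in> iso (cohomology A n) (cohomology B n))"

definition cone ::
    "('r, 'm) cochain \<Rightarrow> ('r, 'n) cochain \<Rightarrow> (int \<Rightarrow> 'm \<Rightarrow> 'n) \<Rightarrow> ('r, 'm \<times> 'n) cochain" where
  "cone A B f = \<lparr>obj = (\<lambda>n. rmod_sum (obj A (n + 1)) (obj B n)),
     diff = (\<lambda>n (x, y). (\<ominus>\<^bsub>obj A (n + 2)\<^esub> diff A (n + 1) x,
                        f (n + 1) x \<oplus>\<^bsub>obj B (n + 1)\<^esub> diff B n y))\<rparr>"

definition tensor_complex ::
    "('r, 'e) ring_scheme \<Rightarrow> ('r, 'm) cochain \<Rightarrow> ('r, 's, 'n) bimodule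
      \<Rightarrow> ('s, ('m \<times> 'n \<Rightarrow>\<^sub>0 int) set) cochain" where
  "tensor_complex R A N = \<lparr>obj = (\<lambda>n. tensor R (obj A n) N),
     diff = (\<lambda>n. tensor_map R (obj A (n + 1)) N (diff A n) (\<lambda>y. y))\<rparr>"


section \<open>Laurent polynomials and Novikov rings\<close>

text \<open>
  A function \<open>f :: int \<Rightarrow> 'r\<close> represents the formal sum of the \<open>f i z\<^sup>i\<close>.  The predicate \<open>P\<close>
  restricts the supports.  For the three choices of \<open>P\<close> below, the sum defining a coefficient of
  a product ranges over a finite set, and the inclusions of Laurent polynomials into Laurent
  series are identity maps.
\<close>

definition laurent_ring :: "(int set \<Rightarrow> bool) \<Rightarrow> ('r, 'e) ring_scheme \<Rightarrow> (int \<Rightarrow> 'r) ring" where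
  "laurent_ring P R = \<lparr>carrier = {f. range f \<subseteq> carrier R \<and> P {i. f i \<noteq> \<zero>\<^bsub>R\<^esub>}},
     monoid.mult = (\<lambda>f g n. \<Oplus>\<^bsub>R\<^esub>i \<in> {i. f i \<noteq> \<zero>\<^bsub>R\<^esub> \<and> g (n - i) \<noteq> \<zero>\<^bsub>R\<^esub>}. f i \<otimes>\<^bsub>R\<^esub> g (n - i)),
     one = (\<lambda>i. if i = 0 then \<one>\<^bsub>R\<^esub> else \<zero>\<^bsub>R\<^esub>),
     ring.zero = (\<lambda>i. \<zero>\<^bsub>R\<^esub>), ring.add = (\<lambda>f g i. f i \<oplus>\<^bsub>R\<^esub> g i)\<rparr>"

definition laurent_polynomials :: "('r, 'e) ring_scheme \<Rightarrow> (int \<Rightarrow> 'r) ring" where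
  "laurent_polynomials R = laurent_ring finite R"

definition novikov_pos :: "('r, 'e) ring_scheme \<Rightarrow> (int \<Rightarrow> 'r) ring" where
  "novikov_pos R = laurent_ring bdd_below R"

definition novikov_neg :: "('r, 'e) ring_scheme \<Rightarrow> (int \<Rightarrow> 'r) ring" where
  "novikov_neg R = laurent_ring bdd_above R"

definition laurent_const :: "('r, 'e) ring_scheme \<Rightarrow> 'r \<Rightarrow> int \<Rightarrow> 'r" where
  "laurent_const R r = (\<lambda>i. if i = 0 then r else \<zero>\<^bsub>R\<^esub>)"

definition laurent_z :: "('r, 'e) ring_scheme \<Rightarrow> int \<Rightarrow> 'r" where
  "laurent_z R = (\<lambda>i. if i = 1 then \<one>\<^bsub>R\<^esub> else \<zero>\<^bsub>R\<^esub>)"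

abbreviation laurent_bimodule :: "('r, 'e) ring_scheme \<Rightarrow> ('r, int \<Rightarrow> 'r, int \<Rightarrow> 'r) bimodule" where
  "laurent_bimodule R \<equiv> ring_bimodule (laurent_const R) (laurent_polynomials R)"


section \<open>Mapping torus\<close>

definition torus_map ::
    "('r, 'e) ring_scheme \<Rightarrow> ('r, 'm) cochain \<Rightarrow> (int \<Rightarrow> 'm \<Rightarrow> 'm) \<Rightarrow> int
      \<Rightarrow> ('m \<times> (int \<Rightarrow> 'r) \<Rightarrow>\<^sub>0 int) set \<Rightarrow> ('m \<times> (int \<Rightarrow> 'r) \<Rightarrow>\<^sub>0 int) set" where
  "torus_map R C h n K =
     tensor_map R (obj C n) (laurent_bimodule R) (h n) (\<lambda>p. p) K
       \<ominus>\<^bsub>tensor R (obj C n) (laurent_bimodule R)\<^esub>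
     tensor_map R (obj C n) (laurent_bimodule R) (\<lambda>x. x)
       (\<lambda>p. laurent_z R \<otimes>\<^bsub>laurent_polynomials R\<^esub> p) K"

definition mapping_torus ::
    "('r, 'e) ring_scheme \<Rightarrow> ('r, 'm) cochain \<Rightarrow> (int \<Rightarrow> 'm \<Rightarrow> 'm)
      \<Rightarrow> (int \<Rightarrow> 'r, ('m \<times> (int \<Rightarrow> 'r) \<Rightarrow>\<^sub>0 int) set \<times> ('m \<times> (int \<Rightarrow> 'r) \<Rightarrow>\<^sub>0 int) set) cochain" where
  "mapping_torus R C h =
     cone (tensor_complex R C (laurent_bimodule R)) (tensor_complex R C (laurent_bimodule R))
       (torus_map R C h)"

text \<open>
  Extension of scalars along the inclusion of the Laurent polynomials into \<open>S\<close>, where \<open>S\<close> is one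
  of the two Novikov rings.
\<close>

definition novikov_complex ::
    "('r, 'e) ring_scheme \<Rightarrow> (int \<Rightarrow> 'r) ring \<Rightarrow> (int \<Rightarrow> 'r, 'm) cochain
      \<Rightarrow> (int \<Rightarrow> 'r, ('m \<times> (int \<Rightarrow> 'r) \<Rightarrow>\<^sub>0 int) set) cochain" where
  "novikov_complex R S B = tensor_complex (laurent_polynomials R) B (ring_bimodule (\<lambda>p. p) S)"

end

theory Submission
  imports Defs
begin

text \<open>
  For a finitely presented module \<open>M\<close>, the tensor product of \<open>M\<close> with a Novikov ring is the group of
  Laurent series with coefficients in \<open>M\<close>.  Hence extending the mapping torus to a Novikov ring gives
  the mapping cone of \<open>h - z\<close> on series with coefficients in \<open>C\<close>.  If the supports are bounded above,
  \<open>h - z\<close> is invertible.  If they are bounded below, a cocycle \<open>(x, y)\<close> of this cone is a coboundary: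
  comparing coefficients of \<open>z\<^sup>i\<close>, the equations for a primitive amount to killing a cocycle of the
  mapping cone of \<open>h\<close> that depends on the coefficient at \<open>z\<^sup>i\<^sup>-\<^sup>1\<close>, and if \<open>h\<close> is a quasi-isomorphism,
  this is possible for all \<open>i\<close> in turn.
\<close>


section \<open>Additive maps and module homomorphisms\<close>

text \<open>Without finite presentation the comparison of \<open>M \<otimes> R((z))\<close> with
  \<open>M((z))\<close> can fail on both sides: a finite sum of elementary tensors only reaches
  series with coefficients in a finitely generated submodule, and a kernel can appear when the
  relations are not finitely generated. The torus is tensored twice, over \<open>R\<close> with
  Laurent polynomials and over these with the Novikov ring. Instead of an associativity isomorphism,
  maps in both directions are obtained from universal properties and compared on elementary tensors.
  Polynomials and both kinds of series differ only in a predicate on supports, which is kept as a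
  parameter. The asymmetry between the two Novikov rings comes from the geometric series:
  \<open>- (z^-1 + h z^-2 + h^2 z^-3 + ...)\<close> inverts \<open>h - z\<close> for every
  \<open>h\<close>, and its exponents are bounded above. With exponents bounded below, the inverse
  would be a series in \<open>h^-1\<close>, but a quasi-isomorphism need not be invertible on
  cochains. Only classes can be lifted along it, so each coefficient of a primitive requires a
  choice and a correction by a coboundary.\<close>

lemma abelian_group_homI':
  assumes "abelian_group A" "abelian_group B"
    and "\<And>x. x \<in> carrier A \<Longrightarrow> f x \<in> carrier B"
    and "\<And>x y. \<lbrakk>x \<in> carrier A; y \<in> carrier A\<rbrakk> \<Longrightarrow> f (x \<oplus>\<^bsub>A\<^esub> y) = f x \<oplus>\<^bsub>B\<^esub> f y"
  shows "abelian_group_hom A B f"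
proof (rule abelian_group_homI[OF assms(1,2)])
  interpret A: abelian_group A by fact
  interpret B: abelian_group B by fact
  show "group_hom (add_monoid A) (add_monoid B) f"
    using assms(3,4)
    by (intro group_hom.intro A.a_group B.a_group group_hom_axioms.intro) (auto simp: hom_def)
qed

lemma abelian_group_homD:
  assumes "abelian_group_hom A B f"
  shows "abelian_group A" "abelian_group B"
    and "\<And>x. x \<in> carrier A \<Longrightarrow> f x \<in> carrier B"
    and "\<And>x y. \<lbrakk>x \<in> carrier A; y \<in> carrier A\<rbrakk> \<Longrightarrow> f (x \<oplus>\<^bsub>A\<^esub> y) = f x \<oplus>\<^bsub>B\<^esub> f y"
    and "f \<zero>\<^bsub>A\<^esub> = \<zero>\<^bsub>B\<^esub>"
    and "\<And>x. x \<in> carrier A \<Longrightarrow> f (\<ominus>\<^bsub>A\<^esub> x) = \<ominus>\<^bsub>B\<^esub> f x"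
    and "\<And>x y. \<lbrakk>x \<in> carrier A; y \<in> carrier A\<rbrakk> \<Longrightarrow> f (x \<ominus>\<^bsub>A\<^esub> y) = f x \<ominus>\<^bsub>B\<^esub> f y"
proof -
  interpret abelian_group_hom A B f by fact
  show "abelian_group A" "abelian_group B" ..
  show "\<And>x. x \<in> carrier A \<Longrightarrow> f x \<in> carrier B" by simp
  show "\<And>x y. \<lbrakk>x \<in> carrier A; y \<in> carrier A\<rbrakk> \<Longrightarrow> f (x \<oplus>\<^bsub>A\<^esub> y) = f x \<oplus>\<^bsub>B\<^esub> f y" by simp
  show "f \<zero>\<^bsub>A\<^esub> = \<zero>\<^bsub>B\<^esub>" by simp
  show "\<And>x. x \<in> carrier A \<Longrightarrow> f (\<ominus>\<^bsub>A\<^esub> x) = \<ominus>\<^bsub>B\<^esub> f x" by simp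
  then show "\<And>x y. \<lbrakk>x \<in> carrier A; y \<in> carrier A\<rbrakk> \<Longrightarrow> f (x \<ominus>\<^bsub>A\<^esub> y) = f x \<ominus>\<^bsub>B\<^esub> f y"
    by (simp add: a_minus_def)
qed

lemma abelian_group_hom_compose:
  assumes "abelian_group_hom A B f" "abelian_group_hom B D g"
  shows "abelian_group_hom A D (\<lambda>x. g (f x))"
  using abelian_group_homD[OF assms(1)] abelian_group_homD[OF assms(2)]
  by (intro abelian_group_homI') auto

lemma abelian_group_hom_add:
  assumes "abelian_group_hom A B f" "abelian_group_hom A B g"
  shows "abelian_group_hom A B (\<lambda>x. f x \<oplus>\<^bsub>B\<^esub> g x)"
proof -
  note f = abelian_group_homD[OF assms(1)] and g = abelian_group_homD[OF assms(2)]
  interpret B: abelian_group B by (rule f)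
  show ?thesis
    using f g by (intro abelian_group_homI') (auto simp: B.a_ac)
qed

lemma abelian_group_hom_uminus:
  assumes "abelian_group_hom A B f"
  shows "abelian_group_hom A B (\<lambda>x. \<ominus>\<^bsub>B\<^esub> f x)"
proof -
  note f = abelian_group_homD[OF assms]
  interpret B: abelian_group B by (rule f)
  show ?thesis using f by (intro abelian_group_homI') (auto simp: B.minus_add B.a_comm)
qed

lemma abelian_group_hom_diff:
  assumes "abelian_group_hom A B f" "abelian_group_hom A B g"
  shows "abelian_group_hom A B (\<lambda>x. f x \<ominus>\<^bsub>B\<^esub> g x)"
  unfolding a_minus_def by (rule abelian_group_hom_add[OF assms(1) abelian_group_hom_uminus[OF assms(2)]])

text \<open>Solves the cocycle equation \<open>(h x_i - x_(i-1)) + d y_i = 0\<close> of the torus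
  for the shifted coefficient \<open>x_(i-1)\<close>.\<close>

lemma (in abelian_group) cancel_diff:
  assumes "a \<in> carrier G" "b \<in> carrier G" "c \<in> carrier G" "(a \<ominus> b) \<oplus> c = \<zero>"
  shows "a \<oplus> c = b"
proof -
  have "(a \<oplus> c) \<oplus> (\<ominus> b) = \<zero>"
    using assms by (simp add: minus_eq a_ac)
  then have "\<ominus> (\<ominus> b) = a \<oplus> c"
    using assms by (intro minus_equality) simp_all
  then show ?thesis using assms by simp
qed

lemma rmod_homD:
  assumes "f \<in> rmod_hom R M N"
  shows "\<And>x. x \<in> carrier M \<Longrightarrow> f x \<in> carrier N"
    and "\<And>x y. \<lbrakk>x \<in> carrier M; y \<in> carrier M\<rbrakk> \<Longrightarrow> f (x \<oplus>\<^bsub>M\<^esub> y) = f x \<oplus>\<^bsub>N\<^esub> f y"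
    and "\<And>x r. \<lbrakk>x \<in> carrier M; r \<in> carrier R\<rbrakk> \<Longrightarrow> f (x \<triangleleft>\<^bsub>M\<^esub> r) = f x \<triangleleft>\<^bsub>N\<^esub> r"
  using assms by (auto simp: rmod_hom_def)

lemma rmod_homI:
  assumes "\<And>x. x \<in> carrier M \<Longrightarrow> f x \<in> carrier N"
    and "\<And>x y. \<lbrakk>x \<in> carrier M; y \<in> carrier M\<rbrakk> \<Longrightarrow> f (x \<oplus>\<^bsub>M\<^esub> y) = f x \<oplus>\<^bsub>N\<^esub> f y"
    and "\<And>x r. \<lbrakk>x \<in> carrier M; r \<in> carrier R\<rbrakk> \<Longrightarrow> f (x \<triangleleft>\<^bsub>M\<^esub> r) = f x \<triangleleft>\<^bsub>N\<^esub> r"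
  shows "f \<in> rmod_hom R M N"
  using assms by (auto simp: rmod_hom_def)

lemma right_moduleD:
  assumes "right_module R M"
  shows "ring R" "abelian_group M"
  using assms right_module.axioms by blast+

lemma rmod_hom_abelian_group_hom:
  assumes "f \<in> rmod_hom R M N" "right_module R M" "right_module R N"
  shows "abelian_group_hom M N f"
  using rmod_homD[OF assms(1)] right_moduleD[OF assms(2)] right_moduleD[OF assms(3)]
  by (intro abelian_group_homI') auto

lemma ract_abelian_group_hom:
  assumes "right_module R M" "r \<in> carrier R"
  shows "abelian_group_hom M M (\<lambda>x. x \<triangleleft>\<^bsub>M\<^esub> r)"
proof -
  interpret right_module R M by fact
  show ?thesis
    using assms(2) by (intro abelian_group_homI' M.abelian_group_axioms ract_closed ract_add_left)
qed

context right_module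
begin

lemma ract_zero_left: "r \<in> carrier R \<Longrightarrow> \<zero>\<^bsub>M\<^esub> \<triangleleft>\<^bsub>M\<^esub> r = \<zero>\<^bsub>M\<^esub>"
  using abelian_group_homD(5)[OF ract_abelian_group_hom[OF right_module_axioms]] .

lemma ract_minus_left:
  "\<lbrakk>x \<in> carrier M; r \<in> carrier R\<rbrakk> \<Longrightarrow> (\<ominus>\<^bsub>M\<^esub> x) \<triangleleft>\<^bsub>M\<^esub> r = \<ominus>\<^bsub>M\<^esub> (x \<triangleleft>\<^bsub>M\<^esub> r)"
  using abelian_group_homD(6)[OF ract_abelian_group_hom[OF right_module_axioms]] .

lemma ract_zero_right:
  assumes "x \<in> carrier M"
  shows "x \<triangleleft>\<^bsub>M\<^esub> \<zero>\<^bsub>R\<^esub> = \<zero>\<^bsub>M\<^esub>"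
proof -
  have "abelian_group_hom R M (\<lambda>r. x \<triangleleft>\<^bsub>M\<^esub> r)"
    using assms by (intro abelian_group_homI' R.is_abelian_group M.abelian_group_axioms
        ract_closed ract_add_right)
  from abelian_group_homD(5)[OF this] show ?thesis .
qed

end


section \<open>Tensor products\<close>

lemma keys_diff_subset:
  "\<lbrakk>Poly_Mapping.keys a \<subseteq> A; Poly_Mapping.keys b \<subseteq> A\<rbrakk> \<Longrightarrow> Poly_Mapping.keys (a - b) \<subseteq> A"
  using keys_diff[of a b] by blast

text \<open>
  \<open>N\<close> is a bimodule, except that the left action of \<open>R\<close> is only required to commute with the
  right action of \<open>S\<close>; the module axioms for \<open>S\<close> are repeated because \<open>right_module\<close> does not
  accept record extensions.
\<close>

locale tensor_factors = M: right_module R M + S: ring S + N: abelian_group N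
  for R :: "('r, 'e) ring_scheme" and S :: "('s, 'f) ring_scheme"
    and M :: "('r, 'm) rmodule" and N :: "('r, 's, 'n) bimodule" +
  assumes N_ract_closed: "\<lbrakk>y \<in> carrier N; s \<in> carrier S\<rbrakk> \<Longrightarrow> y \<triangleleft>\<^bsub>N\<^esub> s \<in> carrier N"
    and N_ract_add_left: "\<lbrakk>y \<in> carrier N; y' \<in> carrier N; s \<in> carrier S\<rbrakk>
        \<Longrightarrow> (y \<oplus>\<^bsub>N\<^esub> y') \<triangleleft>\<^bsub>N\<^esub> s = y \<triangleleft>\<^bsub>N\<^esub> s \<oplus>\<^bsub>N\<^esub> y' \<triangleleft>\<^bsub>N\<^esub> s"
    and N_ract_add_right: "\<lbrakk>y \<in> carrier N; s \<in> carrier S; t \<in> carrier S\<rbrakk>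
        \<Longrightarrow> y \<triangleleft>\<^bsub>N\<^esub> (s \<oplus>\<^bsub>S\<^esub> t) = y \<triangleleft>\<^bsub>N\<^esub> s \<oplus>\<^bsub>N\<^esub> y \<triangleleft>\<^bsub>N\<^esub> t"
    and N_ract_assoc: "\<lbrakk>y \<in> carrier N; s \<in> carrier S; t \<in> carrier S\<rbrakk>
        \<Longrightarrow> y \<triangleleft>\<^bsub>N\<^esub> (s \<otimes>\<^bsub>S\<^esub> t) = (y \<triangleleft>\<^bsub>N\<^esub> s) \<triangleleft>\<^bsub>N\<^esub> t"
    and N_ract_one: "y \<in> carrier N \<Longrightarrow> y \<triangleleft>\<^bsub>N\<^esub> \<one>\<^bsub>S\<^esub> = y"
    and lact_closed: "\<lbrakk>r \<in> carrier R; y \<in> carrier N\<rbrakk> \<Longrightarrow> lact N r y \<in> carrier N"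
    and lact_ract: "\<lbrakk>r \<in> carrier R; y \<in> carrier N; s \<in> carrier S\<rbrakk>
        \<Longrightarrow> lact N r (y \<triangleleft>\<^bsub>N\<^esub> s) = lact N r y \<triangleleft>\<^bsub>N\<^esub> s"

text \<open>The target is only an abelian group. Where compatibility with a right action matters, it
  is checked afterwards on elementary tensors, as in \<open>expand_ract\<close>.\<close>

definition balanced ::
    "('r, 'e) ring_scheme \<Rightarrow> ('r, 'm) rmodule \<Rightarrow> ('r, 's, 'n) bimodule \<Rightarrow> ('g, 'h) ring_scheme
      \<Rightarrow> ('m \<Rightarrow> 'n \<Rightarrow> 'g) \<Rightarrow> bool" where
  "balanced R M N G \<beta> \<longleftrightarrow>
     (\<forall>x\<in>carrier M. \<forall>y\<in>carrier N. \<beta> x y \<in> carrier G) \<and>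
     (\<forall>x\<in>carrier M. \<forall>x'\<in>carrier M. \<forall>y\<in>carrier N. \<beta> (x \<oplus>\<^bsub>M\<^esub> x') y = \<beta> x y \<oplus>\<^bsub>G\<^esub> \<beta> x' y) \<and>
     (\<forall>x\<in>carrier M. \<forall>y\<in>carrier N. \<forall>y'\<in>carrier N. \<beta> x (y \<oplus>\<^bsub>N\<^esub> y') = \<beta> x y \<oplus>\<^bsub>G\<^esub> \<beta> x y') \<and>
     (\<forall>x\<in>carrier M. \<forall>r\<in>carrier R. \<forall>y\<in>carrier N. \<beta> (x \<triangleleft>\<^bsub>M\<^esub> r) y = \<beta> x (lact N r y))"

lemma balancedI:
  assumes "\<And>x y. \<lbrakk>x \<in> carrier M; y \<in> carrier N\<rbrakk> \<Longrightarrow> \<beta> x y \<in> carrier G"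
    and "\<And>x x' y. \<lbrakk>x \<in> carrier M; x' \<in> carrier M; y \<in> carrier N\<rbrakk>
      \<Longrightarrow> \<beta> (x \<oplus>\<^bsub>M\<^esub> x') y = \<beta> x y \<oplus>\<^bsub>G\<^esub> \<beta> x' y"
    and "\<And>x y y'. \<lbrakk>x \<in> carrier M; y \<in> carrier N; y' \<in> carrier N\<rbrakk>
      \<Longrightarrow> \<beta> x (y \<oplus>\<^bsub>N\<^esub> y') = \<beta> x y \<oplus>\<^bsub>G\<^esub> \<beta> x y'"
    and "\<And>x r y. \<lbrakk>x \<in> carrier M; r \<in> carrier R; y \<in> carrier N\<rbrakk>
      \<Longrightarrow> \<beta> (x \<triangleleft>\<^bsub>M\<^esub> r) y = \<beta> x (lact N r y)"
  shows "balanced R M N G \<beta>"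
  using assms by (simp add: balanced_def)

lemma balancedD:
  assumes "balanced R M N G \<beta>"
  shows "\<And>x y. \<lbrakk>x \<in> carrier M; y \<in> carrier N\<rbrakk> \<Longrightarrow> \<beta> x y \<in> carrier G"
    and "\<And>x x' y. \<lbrakk>x \<in> carrier M; x' \<in> carrier M; y \<in> carrier N\<rbrakk>
      \<Longrightarrow> \<beta> (x \<oplus>\<^bsub>M\<^esub> x') y = \<beta> x y \<oplus>\<^bsub>G\<^esub> \<beta> x' y"
    and "\<And>x y y'. \<lbrakk>x \<in> carrier M; y \<in> carrier N; y' \<in> carrier N\<rbrakk>
      \<Longrightarrow> \<beta> x (y \<oplus>\<^bsub>N\<^esub> y') = \<beta> x y \<oplus>\<^bsub>G\<^esub> \<beta> x y'"
    and "\<And>x r y. \<lbrakk>x \<in> carrier M; r \<in> carrier R; y \<in> carrier N\<rbrakk>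
      \<Longrightarrow> \<beta> (x \<triangleleft>\<^bsub>M\<^esub> r) y = \<beta> x (lact N r y)"
  using assms by (simp_all add: balanced_def)

section \<open>Elementary tensors and the universal property of the tensor product\<close>

definition tens ::
    "('r, 'e) ring_scheme \<Rightarrow> ('r, 'm) rmodule \<Rightarrow> ('r, 's, 'n) bimodule \<Rightarrow> 'm \<Rightarrow> 'n
      \<Rightarrow> ('m \<times> 'n \<Rightarrow>\<^sub>0 int) set" where
  "tens R M N x y = tensor_null R M N #>\<^bsub>tensor_free M N\<^esub> frag_of (x, y)"

context tensor_factors
begin

abbreviation (input) "null \<equiv> tensor_null R M N"
abbreviation (input) "free \<equiv> tensor_free M N"
abbreviation (input) "T \<equiv> tensor R M N"

lemma free_simps [simp]:
  "x \<in> carrier free \<longleftrightarrow> Poly_Mapping.keys x \<subseteq> carrier M \<times> carrier N"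
  "\<one>\<^bsub>free\<^esub> = 0" "x \<otimes>\<^bsub>free\<^esub> y = x + y"
  "Poly_Mapping.keys x \<subseteq> carrier M \<times> carrier N \<Longrightarrow> inv\<^bsub>free\<^esub> x = - x"
  by (simp_all add: tensor_free_def)

lemma free_comm_group: "comm_group free"
  by (simp add: tensor_free_def abelian_free_Abelian_group)

lemma relators_subset: "tensor_relators R M N \<subseteq> carrier free"
proof
  fix a assume "a \<in> tensor_relators R M N"
  then show "a \<in> carrier free"
    unfolding tensor_relators_def free_simps
    by (elim UnE CollectE exE conjE; hypsubst; intro keys_diff_subset)
      (simp_all add: lact_closed M.ract_closed)
qed

lemma null_subgroup: "subgroup null free"
proof -
  interpret comm_group free by (rule free_comm_group)
  show ?thesis
    unfolding tensor_null_def using relators_subset by (rule generate_is_subgroup)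
qed

lemma null_normal: "null \<lhd> free"
proof -
  interpret comm_group free by (rule free_comm_group)
  show ?thesis by (simp add: normal_iff_subgroup null_subgroup)
qed

lemma null_closed:
  "0 \<in> null" "\<lbrakk>a \<in> null; b \<in> null\<rbrakk> \<Longrightarrow> a + b \<in> null" "a \<in> null \<Longrightarrow> - a \<in> null"
  "\<lbrakk>a \<in> null; b \<in> null\<rbrakk> \<Longrightarrow> a - b \<in> null"
proof -
  interpret subgroup null free by (rule null_subgroup)
  show "0 \<in> null" using one_closed by simp
  show add: "\<lbrakk>a \<in> null; b \<in> null\<rbrakk> \<Longrightarrow> a + b \<in> null" for a b using m_closed[of a b] by simp
  show inv: "a \<in> null \<Longrightarrow> - a \<in> null" for a
    using m_inv_closed mem_carrier by fastforce
  show "\<lbrakk>a \<in> null; b \<in> null\<rbrakk> \<Longrightarrow> a - b \<in> null" using add[of a "- b"] inv[of b] by simp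
qed

lemma relator_null: "a \<in> tensor_relators R M N \<Longrightarrow> a \<in> null"
  by (simp add: tensor_null_def generate.incl)

lemma coset_eq_iff: "null #>\<^bsub>free\<^esub> a = null #>\<^bsub>free\<^esub> b \<longleftrightarrow> a - b \<in> null"
proof
  assume "null #>\<^bsub>free\<^esub> a = null #>\<^bsub>free\<^esub> b"
  moreover have "a \<in> null #>\<^bsub>free\<^esub> a"
    using null_closed(1) by (force simp: r_coset_def)
  ultimately have "a \<in> null #>\<^bsub>free\<^esub> b" by simp
  then show "a - b \<in> null" by (auto simp: r_coset_def)
next
  assume ab: "a - b \<in> null"
  have "x + a \<in> null #>\<^bsub>free\<^esub> b" if "x \<in> null" for x
    using null_closed(2)[OF that ab] by (force simp: r_coset_def algebra_simps)
  moreover have "x + b \<in> null #>\<^bsub>free\<^esub> a" if "x \<in> null" for x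
    using null_closed(4)[OF that ab] by (force simp: r_coset_def algebra_simps)
  ultimately show "null #>\<^bsub>free\<^esub> a = null #>\<^bsub>free\<^esub> b"
    by (auto simp: r_coset_def)
qed

lemma tensor_simps:
  "carrier T = (\<lambda>a. null #>\<^bsub>free\<^esub> a) ` carrier free"
  "\<zero>\<^bsub>T\<^esub> = null"
  "K \<oplus>\<^bsub>T\<^esub> K' = K <#>\<^bsub>free\<^esub> K'"
  "K \<triangleleft>\<^bsub>T\<^esub> s = tensor_map R M N (\<lambda>x. x) (\<lambda>y. y \<triangleleft>\<^bsub>N\<^esub> s) K"
  by (simp_all add: tensor_def Let_def carrier_FactGroup)

lemma zero_coset: "\<zero>\<^bsub>T\<^esub> = null #>\<^bsub>free\<^esub> 0"
  by (simp add: tensor_simps r_coset_def)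

lemma coset_add:
  "\<lbrakk>a \<in> carrier free; b \<in> carrier free\<rbrakk>
    \<Longrightarrow> (null #>\<^bsub>free\<^esub> a) \<oplus>\<^bsub>T\<^esub> (null #>\<^bsub>free\<^esub> b) = null #>\<^bsub>free\<^esub> (a + b)"
  using normal.rcos_sum[OF null_normal, of a b] by (simp add: tensor_simps)

lemma tensor_abelian_group: "abelian_group T"
proof -
  interpret comm_group free by (rule free_comm_group)
  note Q = comm_groupE[OF abelian_FactGroup[OF null_subgroup]]
  show ?thesis
    using Q by (intro abelian_groupI) (auto simp: tensor_def Let_def)
qed

lemma tens_closed: "\<lbrakk>x \<in> carrier M; y \<in> carrier N\<rbrakk> \<Longrightarrow> tens R M N x y \<in> carrier T"
  by (simp add: tensor_simps tens_def)

lemma tens_balanced: "balanced R M N T (tens R M N)"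
proof (rule balancedI)
  note tens_def [simp]
  show "tens R M N (x \<oplus>\<^bsub>M\<^esub> x') y = tens R M N x y \<oplus>\<^bsub>T\<^esub> tens R M N x' y"
    if "x \<in> carrier M" "x' \<in> carrier M" "y \<in> carrier N" for x x' y
  proof -
    have "frag_of (x \<oplus>\<^bsub>M\<^esub> x', y) - frag_of (x, y) - frag_of (x', y) \<in> null"
      using that by (intro relator_null) (auto simp: tensor_relators_def)
    then show ?thesis
      using that by (simp add: coset_add coset_eq_iff diff_diff_eq)
  qed
  show "tens R M N x (y \<oplus>\<^bsub>N\<^esub> y') = tens R M N x y \<oplus>\<^bsub>T\<^esub> tens R M N x y'"
    if "x \<in> carrier M" "y \<in> carrier N" "y' \<in> carrier N" for x y y'
  proof -
    have "frag_of (x, y \<oplus>\<^bsub>N\<^esub> y') - frag_of (x, y) - frag_of (x, y') \<in> null"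
      using that by (intro relator_null) (auto simp: tensor_relators_def)
    then show ?thesis
      using that by (simp add: coset_add coset_eq_iff diff_diff_eq)
  qed
  show "tens R M N (x \<triangleleft>\<^bsub>M\<^esub> r) y = tens R M N x (lact N r y)"
    if "x \<in> carrier M" "r \<in> carrier R" "y \<in> carrier N" for x r y
  proof -
    have "frag_of (x \<triangleleft>\<^bsub>M\<^esub> r, y) - frag_of (x, lact N r y) \<in> null"
      using that by (intro relator_null) (auto simp: tensor_relators_def)
    then show ?thesis
      by (simp add: coset_eq_iff)
  qed
qed (rule tens_closed)

lemma tens_zero_left:
  assumes "y \<in> carrier N"
  shows "tens R M N \<zero>\<^bsub>M\<^esub> y = \<zero>\<^bsub>T\<^esub>"
proof -
  have "abelian_group_hom M T (\<lambda>x. tens R M N x y)"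
    using assms balancedD[OF tens_balanced]
    by (intro abelian_group_homI' M.M.abelian_group_axioms tensor_abelian_group) auto
  from abelian_group_homD(5)[OF this] show ?thesis .
qed

text \<open>Differences take the place of sums and negatives, as in the induction rule for free
  abelian groups to which this reduces after choosing a representative of the coset.\<close>

lemma tensor_induct [consumes 1, case_names zero tens diff]:
  assumes w: "w \<in> carrier T"
    and zero: "P \<zero>\<^bsub>T\<^esub>"
    and tens: "\<And>x y. \<lbrakk>x \<in> carrier M; y \<in> carrier N\<rbrakk> \<Longrightarrow> P (tens R M N x y)"
    and diff: "\<And>u v. \<lbrakk>u \<in> carrier T; v \<in> carrier T; P u; P v\<rbrakk> \<Longrightarrow> P (u \<ominus>\<^bsub>T\<^esub> v)"
  shows "P w"
proof -
  interpret T: abelian_group T by (rule tensor_abelian_group)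
  obtain c where c: "Poly_Mapping.keys c \<subseteq> carrier M \<times> carrier N" "w = null #>\<^bsub>free\<^esub> c"
    using w by (auto simp: tensor_simps)
  have "P (null #>\<^bsub>free\<^esub> c)"
    using c(1)
  proof (rule free_Abelian_group_induct)
    show "P (null #>\<^bsub>free\<^esub> 0)" using zero by (simp add: zero_coset)
  next
    fix a b assume ab: "Poly_Mapping.keys a \<subseteq> carrier M \<times> carrier N" "Poly_Mapping.keys b \<subseteq> carrier M \<times> carrier N"
      "P (null #>\<^bsub>free\<^esub> a)" "P (null #>\<^bsub>free\<^esub> b)"
    have ab': "Poly_Mapping.keys (a - b) \<subseteq> carrier M \<times> carrier N"
      using ab by (intro keys_diff_subset)
    have in_T: "null #>\<^bsub>free\<^esub> a \<in> carrier T" "null #>\<^bsub>free\<^esub> b \<in> carrier T"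
      "null #>\<^bsub>free\<^esub> (a - b) \<in> carrier T"
      using ab ab' by (simp_all add: tensor_simps)
    have "(null #>\<^bsub>free\<^esub> (a - b)) \<oplus>\<^bsub>T\<^esub> (null #>\<^bsub>free\<^esub> b) = null #>\<^bsub>free\<^esub> a"
      using ab ab' by (simp add: coset_add)
    then have "null #>\<^bsub>free\<^esub> (a - b) = (null #>\<^bsub>free\<^esub> a) \<ominus>\<^bsub>T\<^esub> (null #>\<^bsub>free\<^esub> b)"
      using in_T by (metis T.add.inv_solve_right' T.minus_eq)
    then show "P (null #>\<^bsub>free\<^esub> (a - b))"
      using diff[OF in_T(1,2)] ab by simp
  next
    fix p assume "p \<in> carrier M \<times> carrier N"
    then show "P (null #>\<^bsub>free\<^esub> frag_of p)" using tens by (auto simp: tens_def)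
  qed
  then show ?thesis using c by simp
qed

text \<open>The set on which two additive maps agree is closed under differences. Nearly all later
  identities between tensor products are reduced to elementary tensors in this way.\<close>

lemma tensor_hom_eqI:
  assumes "abelian_group_hom T G f" "abelian_group_hom T G g" "w \<in> carrier T"
    and eq: "\<And>x y. \<lbrakk>x \<in> carrier M; y \<in> carrier N\<rbrakk> \<Longrightarrow> f (tens R M N x y) = g (tens R M N x y)"
  shows "f w = g w"
  using assms(3) by (induction w rule: tensor_induct)
    (simp_all add: eq abelian_group_homD[OF assms(1)] abelian_group_homD[OF assms(2)])

text \<open>The extension of \<beta> to the free abelian group kills the three kinds of relators
  exactly because \<beta> is balanced. Hence it kills the subgroup they generate and factors through
  the quotient.\<close>

lemma tensor_universal:
  assumes G: "abelian_group G" and \<beta>: "balanced R M N G \<beta>"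
  obtains \<phi> where "abelian_group_hom T G \<phi>"
    "\<And>x y. \<lbrakk>x \<in> carrier M; y \<in> carrier N\<rbrakk> \<Longrightarrow> \<phi> (tens R M N x y) = \<beta> x y"
proof -
  interpret G: abelian_group G by fact
  interpret free: comm_group free by (rule free_comm_group)
  note b = balancedD[OF \<beta>]
  obtain h where h: "h \<in> hom free (add_monoid G)"
    and h_of: "\<And>p. p \<in> carrier M \<times> carrier N \<Longrightarrow> h (frag_of p) = case_prod \<beta> p"
  proof (rule comm_group.free_Abelian_group_universal[OF G.a_comm_group])
    show "case_prod \<beta> ` (carrier M \<times> carrier N) \<subseteq> carrier (add_monoid G)"
      using b(1) by auto
  qed (auto simp: tensor_free_def)
  interpret h: group_hom free "add_monoid G" h
    by (intro group_hom.intro free.group_axioms G.a_group group_hom_axioms.intro h)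
  have h_diff: "h (a - b) = h a \<ominus>\<^bsub>G\<^esub> h b" and h_car: "h a \<in> carrier G"
    if "Poly_Mapping.keys a \<subseteq> carrier M \<times> carrier N" "Poly_Mapping.keys b \<subseteq> carrier M \<times> carrier N" for a b
  proof -
    have ab: "Poly_Mapping.keys (a - b) \<subseteq> carrier M \<times> carrier N"
      using that by (intro keys_diff_subset)
    have c: "h (a - b) \<in> carrier G" "h b \<in> carrier G"
      using h.hom_closed[of "a - b"] h.hom_closed[of b] ab that by simp_all
    show "h a \<in> carrier G" using h.hom_closed[of a] that by simp
    have "h a = h (a - b) \<oplus>\<^bsub>G\<^esub> h b"
      using h.hom_mult[of "a - b" b] ab that by simp
    then show "h (a - b) = h a \<ominus>\<^bsub>G\<^esub> h b"
      using c by (metis G.a_closed G.add.inv_solve_right' G.minus_eq)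
  qed
  have self_diff: "u \<ominus>\<^bsub>G\<^esub> u = \<zero>\<^bsub>G\<^esub>" if "u \<in> carrier G" for u
    using that by (simp add: G.minus_eq G.r_neg)
  have sum_diff: "(u \<oplus>\<^bsub>G\<^esub> v) \<ominus>\<^bsub>G\<^esub> u \<ominus>\<^bsub>G\<^esub> v = \<zero>\<^bsub>G\<^esub>"
    if "u \<in> carrier G" "v \<in> carrier G" for u v
  proof -
    have "(u \<oplus>\<^bsub>G\<^esub> v) \<ominus>\<^bsub>G\<^esub> u \<ominus>\<^bsub>G\<^esub> v = (u \<oplus>\<^bsub>G\<^esub> v) \<ominus>\<^bsub>G\<^esub> (u \<oplus>\<^bsub>G\<^esub> v)"
      using that by (simp add: G.minus_eq G.minus_add G.a_assoc)
    then show ?thesis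
      using self_diff[of "u \<oplus>\<^bsub>G\<^esub> v"] that by simp
  qed
  have rel: "h a = \<zero>\<^bsub>G\<^esub>" if "a \<in> tensor_relators R M N" for a
    using that unfolding tensor_relators_def
    by (auto simp: h_diff h_of keys_diff_subset b self_diff sum_diff M.ract_closed lact_closed)
  have null_h: "h a = \<zero>\<^bsub>G\<^esub>" if "a \<in> null" for a
    using that unfolding tensor_null_def
  proof (induction rule: generate.induct)
    case one
    show ?case using h.hom_one by simp
  next
    case (incl a)
    then show ?case by (rule rel)
  next
    case (inv a)
    then have "a \<in> carrier free" using relators_subset by blast
    then show ?case using h.hom_inv[of a] rel[OF inv] by (simp add: a_inv_def[symmetric])
  next
    case (eng a b)
    then have "a \<in> carrier free" "b \<in> carrier free"
      using free.generate_in_carrier[OF relators_subset] by blast+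
    then show ?case using h.hom_mult[of a b] eng by simp
  qed
  obtain g where g: "g \<in> hom (free Mod null) (add_monoid G)"
    and gh: "\<And>x. x \<in> carrier free \<Longrightarrow> g (null #>\<^bsub>free\<^esub> x) = h x"
  proof (rule FactGroup_universal[OF h null_normal])
    fix x y assume xy: "x \<in> carrier free" "y \<in> carrier free" "null #>\<^bsub>free\<^esub> x = null #>\<^bsub>free\<^esub> y"
    then have "h x \<ominus>\<^bsub>G\<^esub> h y = \<zero>\<^bsub>G\<^esub>"
      using null_h[of "x - y"] by (simp add: coset_eq_iff h_diff)
    then show "h x = h y"
      using xy h_car[of x y] h_car[of y x] by (simp add: G.minus_eq) (metis G.add.inv_equality G.add.inv_inv G.a_inv_closed)
  qed blast
  show ?thesis
  proof (rule that[of g])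
    show "abelian_group_hom T G g"
      using g by (intro abelian_group_homI' tensor_abelian_group G)
        (auto simp: tensor_def Let_def hom_def)
    show "g (tens R M N x y) = \<beta> x y" if "x \<in> carrier M" "y \<in> carrier N" for x y
      using that by (simp add: tens_def gh h_of)
  qed
qed

end

text \<open>Right linearity of \<open>g\<close> is left out on purpose and only assumed in
  \<open>tensor_map_rmod_hom\<close>: the map \<open>y \<mapsto> y s\<close>, which defines the
  right action on a tensor product, is not right linear over a noncommutative ring.\<close>

locale tensor_factors_hom = A: tensor_factors R S M N + B: tensor_factors R S M' N'
  for R :: "('r, 'e) ring_scheme" and S :: "('s, 'f) ring_scheme"
    and M :: "('r, 'm) rmodule" and N :: "('r, 's, 'n) bimodule"
    and M' :: "('r, 'm1) rmodule" and N' :: "('r, 's, 'n1) bimodule" +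
  fixes f :: "'m \<Rightarrow> 'm1" and g :: "'n \<Rightarrow> 'n1"
  assumes f: "f \<in> rmod_hom R M M'"
    and g: "abelian_group_hom N N' g"
    and g_lact: "\<lbrakk>r \<in> carrier R; y \<in> carrier N\<rbrakk> \<Longrightarrow> g (lact N r y) = lact N' r (g y)"
begin

lemmas f' = rmod_homD[OF f]
lemmas g' = abelian_group_homD[OF g]

abbreviation (input) "F \<equiv> frag_extend (\<lambda>(x, y). frag_of (f x, g y)) :: _ \<Rightarrow> 'm1 \<times> 'n1 \<Rightarrow>\<^sub>0 int"

lemma F_closed:
  assumes "Poly_Mapping.keys a \<subseteq> carrier M \<times> carrier N"
  shows "Poly_Mapping.keys (F a) \<subseteq> carrier M' \<times> carrier N'"
proof -
  have "Poly_Mapping.keys (case q of (x, y) \<Rightarrow> frag_of (f x, g y)) \<subseteq> carrier M' \<times> carrier N'"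
    if "q \<in> Poly_Mapping.keys a" for q
    using that assms f'(1) g'(3) by (cases q) auto
  then show ?thesis
    using keys_frag_extend[of "\<lambda>(x, y). frag_of (f x, g y)" a] by blast
qed

lemma F_relators:
  assumes "a \<in> tensor_relators R M N"
  shows "F a \<in> tensor_relators R M' N'"
  using assms unfolding tensor_relators_def[of R M N]
proof (elim UnE CollectE exE conjE)
  fix x x' y assume a: "a = frag_of (x \<oplus>\<^bsub>M\<^esub> x', y) - frag_of (x, y) - frag_of (x', y)"
    and car: "x \<in> carrier M" "x' \<in> carrier M" "y \<in> carrier N"
  have "F a = frag_of (f x \<oplus>\<^bsub>M'\<^esub> f x', g y) - frag_of (f x, g y) - frag_of (f x', g y)"
    using car by (simp add: a frag_extend_diff f'(2))
  then show ?thesis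
    unfolding tensor_relators_def using car f'(1) g'(3)
    by (intro UnI1 CollectI exI conjI)
next
  fix x y y' assume a: "a = frag_of (x, y \<oplus>\<^bsub>N\<^esub> y') - frag_of (x, y) - frag_of (x, y')"
    and car: "x \<in> carrier M" "y \<in> carrier N" "y' \<in> carrier N"
  have "F a = frag_of (f x, g y \<oplus>\<^bsub>N'\<^esub> g y') - frag_of (f x, g y) - frag_of (f x, g y')"
    using car by (simp add: a frag_extend_diff g'(4))
  then show ?thesis
    unfolding tensor_relators_def using car f'(1) g'(3)
    by (intro UnI1[OF UnI2] CollectI exI conjI)
next
  fix x r y assume a: "a = frag_of (x \<triangleleft>\<^bsub>M\<^esub> r, y) - frag_of (x, lact N r y)"
    and car: "x \<in> carrier M" "r \<in> carrier R" "y \<in> carrier N"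
  have "F a = frag_of (f x \<triangleleft>\<^bsub>M'\<^esub> r, g y) - frag_of (f x, lact N' r (g y))"
    using car by (simp add: a frag_extend_diff f'(3) g_lact)
  then show ?thesis
    unfolding tensor_relators_def using car f'(1) g'(3)
    by (intro UnI2 CollectI exI conjI)
qed

lemma F_null: "a \<in> tensor_null R M N \<Longrightarrow> F a \<in> tensor_null R M' N'"
  unfolding tensor_null_def[of R M N]
proof (induction rule: generate.induct)
  case one
  then show ?case by (simp add: B.null_closed)
next
  case (incl a)
  then show ?case by (intro B.relator_null F_relators)
next
  case (inv a)
  then have "a \<in> carrier (tensor_free M N)" using A.relators_subset by blast
  then show ?case
    using B.null_closed(3)[OF B.relator_null[OF F_relators[OF inv]]] by (simp add: frag_extend_minus)
next
  case (eng a b)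
  then show ?case by (simp add: frag_extend_add B.null_closed)
qed

text \<open>\<open>tensor_map\<close> adds the whole subgroup of null elements to the image of a
  coset. Since \<open>F\<close> sends null elements to null elements by \<open>F_null\<close>, the
  result is the single coset of \<open>F a\<close>.\<close>

lemma tensor_map_coset:
  "tensor_map R M' N' f g (tensor_null R M N #>\<^bsub>tensor_free M N\<^esub> a)
    = tensor_null R M' N' #>\<^bsub>tensor_free M' N'\<^esub> F a"
  (is "?L = ?Q")
proof
  show "?L \<subseteq> ?Q"
  proof
    fix c assume "c \<in> ?L"
    then obtain n m where "n \<in> tensor_null R M' N'" "m \<in> tensor_null R M N" "c = n + F (m + a)"
      by (auto simp: tensor_map_def r_coset_def set_mult_def)
    then have "n + F m \<in> tensor_null R M' N'" "c = (n + F m) + F a"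
      using F_null B.null_closed(2) by (auto simp: frag_extend_add)
    then show "c \<in> ?Q" by (auto simp: r_coset_def)
  qed
  show "?Q \<subseteq> ?L"
  proof
    fix c assume "c \<in> ?Q"
    then obtain n where "n \<in> tensor_null R M' N'" "c = n + F (0 + a)"
      by (auto simp: r_coset_def)
    moreover have "F (0 + a) \<in> F ` (tensor_null R M N #>\<^bsub>tensor_free M N\<^esub> a)"
      using A.null_closed(1) by (intro imageI) (force simp: r_coset_def)
    ultimately show "c \<in> ?L" unfolding tensor_map_def set_mult_def by force
  qed
qed

lemma tensor_map_tens:
  "tensor_map R M' N' f g (tens R M N x y) = tens R M' N' (f x) (g y)"
  by (simp add: tens_def tensor_map_coset)

lemma tensor_map_hom: "abelian_group_hom (tensor R M N) (tensor R M' N') (tensor_map R M' N' f g)"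
proof (intro abelian_group_homI' A.tensor_abelian_group B.tensor_abelian_group)
  fix v w assume v: "v \<in> carrier (tensor R M N)" and w: "w \<in> carrier (tensor R M N)"
  from v w obtain a b where
      a: "v = tensor_null R M N #>\<^bsub>tensor_free M N\<^esub> a" "a \<in> carrier (tensor_free M N)" and
      b: "w = tensor_null R M N #>\<^bsub>tensor_free M N\<^esub> b" "b \<in> carrier (tensor_free M N)"
    unfolding A.tensor_simps(1) by blast
  have F: "F a \<in> carrier (tensor_free M' N')" "F b \<in> carrier (tensor_free M' N')"
    using a(2) b(2) F_closed unfolding A.free_simps B.free_simps by blast+
  then show "tensor_map R M' N' f g v \<in> carrier (tensor R M' N')"
    unfolding B.tensor_simps(1) a(1) tensor_map_coset by (rule_tac imageI)
  show "tensor_map R M' N' f g (v \<oplus>\<^bsub>tensor R M N\<^esub> w)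
      = tensor_map R M' N' f g v \<oplus>\<^bsub>tensor R M' N'\<^esub> tensor_map R M' N' f g w"
    unfolding a(1) b(1) A.coset_add[OF a(2) b(2)] tensor_map_coset B.coset_add[OF F] frag_extend_add ..
qed

end

section \<open>The right module structure on a tensor product\<close>

context tensor_factors
begin

text \<open>By definition the action of \<open>s\<close> is the instance of
  \<open>tensor_map\<close> with the identity on \<open>M\<close> and \<open>y \<mapsto> y s\<close>
  on \<open>N\<close>, so the general facts on such maps apply.\<close>

lemma tensor_ract:
  assumes s: "s \<in> carrier S"
  shows tensor_ract_hom: "abelian_group_hom T T (\<lambda>w. w \<triangleleft>\<^bsub>T\<^esub> s)"
    and tens_ract: "tens R M N x y \<triangleleft>\<^bsub>T\<^esub> s = tens R M N x (y \<triangleleft>\<^bsub>N\<^esub> s)"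
proof -
  interpret tensor_factors_hom R S M N M N "\<lambda>x. x" "\<lambda>y. y \<triangleleft>\<^bsub>N\<^esub> s"
  proof (intro tensor_factors_hom.intro tensor_factors_axioms tensor_factors_hom_axioms.intro)
    show "(\<lambda>x. x) \<in> rmod_hom R M M" by (intro rmod_homI refl)
    show "abelian_group_hom N N (\<lambda>y. y \<triangleleft>\<^bsub>N\<^esub> s)"
      using s by (intro abelian_group_homI' N.abelian_group_axioms N_ract_closed N_ract_add_left)
  qed (use s in \<open>simp add: lact_ract\<close>)
  show "abelian_group_hom T T (\<lambda>w. w \<triangleleft>\<^bsub>T\<^esub> s)"
    using tensor_map_hom by (simp only: tensor_simps(4))
  show "tens R M N x y \<triangleleft>\<^bsub>T\<^esub> s = tens R M N x (y \<triangleleft>\<^bsub>N\<^esub> s)"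
    using tensor_map_tens by (simp only: tensor_simps(4))
qed

text \<open>For fixed scalars, each axiom that involves \<open>s\<close> and \<open>t\<close> or the
  unit equates two additive maps out of the tensor product. On an elementary tensor it becomes the
  corresponding axiom for \<open>N\<close>.\<close>

lemma tensor_right_module: "right_module S T"
proof -
  interpret T: abelian_group T by (rule tensor_abelian_group)
  note tb = balancedD[OF tens_balanced]
  show ?thesis
  proof (intro right_module.intro right_module_axioms.intro T.abelian_group_axioms S.ring_axioms)
    fix v s assume v: "v \<in> carrier T" and s: "s \<in> carrier S"
    show "v \<triangleleft>\<^bsub>T\<^esub> s \<in> carrier T"
      by (rule abelian_group_homD(3)[OF tensor_ract_hom[OF s] v])
  next
    fix v w s assume v: "v \<in> carrier T" and w: "w \<in> carrier T" and s: "s \<in> carrier S"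
    show "(v \<oplus>\<^bsub>T\<^esub> w) \<triangleleft>\<^bsub>T\<^esub> s = v \<triangleleft>\<^bsub>T\<^esub> s \<oplus>\<^bsub>T\<^esub> w \<triangleleft>\<^bsub>T\<^esub> s"
      by (rule abelian_group_homD(4)[OF tensor_ract_hom[OF s] v w])
  next
    fix v s t assume v: "v \<in> carrier T" and s: "s \<in> carrier S" and t: "t \<in> carrier S"
    have st: "s \<oplus>\<^bsub>S\<^esub> t \<in> carrier S" "s \<otimes>\<^bsub>S\<^esub> t \<in> carrier S"
      using s t by simp_all
    show "v \<triangleleft>\<^bsub>T\<^esub> (s \<oplus>\<^bsub>S\<^esub> t) = v \<triangleleft>\<^bsub>T\<^esub> s \<oplus>\<^bsub>T\<^esub> v \<triangleleft>\<^bsub>T\<^esub> t"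
    proof (rule tensor_hom_eqI[where f = "\<lambda>v. v \<triangleleft>\<^bsub>T\<^esub> (s \<oplus>\<^bsub>S\<^esub> t)"
          and g = "\<lambda>v. v \<triangleleft>\<^bsub>T\<^esub> s \<oplus>\<^bsub>T\<^esub> v \<triangleleft>\<^bsub>T\<^esub> t", OF _ _ v])
      show "abelian_group_hom T T (\<lambda>v. v \<triangleleft>\<^bsub>T\<^esub> s \<oplus>\<^bsub>T\<^esub> v \<triangleleft>\<^bsub>T\<^esub> t)"
        by (rule abelian_group_hom_add[OF tensor_ract_hom[OF s] tensor_ract_hom[OF t]])
    qed (use s t st in \<open>simp_all add: tensor_ract_hom tens_ract N_ract_add_right N_ract_closed tb\<close>)
    show "v \<triangleleft>\<^bsub>T\<^esub> (s \<otimes>\<^bsub>S\<^esub> t) = v \<triangleleft>\<^bsub>T\<^esub> s \<triangleleft>\<^bsub>T\<^esub> t"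
    proof (rule tensor_hom_eqI[where f = "\<lambda>v. v \<triangleleft>\<^bsub>T\<^esub> (s \<otimes>\<^bsub>S\<^esub> t)"
          and g = "\<lambda>v. v \<triangleleft>\<^bsub>T\<^esub> s \<triangleleft>\<^bsub>T\<^esub> t", OF _ _ v])
      show "abelian_group_hom T T (\<lambda>v. v \<triangleleft>\<^bsub>T\<^esub> s \<triangleleft>\<^bsub>T\<^esub> t)"
        by (rule abelian_group_hom_compose[OF tensor_ract_hom[OF s] tensor_ract_hom[OF t]])
    qed (use s t st in \<open>simp_all add: tensor_ract_hom tens_ract N_ract_assoc\<close>)
  next
    fix v assume v: "v \<in> carrier T"
    show "v \<triangleleft>\<^bsub>T\<^esub> \<one>\<^bsub>S\<^esub> = v"
    proof (rule tensor_hom_eqI[where f = "\<lambda>v. v \<triangleleft>\<^bsub>T\<^esub> \<one>\<^bsub>S\<^esub>" and g = "\<lambda>v. v", OF _ _ v])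
      show "abelian_group_hom T T (\<lambda>w. w)"
        by (intro abelian_group_homI' T.abelian_group_axioms refl)
    qed (simp_all add: tensor_ract_hom tens_ract N_ract_one)
  qed
qed

end

lemma (in tensor_factors_hom) tensor_map_rmod_hom:
  assumes g_ract: "\<And>y s. \<lbrakk>y \<in> carrier N; s \<in> carrier S\<rbrakk> \<Longrightarrow> g (y \<triangleleft>\<^bsub>N\<^esub> s) = g y \<triangleleft>\<^bsub>N'\<^esub> s"
  shows "tensor_map R M' N' f g \<in> rmod_hom S (tensor R M N) (tensor R M' N')"
proof (rule rmod_homI)
  fix v assume v: "v \<in> carrier (tensor R M N)"
  show "tensor_map R M' N' f g v \<in> carrier (tensor R M' N')"
    by (rule abelian_group_homD(3)[OF tensor_map_hom v])
next
  fix v w assume v: "v \<in> carrier (tensor R M N)" and w: "w \<in> carrier (tensor R M N)"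
  show "tensor_map R M' N' f g (v \<oplus>\<^bsub>tensor R M N\<^esub> w)
      = tensor_map R M' N' f g v \<oplus>\<^bsub>tensor R M' N'\<^esub> tensor_map R M' N' f g w"
    by (rule abelian_group_homD(4)[OF tensor_map_hom v w])
next
  fix v s assume v: "v \<in> carrier (tensor R M N)" and s: "s \<in> carrier S"
  show "tensor_map R M' N' f g (v \<triangleleft>\<^bsub>tensor R M N\<^esub> s)
      = tensor_map R M' N' f g v \<triangleleft>\<^bsub>tensor R M' N'\<^esub> s"
    by (rule A.tensor_hom_eqI[where f = "\<lambda>v. tensor_map R M' N' f g (v \<triangleleft>\<^bsub>tensor R M N\<^esub> s)"
          and g = "\<lambda>v. tensor_map R M' N' f g v \<triangleleft>\<^bsub>tensor R M' N'\<^esub> s",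
          OF abelian_group_hom_compose[OF A.tensor_ract_hom[OF s] tensor_map_hom]
            abelian_group_hom_compose[OF tensor_map_hom B.tensor_ract_hom[OF s]] v])
      (simp add: A.tens_ract B.tens_ract tensor_map_tens g_ract s)
qed


section \<open>Laurent series with coefficients in a module\<close>

lemma abelian_group_hom_finsum:
  assumes "abelian_group_hom A B f" and "g \<in> I \<rightarrow> carrier A"
  shows "f (finsum A g I) = finsum B (\<lambda>i. f (g i)) I"
proof -
  note f = abelian_group_homD[OF assms(1)]
  interpret A: abelian_group A by (rule f)
  interpret B: abelian_group B by (rule f)
  show ?thesis
    using assms(2)
  proof (induction I rule: infinite_finite_induct)
    case (insert i I)
    then have "g i \<in> carrier A" "g \<in> I \<rightarrow> carrier A" by auto
    with insert show ?case
      by (simp add: A.finsum_insert B.finsum_insert f Pi_iff)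
  qed (simp_all add: f)
qed

lemma (in abelian_group) finsum_swap:
  assumes "finite I" "finite K" "\<And>i k. \<lbrakk>i \<in> I; k \<in> K\<rbrakk> \<Longrightarrow> g i k \<in> carrier G"
  shows "(\<Oplus>i\<in>I. \<Oplus>k\<in>K. g i k) = (\<Oplus>k\<in>K. \<Oplus>i\<in>I. g i k)"
  using assms(1,3)
proof (induction I)
  case (insert i I)
  have *: "(\<Oplus>i\<in>insert i I. g i k) = g i k \<oplus> (\<Oplus>i\<in>I. g i k)" if "k \<in> K" for k
    using insert that by (intro finsum_insert) auto
  have "(\<Oplus>i\<in>insert i I. \<Oplus>k\<in>K. g i k) = (\<Oplus>k\<in>K. g i k) \<oplus> (\<Oplus>i\<in>I. \<Oplus>k\<in>K. g i k)"
    using insert by (intro finsum_insert) (auto intro!: finsum_closed)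
  also have "\<dots> = (\<Oplus>k\<in>K. g i k) \<oplus> (\<Oplus>k\<in>K. \<Oplus>i\<in>I. g i k)"
    using insert by simp
  also have "\<dots> = (\<Oplus>k\<in>K. g i k \<oplus> (\<Oplus>i\<in>I. g i k))"
    using insert by (intro finsum_addf[symmetric]) (auto intro!: finsum_closed)
  also have "\<dots> = (\<Oplus>k\<in>K. \<Oplus>i\<in>insert i I. g i k)"
    using insert * by (intro finsum_cong') (auto intro!: finsum_closed)
  finally show ?case .
qed (simp add: assms(2))

text \<open>With \<open>R\<close> viewed as a right module over itself, multiplication of Laurent
  series becomes an instance of \<open>series_act\<close>. The ring axioms for series are then
  special cases of the module axioms.\<close>

definition regular_module :: "('r, 'e) ring_scheme \<Rightarrow> ('r, 'r) rmodule" where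
  "regular_module R = \<lparr>carrier = carrier R, monoid.mult = undefined, one = undefined,
     ring.zero = \<zero>\<^bsub>R\<^esub>, ring.add = ring.add R, ract = (\<lambda>x r. x \<otimes>\<^bsub>R\<^esub> r)\<rparr>"

lemma regular_module_simps [simp]:
  "carrier (regular_module R) = carrier R" "\<zero>\<^bsub>regular_module R\<^esub> = \<zero>\<^bsub>R\<^esub>"
  "x \<oplus>\<^bsub>regular_module R\<^esub> y = x \<oplus>\<^bsub>R\<^esub> y" "x \<triangleleft>\<^bsub>regular_module R\<^esub> r = x \<otimes>\<^bsub>R\<^esub> r"
  by (simp_all add: regular_module_def)

lemma finsum_regular_module: "finsum (regular_module R) = finsum R"
  by (simp add: finsum_def finprod_def regular_module_def fun_eq_iff)

lemma regular_module_right_module: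
  assumes "ring R"
  shows "right_module R (regular_module R)"
proof -
  interpret ring R by fact
  have "abelian_group (regular_module R)"
    using abelian_groupE[OF is_abelian_group] by (intro abelian_groupI) auto
  then show ?thesis
    by (intro right_module.intro right_module_axioms.intro ring_axioms)
      (auto simp: l_distr r_distr m_assoc)
qed

text \<open>This copies the convolution in \<open>laurent_ring\<close>. Over an infinite index set
  \<open>finsum\<close> would return zero; for the supports considered below the index set is
  finite.\<close>

definition series_act ::
    "('r, 'e) ring_scheme \<Rightarrow> ('r, 'm) rmodule \<Rightarrow> (int \<Rightarrow> 'm) \<Rightarrow> (int \<Rightarrow> 'r) \<Rightarrow> int \<Rightarrow> 'm" where
  "series_act R M m s =
     (\<lambda>n. \<Oplus>\<^bsub>M\<^esub>i\<in>{i. m i \<noteq> \<zero>\<^bsub>M\<^esub> \<and> s (n - i) \<noteq> \<zero>\<^bsub>R\<^esub>}. m i \<triangleleft>\<^bsub>M\<^esub> s (n - i))"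

definition series_module ::
    "(int set \<Rightarrow> bool) \<Rightarrow> ('r, 'e) ring_scheme \<Rightarrow> ('r, 'm) rmodule \<Rightarrow> (int \<Rightarrow> 'r, int \<Rightarrow> 'm) rmodule" where
  "series_module P R M = \<lparr>carrier = {m. range m \<subseteq> carrier M \<and> P {i. m i \<noteq> \<zero>\<^bsub>M\<^esub>}},
     monoid.mult = undefined, one = undefined,
     ring.zero = (\<lambda>i. \<zero>\<^bsub>M\<^esub>), ring.add = (\<lambda>m m' i. m i \<oplus>\<^bsub>M\<^esub> m' i), ract = series_act R M\<rparr>"

definition const_series :: "('r, 'm) rmodule \<Rightarrow> 'm \<Rightarrow> int \<Rightarrow> 'm" where
  "const_series M x = (\<lambda>i. if i = 0 then x else \<zero>\<^bsub>M\<^esub>)"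

lemma series_module_simps:
  "m \<in> carrier (series_module P R M) \<longleftrightarrow> (\<forall>i. m i \<in> carrier M) \<and> P {i. m i \<noteq> \<zero>\<^bsub>M\<^esub>}"
  "\<zero>\<^bsub>series_module P R M\<^esub> = (\<lambda>i. \<zero>\<^bsub>M\<^esub>)"
  "m \<oplus>\<^bsub>series_module P R M\<^esub> m' = (\<lambda>i. m i \<oplus>\<^bsub>M\<^esub> m' i)"
  "m \<triangleleft>\<^bsub>series_module P R M\<^esub> s = series_act R M m s"
  by (auto simp: series_module_def)

lemma laurent_ring_simps:
  "s \<in> carrier (laurent_ring P R) \<longleftrightarrow> (\<forall>i. s i \<in> carrier R) \<and> P {i. s i \<noteq> \<zero>\<^bsub>R\<^esub>}"
  "\<zero>\<^bsub>laurent_ring P R\<^esub> = (\<lambda>i. \<zero>\<^bsub>R\<^esub>)"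
  "\<one>\<^bsub>laurent_ring P R\<^esub> = laurent_const R \<one>\<^bsub>R\<^esub>"
  "s \<oplus>\<^bsub>laurent_ring P R\<^esub> t = (\<lambda>i. s i \<oplus>\<^bsub>R\<^esub> t i)"
  "s \<otimes>\<^bsub>laurent_ring P R\<^esub> t = series_act R (regular_module R) s t"
  by (auto simp: laurent_ring_def laurent_const_def series_act_def finsum_regular_module)

lemma const_series_regular: "const_series (regular_module R) r = laurent_const R r"
  by (simp add: const_series_def laurent_const_def fun_eq_iff)

text \<open>These closure properties are what the product of series requires:
  \<open>supp_conv\<close> makes every coefficient a finite sum, and \<open>supp_sum\<close> keeps
  products inside the chosen class. They hold for finite sets, for sets bounded below and for sets
  bounded above.\<close>

locale laurent_support =
  fixes P :: "int set \<Rightarrow> bool"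
  assumes supp_finite: "finite A \<Longrightarrow> P A"
    and supp_subset: "\<lbrakk>P B; A \<subseteq> B\<rbrakk> \<Longrightarrow> P A"
    and supp_Un: "\<lbrakk>P A; P B\<rbrakk> \<Longrightarrow> P (A \<union> B)"
    and supp_sum: "\<lbrakk>P A; P B\<rbrakk> \<Longrightarrow> P {i + j | i j. i \<in> A \<and> j \<in> B}"
    and supp_conv: "\<lbrakk>P A; P B\<rbrakk> \<Longrightarrow> finite {i \<in> A. n - i \<in> B}"

lemma laurent_support_finite: "laurent_support finite"
proof
  show "finite {i + j | i j. i \<in> A \<and> j \<in> B}" if "finite A" "finite B" for A B :: "int set"
    using finite_image_set2[of "\<lambda>i. i \<in> A" "\<lambda>j. j \<in> B" "(+)"] that by simp
qed (auto intro: finite_subset)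

lemma laurent_support_bdd_below: "laurent_support (bdd_below :: int set \<Rightarrow> bool)"
proof
  fix A B :: "int set" and n
  assume "bdd_below A" "bdd_below B"
  then obtain a b where ab: "\<And>i. i \<in> A \<Longrightarrow> a \<le> i" "\<And>j. j \<in> B \<Longrightarrow> b \<le> j"
    unfolding bdd_below_def by blast
  have "{i \<in> A. n - i \<in> B} \<subseteq> {a..n - b}"
    using ab by fastforce
  then show "finite {i \<in> A. n - i \<in> B}" by (rule finite_subset) simp
  show "bdd_below {i + j | i j. i \<in> A \<and> j \<in> B}"
    by (rule bdd_belowI[of _ "a + b"]) (auto intro: add_mono ab)
qed (auto intro: bdd_below_mono)

lemma laurent_support_bdd_above: "laurent_support (bdd_above :: int set \<Rightarrow> bool)"
proof
  fix A B :: "int set" and n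
  assume "bdd_above A" "bdd_above B"
  then obtain a b where ab: "\<And>i. i \<in> A \<Longrightarrow> i \<le> a" "\<And>j. j \<in> B \<Longrightarrow> j \<le> b"
    unfolding bdd_above_def by blast
  have "{i \<in> A. n - i \<in> B} \<subseteq> {n - b..a}"
    using ab by fastforce
  then show "finite {i \<in> A. n - i \<in> B}" by (rule finite_subset) simp
  show "bdd_above {i + j | i j. i \<in> A \<and> j \<in> B}"
    by (rule bdd_aboveI[of _ "a + b"]) (auto intro: add_mono ab)
qed (auto intro: bdd_above_mono)

section \<open>The module of series over the ring of series\<close>

locale laurent = right_module R M + laurent_support P
  for R :: "('r, 'e) ring_scheme" and M :: "('r, 'm) rmodule" and P
begin

abbreviation (input) "S \<equiv> laurent_ring P R"
abbreviation (input) "Mz \<equiv> series_module P R M"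

text \<open>The index set in \<open>series_act\<close> depends on both factors. Replacing it by any
  finite set that contains it allows sums with different factors to be compared over a common
  range.\<close>

lemma act_eq_finsum:
  assumes "\<And>i. m i \<in> carrier M" "\<And>i. s i \<in> carrier R" "finite A"
    and "\<And>i. \<lbrakk>m i \<noteq> \<zero>\<^bsub>M\<^esub>; s (n - i) \<noteq> \<zero>\<^bsub>R\<^esub>\<rbrakk> \<Longrightarrow> i \<in> A"
  shows "series_act R M m s n = (\<Oplus>\<^bsub>M\<^esub>i\<in>A. m i \<triangleleft>\<^bsub>M\<^esub> s (n - i))"
  unfolding series_act_def
  by (rule M.add.finprod_mono_neutral_cong_left)
    (use assms in \<open>auto simp: ract_zero_left ract_zero_right ract_closed\<close>)

lemma conv_finite:
  assumes "m \<in> carrier Mz" "s \<in> carrier S"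
  shows "finite {i. m i \<noteq> \<zero>\<^bsub>M\<^esub> \<and> s (n - i) \<noteq> \<zero>\<^bsub>R\<^esub>}"
  using assms supp_conv[of "{i. m i \<noteq> \<zero>\<^bsub>M\<^esub>}" "{i. s i \<noteq> \<zero>\<^bsub>R\<^esub>}" n]
  by (simp add: series_module_simps laurent_ring_simps)

lemma series_add_closed: "\<lbrakk>m \<in> carrier Mz; m' \<in> carrier Mz\<rbrakk> \<Longrightarrow> m \<oplus>\<^bsub>Mz\<^esub> m' \<in> carrier Mz"
  using supp_subset[OF supp_Un[of "{i. m i \<noteq> \<zero>\<^bsub>M\<^esub>}" "{i. m' i \<noteq> \<zero>\<^bsub>M\<^esub>}"],
      of "{i. m i \<oplus>\<^bsub>M\<^esub> m' i \<noteq> \<zero>\<^bsub>M\<^esub>}"]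
  by (fastforce simp: series_module_simps)

lemma series_pointwise_closed:
  assumes m: "m \<in> carrier Mz" and f: "\<And>x. x \<in> carrier M \<Longrightarrow> f x \<in> carrier M'" "f \<zero>\<^bsub>M\<^esub> = \<zero>\<^bsub>M'\<^esub>"
  shows "(\<lambda>i. f (m i)) \<in> carrier (series_module P R M')"
proof -
  have "P {i. f (m i) \<noteq> \<zero>\<^bsub>M'\<^esub>}"
    using m f(2)
    by (intro supp_subset[of "{i. m i \<noteq> \<zero>\<^bsub>M\<^esub>}" "{i. f (m i) \<noteq> \<zero>\<^bsub>M'\<^esub>}"])
      (auto simp: series_module_simps)
  then show ?thesis using m f(1) by (simp add: series_module_simps)
qed

lemma series_abelian_group: "abelian_group Mz"
proof (rule abelian_groupI)
  show "\<zero>\<^bsub>Mz\<^esub> \<in> carrier Mz"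
    using supp_finite[of "{}"] by (simp add: series_module_simps)
  fix m assume m: "m \<in> carrier Mz"
  have "(\<lambda>i. \<ominus>\<^bsub>M\<^esub> m i) \<in> carrier Mz"
    by (rule series_pointwise_closed[OF m]) simp_all
  then show "\<exists>m'\<in>carrier Mz. m' \<oplus>\<^bsub>Mz\<^esub> m = \<zero>\<^bsub>Mz\<^esub>"
    using m by (intro bexI[of _ "\<lambda>i. \<ominus>\<^bsub>M\<^esub> m i"]) (auto simp: series_module_simps M.l_neg)
qed (auto simp: series_module_simps(1) M.a_ac series_module_simps(2-3)
    intro!: series_add_closed[unfolded series_module_simps(1,3), THEN conjunct2])

text \<open>A nonzero coefficient in degree \<open>n\<close> needs a nonempty index set, which puts
  \<open>n\<close> into the sum of the two supports.\<close>

lemma act_closed: "\<lbrakk>m \<in> carrier Mz; s \<in> carrier S\<rbrakk> \<Longrightarrow> series_act R M m s \<in> carrier Mz"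
proof -
  assume m: "m \<in> carrier Mz" and s: "s \<in> carrier S"
  have "series_act R M m s n \<in> carrier M" for n
    using m s unfolding series_act_def
    by (auto simp: series_module_simps laurent_ring_simps ract_closed intro!: M.finsum_closed)
  moreover have "{n. series_act R M m s n \<noteq> \<zero>\<^bsub>M\<^esub>}
      \<subseteq> {i + j | i j. i \<in> {i. m i \<noteq> \<zero>\<^bsub>M\<^esub>} \<and> j \<in> {j. s j \<noteq> \<zero>\<^bsub>R\<^esub>}}"
  proof
    fix n assume "n \<in> {n. series_act R M m s n \<noteq> \<zero>\<^bsub>M\<^esub>}"
    then have "{i. m i \<noteq> \<zero>\<^bsub>M\<^esub> \<and> s (n - i) \<noteq> \<zero>\<^bsub>R\<^esub>} \<noteq> {}"
      unfolding series_act_def by force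
    then obtain i where "m i \<noteq> \<zero>\<^bsub>M\<^esub>" "s (n - i) \<noteq> \<zero>\<^bsub>R\<^esub>" by blast
    then show "n \<in> {i + j | i j. i \<in> {i. m i \<noteq> \<zero>\<^bsub>M\<^esub>} \<and> j \<in> {j. s j \<noteq> \<zero>\<^bsub>R\<^esub>}}"
      by (intro CollectI exI[of _ i] exI[of _ "n - i"]) simp
  qed
  moreover have "P {i + j | i j. i \<in> {i. m i \<noteq> \<zero>\<^bsub>M\<^esub>} \<and> j \<in> {j. s j \<noteq> \<zero>\<^bsub>R\<^esub>}}"
    using m s by (intro supp_sum) (simp_all add: series_module_simps laurent_ring_simps)
  ultimately show ?thesis
    using supp_subset by (simp add: series_module_simps)
qed

lemma act_add_left:
  assumes "m \<in> carrier Mz" "m' \<in> carrier Mz" "s \<in> carrier S"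
  shows "series_act R M (m \<oplus>\<^bsub>Mz\<^esub> m') s = series_act R M m s \<oplus>\<^bsub>Mz\<^esub> series_act R M m' s"
proof
  fix n
  let ?A = "{i. m i \<noteq> \<zero>\<^bsub>M\<^esub> \<and> s (n - i) \<noteq> \<zero>\<^bsub>R\<^esub>} \<union> {i. m' i \<noteq> \<zero>\<^bsub>M\<^esub> \<and> s (n - i) \<noteq> \<zero>\<^bsub>R\<^esub>}"
  have A: "finite ?A" using assms conv_finite by simp
  have car: "m i \<in> carrier M" "m' i \<in> carrier M" "s i \<in> carrier R" for i
    using assms by (auto simp: series_module_simps laurent_ring_simps)
  have "series_act R M (m \<oplus>\<^bsub>Mz\<^esub> m') s n = (\<Oplus>\<^bsub>M\<^esub>i\<in>?A. (m i \<oplus>\<^bsub>M\<^esub> m' i) \<triangleleft>\<^bsub>M\<^esub> s (n - i))"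
    unfolding series_module_simps using car by (intro act_eq_finsum[OF _ _ A]) auto
  also have "\<dots> = (\<Oplus>\<^bsub>M\<^esub>i\<in>?A. m i \<triangleleft>\<^bsub>M\<^esub> s (n - i) \<oplus>\<^bsub>M\<^esub> m' i \<triangleleft>\<^bsub>M\<^esub> s (n - i))"
    using car by (simp add: ract_add_left)
  also have "\<dots> = (\<Oplus>\<^bsub>M\<^esub>i\<in>?A. m i \<triangleleft>\<^bsub>M\<^esub> s (n - i)) \<oplus>\<^bsub>M\<^esub> (\<Oplus>\<^bsub>M\<^esub>i\<in>?A. m' i \<triangleleft>\<^bsub>M\<^esub> s (n - i))"
    using car by (intro M.finsum_addf) (auto simp: ract_closed)
  also have "(\<Oplus>\<^bsub>M\<^esub>i\<in>?A. m i \<triangleleft>\<^bsub>M\<^esub> s (n - i)) = series_act R M m s n"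
    using car by (intro act_eq_finsum[OF _ _ A, symmetric]) auto
  also have "(\<Oplus>\<^bsub>M\<^esub>i\<in>?A. m' i \<triangleleft>\<^bsub>M\<^esub> s (n - i)) = series_act R M m' s n"
    using car by (intro act_eq_finsum[OF _ _ A, symmetric]) auto
  finally show "series_act R M (m \<oplus>\<^bsub>Mz\<^esub> m') s n = (series_act R M m s \<oplus>\<^bsub>Mz\<^esub> series_act R M m' s) n"
    by (simp add: series_module_simps)
qed

lemma act_add_right:
  assumes "m \<in> carrier Mz" "s \<in> carrier S" "t \<in> carrier S"
  shows "series_act R M m (s \<oplus>\<^bsub>S\<^esub> t) = series_act R M m s \<oplus>\<^bsub>Mz\<^esub> series_act R M m t"
proof
  fix n
  let ?A = "{i. m i \<noteq> \<zero>\<^bsub>M\<^esub> \<and> s (n - i) \<noteq> \<zero>\<^bsub>R\<^esub>} \<union> {i. m i \<noteq> \<zero>\<^bsub>M\<^esub> \<and> t (n - i) \<noteq> \<zero>\<^bsub>R\<^esub>}"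
  have A: "finite ?A" using assms conv_finite by simp
  have car: "m i \<in> carrier M" "s i \<in> carrier R" "t i \<in> carrier R" for i
    using assms by (auto simp: series_module_simps laurent_ring_simps)
  have "series_act R M m (s \<oplus>\<^bsub>S\<^esub> t) n = (\<Oplus>\<^bsub>M\<^esub>i\<in>?A. m i \<triangleleft>\<^bsub>M\<^esub> (s (n - i) \<oplus>\<^bsub>R\<^esub> t (n - i)))"
    unfolding laurent_ring_simps using car by (intro act_eq_finsum[OF _ _ A]) auto
  also have "\<dots> = (\<Oplus>\<^bsub>M\<^esub>i\<in>?A. m i \<triangleleft>\<^bsub>M\<^esub> s (n - i) \<oplus>\<^bsub>M\<^esub> m i \<triangleleft>\<^bsub>M\<^esub> t (n - i))"
    using car by (simp add: ract_add_right)
  also have "\<dots> = (\<Oplus>\<^bsub>M\<^esub>i\<in>?A. m i \<triangleleft>\<^bsub>M\<^esub> s (n - i)) \<oplus>\<^bsub>M\<^esub> (\<Oplus>\<^bsub>M\<^esub>i\<in>?A. m i \<triangleleft>\<^bsub>M\<^esub> t (n - i))"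
    using car by (intro M.finsum_addf) (auto simp: ract_closed)
  also have "(\<Oplus>\<^bsub>M\<^esub>i\<in>?A. m i \<triangleleft>\<^bsub>M\<^esub> s (n - i)) = series_act R M m s n"
    using car by (intro act_eq_finsum[OF _ _ A, symmetric]) auto
  also have "(\<Oplus>\<^bsub>M\<^esub>i\<in>?A. m i \<triangleleft>\<^bsub>M\<^esub> t (n - i)) = series_act R M m t n"
    using car by (intro act_eq_finsum[OF _ _ A, symmetric]) auto
  finally show "series_act R M m (s \<oplus>\<^bsub>S\<^esub> t) n = (series_act R M m s \<oplus>\<^bsub>Mz\<^esub> series_act R M m t) n"
    by (simp add: series_module_simps)
qed

lemma act_const:
  assumes "x \<in> carrier M" "\<And>i. s i \<in> carrier R"
  shows "series_act R M (const_series M x) s = (\<lambda>n. x \<triangleleft>\<^bsub>M\<^esub> s n)"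
proof
  fix n
  have "series_act R M (const_series M x) s n
      = (\<Oplus>\<^bsub>M\<^esub>i\<in>{0}. const_series M x i \<triangleleft>\<^bsub>M\<^esub> s (n - i))"
    using assms by (intro act_eq_finsum) (auto simp: const_series_def split: if_splits)
  then show "series_act R M (const_series M x) s n = x \<triangleleft>\<^bsub>M\<^esub> s n"
    using assms by (simp add: const_series_def ract_closed)
qed

lemma const_closed: "x \<in> carrier M \<Longrightarrow> const_series M x \<in> carrier Mz"
  by (auto simp: series_module_simps const_series_def intro!: supp_finite)

lemma act_one:
  assumes "m \<in> carrier Mz"
  shows "series_act R M m \<one>\<^bsub>S\<^esub> = m"
proof
  fix n
  have "series_act R M m \<one>\<^bsub>S\<^esub> n = (\<Oplus>\<^bsub>M\<^esub>i\<in>{n}. m i \<triangleleft>\<^bsub>M\<^esub> \<one>\<^bsub>S\<^esub> (n - i))"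
    using assms by (intro act_eq_finsum)
      (auto simp: series_module_simps laurent_ring_simps laurent_const_def split: if_splits)
  then show "series_act R M m \<one>\<^bsub>S\<^esub> n = m n"
    using assms by (simp add: series_module_simps laurent_ring_simps laurent_const_def
        ract_closed ract_one)
qed

text \<open>In degree \<open>n\<close> both sides are the double sum of
  \<open>m_i s_(k-i) t_(n-k)\<close> over the same finite rectangle of pairs \<open>(i, k)\<close>,
  taken in the two possible orders.\<close>

lemma act_assoc:
  assumes m: "m \<in> carrier Mz" and s: "s \<in> carrier S" and t: "t \<in> carrier S"
  shows "series_act R M m (s \<otimes>\<^bsub>S\<^esub> t) = series_act R M (series_act R M m s) t"
proof
  fix n
  \<comment> \<open>The product \<open>s t\<close> is an action on the regular module, so the facts
    about \<open>series_act\<close> also describe its coefficients.\<close>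
  have reg: "laurent R (regular_module R) P"
    by (intro laurent.intro regular_module_right_module R.ring_axioms laurent_support_axioms)
  define A where "A = {i. m i \<noteq> \<zero>\<^bsub>M\<^esub>}"
  define B where "B = {i. s i \<noteq> \<zero>\<^bsub>R\<^esub>}"
  define D where "D = {i. t i \<noteq> \<zero>\<^bsub>R\<^esub>}"
  note supps = A_def B_def D_def
  have P: "P A" "P B" "P D"
    using m s t by (auto simp: series_module_simps laurent_ring_simps supps)
  have car: "m i \<in> carrier M" "s i \<in> carrier R" "t i \<in> carrier R" for i
    using m s t by (auto simp: series_module_simps laurent_ring_simps)
  have car_ms: "series_act R M m s i \<in> carrier M" for i
    using act_closed[OF m s] by (simp add: series_module_simps)
  have s': "s \<in> carrier (series_module P R (regular_module R))"
    using s by (simp add: series_module_simps laurent_ring_simps)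
  have car_st: "series_act R (regular_module R) s t i \<in> carrier R" for i
    using laurent.act_closed[OF reg s' t] by (simp add: series_module_simps)
  define U where "U = {i + j | i j. i \<in> A \<and> j \<in> B}"
  define V where "V = {i + j | i j. i \<in> B \<and> j \<in> D}"
  have in_U: "k \<in> U" if "i \<in> A" "k - i \<in> B" for i k
    unfolding U_def using that by (intro CollectI exI[of _ i] exI[of _ "k - i"]) simp
  have in_V: "l \<in> V" if "j \<in> B" "l - j \<in> D" for j l
    unfolding V_def using that by (intro CollectI exI[of _ j] exI[of _ "l - j"]) simp
  \<comment> \<open>\<open>K\<close> contains the degrees in which \<open>m s\<close> can meet
    \<open>t\<close> in total degree \<open>n\<close>, and \<open>I\<close> those in which
    \<open>m\<close> can meet \<open>s t\<close>. Both are finite by \<open>supp_conv\<close>,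
    applied to a support and a sum of supports.\<close>
  define K where "K = {k \<in> U. n - k \<in> D}"
  define I where "I = {i \<in> A. n - i \<in> V}"
  have fin: "finite K" "finite I"
    unfolding K_def I_def U_def V_def
    using supp_conv[OF supp_sum[OF P(1,2)] P(3)] supp_conv[OF P(1) supp_sum[OF P(2,3)]] by simp_all
  have supp_ms: "k \<in> U" if "series_act R M m s k \<noteq> \<zero>\<^bsub>M\<^esub>" for k
  proof -
    have "{i. m i \<noteq> \<zero>\<^bsub>M\<^esub> \<and> s (k - i) \<noteq> \<zero>\<^bsub>R\<^esub>} \<noteq> {}"
      using that unfolding series_act_def by force
    then show ?thesis using in_U by (auto simp: supps)
  qed
  have supp_st: "l \<in> V" if "series_act R (regular_module R) s t l \<noteq> \<zero>\<^bsub>R\<^esub>" for l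
  proof -
    have "{i. s i \<noteq> \<zero>\<^bsub>R\<^esub> \<and> t (l - i) \<noteq> \<zero>\<^bsub>R\<^esub>} \<noteq> {}"
      using that unfolding series_act_def finsum_regular_module by force
    then show ?thesis using in_V by (auto simp: supps)
  qed
  \<comment> \<open>The shift \<open>j = k - i\<close> expresses the inner sum through the outer
    variable \<open>k\<close>, so that its range \<open>K\<close> no longer depends on
    \<open>i\<close>.\<close>
  have st: "series_act R (regular_module R) s t (n - i) = (\<Oplus>\<^bsub>R\<^esub>k\<in>K. s (k - i) \<otimes>\<^bsub>R\<^esub> t (n - k))"
    if "i \<in> I" for i
  proof -
    have inj: "inj_on (\<lambda>k. k - i) K" by (simp add: inj_on_def)
    have "series_act R (regular_module R) s t (n - i)
        = (\<Oplus>\<^bsub>regular_module R\<^esub>j\<in>(\<lambda>k. k - i) ` K. s j \<triangleleft>\<^bsub>regular_module R\<^esub> t (n - i - j))"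
    proof (rule laurent.act_eq_finsum[OF reg])
      fix j assume "s j \<noteq> \<zero>\<^bsub>regular_module R\<^esub>" "t (n - i - j) \<noteq> \<zero>\<^bsub>R\<^esub>"
      then have "i + j \<in> K"
        using \<open>i \<in> I\<close> in_U[of i "i + j"] by (simp add: K_def I_def supps algebra_simps)
      then show "j \<in> (\<lambda>k. k - i) ` K" by (force intro: image_eqI[of _ _ "i + j"])
    qed (use car fin in simp_all)
    also have "\<dots> = (\<Oplus>\<^bsub>R\<^esub>j\<in>(\<lambda>k. k - i) ` K. s j \<otimes>\<^bsub>R\<^esub> t (n - i - j))"
      by (simp add: finsum_regular_module)
    also have "\<dots> = (\<Oplus>\<^bsub>R\<^esub>k\<in>K. s (k - i) \<otimes>\<^bsub>R\<^esub> t (n - i - (k - i)))"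
      using car inj by (intro R.finsum_reindex) auto
    finally show ?thesis by (simp add: algebra_simps)
  qed
  have "series_act R M m (s \<otimes>\<^bsub>S\<^esub> t) n
      = (\<Oplus>\<^bsub>M\<^esub>i\<in>I. m i \<triangleleft>\<^bsub>M\<^esub> series_act R (regular_module R) s t (n - i))"
    unfolding laurent_ring_simps
    using car car_st fin supp_st by (intro act_eq_finsum) (auto simp: I_def supps)
  also have "\<dots> = (\<Oplus>\<^bsub>M\<^esub>i\<in>I. \<Oplus>\<^bsub>M\<^esub>k\<in>K. m i \<triangleleft>\<^bsub>M\<^esub> s (k - i) \<triangleleft>\<^bsub>M\<^esub> t (n - k))"
  proof (rule M.finsum_cong')
    fix i assume "i \<in> I"
    have hom: "abelian_group_hom R M (\<lambda>r. m i \<triangleleft>\<^bsub>M\<^esub> r)"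
      using car by (intro abelian_group_homI' R.is_abelian_group M.abelian_group_axioms
          ract_closed ract_add_right)
    show "m i \<triangleleft>\<^bsub>M\<^esub> series_act R (regular_module R) s t (n - i)
        = (\<Oplus>\<^bsub>M\<^esub>k\<in>K. m i \<triangleleft>\<^bsub>M\<^esub> s (k - i) \<triangleleft>\<^bsub>M\<^esub> t (n - k))"
      unfolding st[OF \<open>i \<in> I\<close>] using car
      by (subst abelian_group_hom_finsum[OF hom]) (auto simp: ract_assoc)
  qed (use car in \<open>auto intro!: M.finsum_closed simp: ract_closed\<close>)
  also have "\<dots> = (\<Oplus>\<^bsub>M\<^esub>k\<in>K. \<Oplus>\<^bsub>M\<^esub>i\<in>I. m i \<triangleleft>\<^bsub>M\<^esub> s (k - i) \<triangleleft>\<^bsub>M\<^esub> t (n - k))"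
    using fin car by (intro M.finsum_swap) (auto simp: ract_closed)
  also have "\<dots> = (\<Oplus>\<^bsub>M\<^esub>k\<in>K. series_act R M m s k \<triangleleft>\<^bsub>M\<^esub> t (n - k))"
  proof (rule M.finsum_cong')
    fix k assume "k \<in> K"
    have "i \<in> I" if "m i \<noteq> \<zero>\<^bsub>M\<^esub>" "s (k - i) \<noteq> \<zero>\<^bsub>R\<^esub>" for i
      using that \<open>k \<in> K\<close> in_V[of "k - i" "n - i"] by (auto simp: K_def I_def supps)
    then have ms: "series_act R M m s k = (\<Oplus>\<^bsub>M\<^esub>i\<in>I. m i \<triangleleft>\<^bsub>M\<^esub> s (k - i))"
      using car fin by (intro act_eq_finsum) auto
    show "(\<Oplus>\<^bsub>M\<^esub>i\<in>I. m i \<triangleleft>\<^bsub>M\<^esub> s (k - i) \<triangleleft>\<^bsub>M\<^esub> t (n - k)) = series_act R M m s k \<triangleleft>\<^bsub>M\<^esub> t (n - k)"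
      unfolding ms using car
      by (subst abelian_group_hom_finsum[OF ract_abelian_group_hom[OF right_module_axioms]])
        (auto simp: ract_closed)
  qed (use car car_ms in \<open>auto simp: ract_closed\<close>)
  also have "\<dots> = series_act R M (series_act R M m s) t n"
    using car car_ms fin supp_ms
    by (intro act_eq_finsum[symmetric]) (auto simp: K_def supps)
  finally show "series_act R M m (s \<otimes>\<^bsub>S\<^esub> t) n = series_act R M (series_act R M m s) t n" .
qed

text \<open>All axioms are those of the module of series for the regular module, except the left
  unit law, which is multiplication by a constant series.\<close>

lemma laurent_ring_ring: "ring S"
proof -
  interpret reg: laurent R "regular_module R" P
    by (intro laurent.intro regular_module_right_module R.ring_axioms laurent_support_axioms)
  have car: "carrier (series_module P R (regular_module R)) = carrier S"
    by (auto simp: series_module_simps laurent_ring_simps)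
  have add: "s \<oplus>\<^bsub>series_module P R (regular_module R)\<^esub> t = s \<oplus>\<^bsub>S\<^esub> t" for s t
    by (simp add: series_module_simps laurent_ring_simps)
  have zero: "\<zero>\<^bsub>series_module P R (regular_module R)\<^esub> = \<zero>\<^bsub>S\<^esub>"
    by (simp add: series_module_simps laurent_ring_simps)
  have mult: "series_act R (regular_module R) s t = s \<otimes>\<^bsub>S\<^esub> t" for s t
    by (simp add: laurent_ring_simps)
  note [simp] = reg.act_closed[unfolded car mult]
  have one: "\<one>\<^bsub>S\<^esub> \<in> carrier S"
    using reg.const_closed[of "\<one>\<^bsub>R\<^esub>"] by (simp add: car const_series_regular laurent_ring_simps(3))
  show ?thesis
  proof (rule ringI)
    show "abelian_group S"
      using abelian_groupE[OF reg.series_abelian_group]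
      unfolding car add zero by (intro abelian_groupI) auto
    show "monoid S"
    proof (rule monoidI)
      show "\<one>\<^bsub>S\<^esub> \<otimes>\<^bsub>S\<^esub> s = s" if "s \<in> carrier S" for s
        using that reg.act_const[of "\<one>\<^bsub>R\<^esub>" s] unfolding const_series_regular
        by (simp add: laurent_ring_simps)
    qed (use one reg.act_one reg.act_assoc in \<open>auto simp: car mult\<close>)
  qed (use reg.act_add_left reg.act_add_right in \<open>simp_all add: car add mult\<close>)
qed

lemma series_right_module: "right_module S Mz"
  by (intro right_module.intro right_module_axioms.intro laurent_ring_ring series_abelian_group)
    (simp_all add: series_module_simps(4) act_closed act_add_left act_add_right act_assoc act_one)

end


section \<open>Cochain complexes\<close>

text \<open>Composing differentials produces degrees such as \<open>n + 1 + 1\<close>, whereas the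
  definitions of complex and cone write \<open>n + 2\<close>. The indices must be normalised before
  objects can be matched.\<close>

lemma degree_simps [simp]:
  fixes n :: int
  shows "n + 1 + 1 = n + 2" "n + 2 + 1 = n + 3" "n + 1 + 2 = n + 3" "n - 1 + 2 = n + 1"
  by simp_all

lemma ring_bimodule_simps:
  "carrier (ring_bimodule \<phi> S) = carrier S" "\<zero>\<^bsub>ring_bimodule \<phi> S\<^esub> = \<zero>\<^bsub>S\<^esub>"
  "x \<oplus>\<^bsub>ring_bimodule \<phi> S\<^esub> y = x \<oplus>\<^bsub>S\<^esub> y" "x \<triangleleft>\<^bsub>ring_bimodule \<phi> S\<^esub> s = x \<otimes>\<^bsub>S\<^esub> s"
  "lact (ring_bimodule \<phi> S) r x = \<phi> r \<otimes>\<^bsub>S\<^esub> x"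
  by (simp_all add: ring_bimodule_def)

lemma tensor_factors_ring_bimodule:
  assumes "right_module R M" "ring S" "\<And>r. r \<in> carrier R \<Longrightarrow> \<phi> r \<in> carrier S"
  shows "tensor_factors R S M (ring_bimodule \<phi> S)"
proof -
  interpret S: ring S by fact
  have "abelian_group (ring_bimodule \<phi> S)"
    using abelian_groupE[OF S.is_abelian_group]
    by (intro abelian_groupI) (auto simp: ring_bimodule_simps)
  then show ?thesis
    using assms by (intro tensor_factors.intro tensor_factors_axioms.intro)
      (auto simp: ring_bimodule_simps S.l_distr S.r_distr S.m_assoc)
qed

section \<open>Direct sums, differences of cochain maps and mapping cones\<close>

lemma rmod_sum_simps [simp]:
  "carrier (rmod_sum M N) = carrier M \<times> carrier N"
  "\<zero>\<^bsub>rmod_sum M N\<^esub> = (\<zero>\<^bsub>M\<^esub>, \<zero>\<^bsub>N\<^esub>)"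
  "(x, y) \<oplus>\<^bsub>rmod_sum M N\<^esub> (x', y') = (x \<oplus>\<^bsub>M\<^esub> x', y \<oplus>\<^bsub>N\<^esub> y')"
  "(x, y) \<triangleleft>\<^bsub>rmod_sum M N\<^esub> r = (x \<triangleleft>\<^bsub>M\<^esub> r, y \<triangleleft>\<^bsub>N\<^esub> r)"
  by (simp_all add: rmod_sum_def)

lemma rmod_sum_right_module:
  assumes "right_module R M" "right_module R N"
  shows "right_module R (rmod_sum M N)"
proof -
  interpret M: right_module R M by fact
  interpret N: right_module R N by fact
  have "abelian_group (rmod_sum M N)"
  proof (rule abelian_groupI)
    fix x assume "x \<in> carrier (rmod_sum M N)"
    then show "\<exists>y\<in>carrier (rmod_sum M N). y \<oplus>\<^bsub>rmod_sum M N\<^esub> x = \<zero>\<^bsub>rmod_sum M N\<^esub>"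
      by (intro bexI[of _ "(\<ominus>\<^bsub>M\<^esub> fst x, \<ominus>\<^bsub>N\<^esub> snd x)"]) (auto simp: M.M.l_neg N.M.l_neg)
  qed (auto simp: M.M.a_ac N.M.a_ac)
  then show ?thesis
    by (intro right_module.intro right_module_axioms.intro M.R.ring_axioms)
      (auto simp: M.ract_closed N.ract_closed M.ract_add_left N.ract_add_left
        M.ract_add_right N.ract_add_right M.ract_assoc N.ract_assoc M.ract_one N.ract_one)
qed

lemma cochain_mapD:
  assumes "cochain_map R A B f"
  shows "f n \<in> rmod_hom R (obj A n) (obj B n)"
    and "x \<in> carrier (obj A n) \<Longrightarrow> f (n + 1) (diff A n x) = diff B n (f n x)"
  using assms by (auto simp: cochain_map_def)

lemma (in cochain_complex) diff_abelian_group_hom: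
  "abelian_group_hom (obj A n) (obj A (n + 1)) (diff A n)"
  by (rule rmod_hom_abelian_group_hom[OF diff_hom obj_module obj_module])

lemma rmod_hom_minus:
  assumes "right_module R M" "right_module R N" "f \<in> rmod_hom R M N" "g \<in> rmod_hom R M N"
  shows "(\<lambda>x. f x \<ominus>\<^bsub>N\<^esub> g x) \<in> rmod_hom R M N"
proof -
  interpret N: right_module R N by fact
  show ?thesis
    using rmod_homD[OF assms(3)] rmod_homD[OF assms(4)]
    by (intro rmod_homI) (auto simp: N.M.minus_eq N.M.minus_add N.M.a_ac
        N.ract_add_left N.ract_minus_left N.ract_closed)
qed

lemma cochain_map_minus:
  assumes "cochain_complex R A" "cochain_complex R B" "cochain_map R A B f" "cochain_map R A B g"
  shows "cochain_map R A B (\<lambda>n x. f n x \<ominus>\<^bsub>obj B n\<^esub> g n x)"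
proof -
  interpret A: cochain_complex R A by fact
  interpret B: cochain_complex R B by fact
  note f = cochain_mapD[OF assms(3)] and g = cochain_mapD[OF assms(4)]
  show ?thesis
    unfolding cochain_map_def
    using rmod_homD(1)[OF f(1)] rmod_homD(1)[OF g(1)]
    by (auto intro!: rmod_hom_minus A.obj_module B.obj_module f g
        simp: f(2) g(2) abelian_group_homD(7)[OF B.diff_abelian_group_hom])
qed

text \<open>The sign in the first component of the differential makes \<open>f (- d x)\<close>
  cancel against \<open>d (f x)\<close> in the second component of the square.\<close>

lemma cone_cochain_complex:
  assumes "cochain_complex R A" "cochain_complex R B" "cochain_map R A B f"
  shows "cochain_complex R (cone A B f)"
proof (rule cochain_complex.intro)
  interpret A: cochain_complex R A by fact
  interpret B: cochain_complex R B by fact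
  note f = cochain_mapD[OF assms(3)]
  fix n
  show "right_module R (obj (cone A B f) n)"
    by (simp add: cone_def rmod_sum_right_module A.obj_module B.obj_module)
  interpret A1: right_module R "obj A (n + 1)" by (rule A.obj_module)
  interpret A2: right_module R "obj A (n + 2)" by (rule A.obj_module)
  interpret A3: right_module R "obj A (n + 3)" by (rule A.obj_module)
  interpret B1: right_module R "obj B (n + 1)" by (rule B.obj_module)
  interpret B2: right_module R "obj B (n + 2)" by (rule B.obj_module)
  have dA: "diff A (n + 1) \<in> rmod_hom R (obj A (n + 1)) (obj A (n + 2))"
    using A.diff_hom[of "n + 1"] by simp
  have dA2: "abelian_group_hom (obj A (n + 2)) (obj A (n + 3)) (diff A (n + 2))"
    using A.diff_abelian_group_hom[of "n + 2"] by simp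
  have dB1: "abelian_group_hom (obj B (n + 1)) (obj B (n + 2)) (diff B (n + 1))"
    using B.diff_abelian_group_hom[of "n + 1"] by simp
  have f2: "abelian_group_hom (obj A (n + 2)) (obj B (n + 2)) (f (n + 2))"
    by (rule rmod_hom_abelian_group_hom[OF f(1) A.obj_module B.obj_module])
  note dA' = rmod_homD[OF dA] and dB' = rmod_homD[OF B.diff_hom[of n]] and f' = rmod_homD[OF f(1)]
  show "diff (cone A B f) n \<in> rmod_hom R (obj (cone A B f) n) (obj (cone A B f) (n + 1))"
    by (rule rmod_homI)
      (auto simp: cone_def dA' dB' f' A2.M.minus_add A2.M.a_ac B1.M.a_ac
        A2.ract_minus_left B1.ract_add_left B1.ract_closed)
  fix p assume p: "p \<in> carrier (obj (cone A B f) n)"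
  then obtain x y where xy: "p = (x, y)" "x \<in> carrier (obj A (n + 1))" "y \<in> carrier (obj B n)"
    by (auto simp: cone_def)
  have ddA: "diff A (n + 2) (diff A (n + 1) x) = \<zero>\<^bsub>obj A (n + 3)\<^esub>"
    using A.diff_diff[OF xy(2)] by simp
  have fd: "f (n + 2) (diff A (n + 1) x) = diff B (n + 1) (f (n + 1) x)"
    using f(2)[OF xy(2)] by simp
  have car: "diff A (n + 1) x \<in> carrier (obj A (n + 2))" "diff B n y \<in> carrier (obj B (n + 1))"
    "f (n + 1) x \<in> carrier (obj B (n + 1))" "diff B (n + 1) (f (n + 1) x) \<in> carrier (obj B (n + 2))"
    using xy dA' dB' f' abelian_group_homD(3)[OF dB1] by auto
  show "diff (cone A B f) (n + 1) (diff (cone A B f) n p) = \<zero>\<^bsub>obj (cone A B f) (n + 2)\<^esub>"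
    using car by (simp add: cone_def xy abelian_group_homD[OF dA2] abelian_group_homD[OF dB1]
        abelian_group_homD[OF f2] ddA fd B.diff_diff[OF xy(3)] B2.M.l_neg)
qed

section \<open>Tensoring a cochain complex with a bimodule\<close>

lemma tensor_complex_simps [simp]:
  "obj (tensor_complex R A N) n = tensor R (obj A n) N"
  "diff (tensor_complex R A N) n = tensor_map R (obj A (n + 1)) N (diff A n) (\<lambda>y. y)"
  by (simp_all add: tensor_complex_def)

context
  fixes R :: "('r, 'e) ring_scheme" and S :: "('s, 'f) ring_scheme"
    and A :: "('r, 'm) cochain" and N :: "('r, 's, 'n) bimodule"
  assumes A: "cochain_complex R A"
    and N: "\<And>n. tensor_factors R S (obj A n) N"
begin

lemma tensor_factors_hom_cochain:
  assumes "f \<in> rmod_hom R (obj A m) (obj A n)" "abelian_group_hom N N g"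
    and "\<And>r y. \<lbrakk>r \<in> carrier R; y \<in> carrier N\<rbrakk> \<Longrightarrow> g (lact N r y) = lact N r (g y)"
  shows "tensor_factors_hom R S (obj A m) N (obj A n) N f g"
  using assms by (intro tensor_factors_hom.intro tensor_factors_hom_axioms.intro N)

lemma id_abelian_group_hom: "abelian_group_hom N N (\<lambda>y. y)"
  by (intro abelian_group_homI' tensor_factors.axioms(3)[OF N] refl)

lemma tensor_diff: "tensor_factors_hom R S (obj A n) N (obj A (n + 1)) N (diff A n) (\<lambda>y. y)"
  by (intro tensor_factors_hom_cochain cochain_complex.diff_hom A id_abelian_group_hom refl)

text \<open>The square of the differential sends \<open>x \<otimes> y\<close> to
  \<open>0 \<otimes> y\<close>, which vanishes by \<open>tens_zero_left\<close>.\<close>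

lemma tensor_complex_cochain_complex: "cochain_complex S (tensor_complex R A N)"
proof (rule cochain_complex.intro)
  interpret A: cochain_complex R A by (rule A)
  fix n
  interpret T: tensor_factors R S "obj A n" N by (rule N)
  interpret T2: tensor_factors R S "obj A (n + 2)" N by (rule N)
  interpret d: tensor_factors_hom R S "obj A n" N "obj A (n + 1)" N "diff A n" "\<lambda>y. y"
    by (rule tensor_diff)
  have "tensor_factors_hom R S (obj A (n + 1)) N (obj A (n + 2)) N (diff A (n + 1)) (\<lambda>y. y)"
    using tensor_diff[of "n + 1"] by simp
  then interpret d1: tensor_factors_hom R S "obj A (n + 1)" N "obj A (n + 2)" N "diff A (n + 1)" "\<lambda>y. y" .
  show "right_module S (obj (tensor_complex R A N) n)"
    by (simp add: T.tensor_right_module)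
  show "diff (tensor_complex R A N) n \<in> rmod_hom S (obj (tensor_complex R A N) n) (obj (tensor_complex R A N) (n + 1))"
    unfolding tensor_complex_simps by (rule d.tensor_map_rmod_hom) (rule refl)
  fix w assume w: "w \<in> carrier (obj (tensor_complex R A N) n)"
  have "tensor_map R (obj A (n + 2)) N (diff A (n + 1)) (\<lambda>y. y)
      (tensor_map R (obj A (n + 1)) N (diff A n) (\<lambda>y. y) w) = \<zero>\<^bsub>tensor R (obj A (n + 2)) N\<^esub>"
  proof (rule T.tensor_hom_eqI[where g = "\<lambda>w. \<zero>\<^bsub>tensor R (obj A (n + 2)) N\<^esub>",
        OF abelian_group_hom_compose[OF d.tensor_map_hom d1.tensor_map_hom]])
    interpret G: abelian_group "tensor R (obj A (n + 2)) N" by (rule T2.tensor_abelian_group)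
    show "abelian_group_hom (tensor R (obj A n) N) (tensor R (obj A (n + 2)) N)
        (\<lambda>w. \<zero>\<^bsub>tensor R (obj A (n + 2)) N\<^esub>)"
      by (intro abelian_group_homI' T.tensor_abelian_group G.abelian_group_axioms) simp_all
    fix x y assume xy: "x \<in> carrier (obj A n)" "y \<in> carrier N"
    show "tensor_map R (obj A (n + 2)) N (diff A (n + 1)) (\<lambda>y. y)
        (tensor_map R (obj A (n + 1)) N (diff A n) (\<lambda>y. y) (tens R (obj A n) N x y))
        = \<zero>\<^bsub>tensor R (obj A (n + 2)) N\<^esub>"
      using xy by (simp add: d.tensor_map_tens d1.tensor_map_tens A.diff_diff T2.tens_zero_left)
  qed (use w in simp)
  then show "diff (tensor_complex R A N) (n + 1) (diff (tensor_complex R A N) n w)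
      = \<zero>\<^bsub>obj (tensor_complex R A N) (n + 2)\<^esub>"
    by simp
qed

text \<open>The map \<open>g\<close> on the bimodule is kept general so that both parts of the torus
  map are covered: \<open>h\<close> with the identity, and the identity with multiplication by
  \<open>z\<close>.\<close>

lemma tensor_map_cochain_map:
  assumes f: "cochain_map R A A f" and g: "abelian_group_hom N N g"
    and g_lact: "\<And>r y. \<lbrakk>r \<in> carrier R; y \<in> carrier N\<rbrakk> \<Longrightarrow> g (lact N r y) = lact N r (g y)"
    and g_ract: "\<And>y s. \<lbrakk>y \<in> carrier N; s \<in> carrier S\<rbrakk> \<Longrightarrow> g (y \<triangleleft>\<^bsub>N\<^esub> s) = g y \<triangleleft>\<^bsub>N\<^esub> s"
  shows "cochain_map S (tensor_complex R A N) (tensor_complex R A N)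
    (\<lambda>n. tensor_map R (obj A n) N (f n) g)"
  unfolding cochain_map_def tensor_complex_simps
proof (intro conjI allI ballI)
  fix n
  have fg: "tensor_factors_hom R S (obj A k) N (obj A k) N (f k) g" for k
    by (intro tensor_factors_hom_cochain cochain_mapD[OF f] g g_lact)
  interpret T: tensor_factors R S "obj A n" N by (rule N)
  interpret fg: tensor_factors_hom R S "obj A n" N "obj A n" N "f n" g by (rule fg)
  interpret fg1: tensor_factors_hom R S "obj A (n + 1)" N "obj A (n + 1)" N "f (n + 1)" g by (rule fg)
  interpret d: tensor_factors_hom R S "obj A n" N "obj A (n + 1)" N "diff A n" "\<lambda>y. y"
    by (rule tensor_diff)
  show "tensor_map R (obj A n) N (f n) g \<in> rmod_hom S (tensor R (obj A n) N) (tensor R (obj A n) N)"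
    by (rule fg.tensor_map_rmod_hom[OF g_ract])
  fix w assume w: "w \<in> carrier (tensor R (obj A n) N)"
  show "tensor_map R (obj A (n + 1)) N (f (n + 1)) g (tensor_map R (obj A (n + 1)) N (diff A n) (\<lambda>y. y) w)
      = tensor_map R (obj A (n + 1)) N (diff A n) (\<lambda>y. y) (tensor_map R (obj A n) N (f n) g w)"
    by (rule T.tensor_hom_eqI[OF abelian_group_hom_compose[OF d.tensor_map_hom fg1.tensor_map_hom]
          abelian_group_hom_compose[OF fg.tensor_map_hom d.tensor_map_hom] w])
      (simp add: d.tensor_map_tens fg.tensor_map_tens fg1.tensor_map_tens cochain_mapD(2)[OF f])
qed

end

section \<open>Cocycles, coboundaries and exactness\<close>

lemma (in cochain_complex) coboundaries_subgroup:
  "subgroup (coboundaries A n) (add_monoid (obj A n))"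
proof -
  interpret d: abelian_group_hom "obj A (n - 1)" "obj A n" "diff A (n - 1)"
    using diff_abelian_group_hom[of "n - 1"] by simp
  interpret g: group_hom "add_monoid (obj A (n - 1))" "add_monoid (obj A n)" "diff A (n - 1)"
    by (rule d.a_group_hom)
  show ?thesis
    using g.img_is_subgroup by (simp add: coboundaries_def)
qed

lemma (in cochain_complex) coboundaries_subset_cocycles: "coboundaries A n \<subseteq> cocycles A n"
  using rmod_homD(1)[OF diff_hom[of "n - 1"]] diff_diff[of _ "n - 1"]
  by (auto simp: coboundaries_def cocycles_def)

lemma (in cochain_complex) cocycles_subgroup: "subgroup (cocycles A n) (add_monoid (obj A n))"
proof -
  interpret d: abelian_group_hom "obj A n" "obj A (n + 1)" "diff A n"
    by (rule diff_abelian_group_hom)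
  interpret g: group_hom "add_monoid (obj A n)" "add_monoid (obj A (n + 1))" "diff A n"
    by (rule d.a_group_hom)
  show ?thesis
    using g.subgroup_kernel by (simp add: cocycles_def kernel_def)
qed

text \<open>If every cocycle is a coboundary, then cohomology is the group of cocycles modulo
  itself, whose only element is the full coset.\<close>

lemma acyclic_complexI:
  assumes A: "cochain_complex R A"
    and ex: "\<And>n x. \<lbrakk>x \<in> carrier (obj A n); diff A n x = \<zero>\<^bsub>obj A (n + 1)\<^esub>\<rbrakk> \<Longrightarrow>
      \<exists>y\<in>carrier (obj A (n - 1)). diff A (n - 1) y = x"
  shows "acyclic_complex R A"
  unfolding acyclic_complex_def
proof (intro conjI allI A)
  fix n
  interpret cochain_complex R A by (rule A)
  interpret G: abelian_group "obj A n" by (rule right_moduleD[OF obj_module])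
  let ?Z = "(add_monoid (obj A n))\<lparr>carrier := cocycles A n\<rparr>"
  have eq: "coboundaries A n = cocycles A n"
    using coboundaries_subset_cocycles ex by (auto simp: coboundaries_def cocycles_def) blast
  interpret Z: group ?Z
    by (rule subgroup.subgroup_is_group[OF cocycles_subgroup G.a_group])
  note sub = Z.subgroup_self
  have "group (?Z Mod carrier ?Z)" by (rule normal.factorgroup_is_group[OF Z.normal_self])
  moreover have "carrier (?Z Mod carrier ?Z) = {carrier ?Z}"
    using Z.coset_join2[OF _ sub] Z.one_closed by (auto simp: carrier_FactGroup)
  ultimately show "trivial_group (cohomology A n)"
    by (simp add: cohomology_def eq trivial_group_def)
qed

text \<open>Exactness of the mapping cone of a quasi-isomorphism, by hand: injectivity on cohomology
  in degree \<open>n + 1\<close> makes \<open>x\<close> a coboundary, and surjectivity in degree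
  \<open>n\<close> then corrects the primitive so that it also accounts for
  \<open>y\<close>.\<close>

lemma quasi_isomorphism_cone_exact:
  assumes C: "cochain_complex R C" and h: "quasi_isomorphism R C C h"
    and x: "x \<in> carrier (obj C (n + 1))" and y: "y \<in> carrier (obj C n)"
    and dx: "diff C (n + 1) x = \<zero>\<^bsub>obj C (n + 2)\<^esub>"
    and hx: "h (n + 1) x \<oplus>\<^bsub>obj C (n + 1)\<^esub> diff C n y = \<zero>\<^bsub>obj C (n + 1)\<^esub>"
  shows "\<exists>u\<in>carrier (obj C n). \<exists>v\<in>carrier (obj C (n - 1)).
    \<ominus>\<^bsub>obj C (n + 1)\<^esub> diff C n u = x \<and> h n u \<oplus>\<^bsub>obj C n\<^esub> diff C (n - 1) v = y"
proof -
  interpret C: cochain_complex R C by (rule C)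
  have hc: "cochain_map R C C h" and iso: "cohomology_map C h m \<in> iso (cohomology C m) (cohomology C m)" for m
    using h by (auto simp: quasi_isomorphism_def)
  \<comment> \<open>Classes are cosets of the coboundaries. The facts \<open>mem\<close> and
    \<open>self\<close> turn equalities of classes into statements about representatives.\<close>
  define cls where "cls m z = coboundaries C m #>\<^bsub>add_monoid (obj C m)\<^esub> z" for m z
  have G: "abelian_group (obj C m)" for m
    by (rule right_moduleD[OF C.obj_module])
  have hom: "abelian_group_hom (obj C m) (obj C m) (h m)" for m
    by (rule rmod_hom_abelian_group_hom[OF cochain_mapD(1)[OF hc] C.obj_module C.obj_module])
  have car: "carrier (cohomology C m) = cls m ` cocycles C m" for m
    by (auto simp: cohomology_def carrier_FactGroup cls_def r_coset_def)
  have B: "subgroup (coboundaries C m) (add_monoid (obj C m))" for m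
    by (rule C.coboundaries_subgroup)
  have B_sub: "b \<in> carrier (obj C m)" if "b \<in> coboundaries C m" for b m
    using subgroup.mem_carrier[OF B that] by simp
  have hB: "h m b \<in> coboundaries C m" if "b \<in> coboundaries C m" for m b
    using that cochain_mapD(2)[OF hc, of _ "m - 1"] rmod_homD(1)[OF cochain_mapD(1)[OF hc]]
    by (auto simp: coboundaries_def)
  have mem: "w \<in> cls m z \<longleftrightarrow> (\<exists>b\<in>coboundaries C m. w = b \<oplus>\<^bsub>obj C m\<^esub> z)" for m w z
    by (auto simp: cls_def r_coset_def)
  have self: "z \<in> cls m z" if "z \<in> carrier (obj C m)" for m z
    using subgroup.one_closed[OF B, of m] abelian_groupE(5)[OF G that]
    by (auto simp: mem intro!: bexI[of _ "\<zero>\<^bsub>obj C m\<^esub>"])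
  \<comment> \<open>\<open>h\<close> preserves coboundaries, so applying it to a whole coset and
    adding all coboundaries gives exactly the coset of \<open>h z\<close>.\<close>
  have map: "cohomology_map C h m (cls m z) = cls m (h m z)" if z: "z \<in> carrier (obj C m)" for m z
  proof -
    interpret G: abelian_group "obj C m" by (rule G)
    note hm = abelian_group_homD[OF hom[of m]]
    show ?thesis
    proof (intro Set.set_eqI iffI)
      fix w assume "w \<in> cohomology_map C h m (cls m z)"
      then obtain b b' where b: "b \<in> coboundaries C m" "b' \<in> coboundaries C m"
          "w = b \<oplus>\<^bsub>obj C m\<^esub> h m (b' \<oplus>\<^bsub>obj C m\<^esub> z)"
        by (auto simp: cohomology_map_def set_mult_def mem)
      then have "w = (b \<oplus>\<^bsub>obj C m\<^esub> h m b') \<oplus>\<^bsub>obj C m\<^esub> h m z"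
        using z by (simp add: hm B_sub G.a_assoc)
      moreover have "b \<oplus>\<^bsub>obj C m\<^esub> h m b' \<in> coboundaries C m"
        using subgroup.m_closed[OF B b(1) hB[OF b(2)]] by simp
      ultimately show "w \<in> cls m (h m z)" by (auto simp: mem)
    next
      fix w assume "w \<in> cls m (h m z)"
      then obtain b where "b \<in> coboundaries C m" "w = b \<oplus>\<^bsub>obj C m\<^esub> h m z" by (auto simp: mem)
      then show "w \<in> cohomology_map C h m (cls m z)"
        using self[OF z] by (auto simp: cohomology_map_def set_mult_def)
    qed
  qed
  have cls_zero: "cls m b = cls m \<zero>\<^bsub>obj C m\<^esub>" if b: "b \<in> coboundaries C m" for m b
  proof -
    interpret G: abelian_group "obj C m" by (rule G)
    have "cls m b = coboundaries C m"
      unfolding cls_def using b B_sub[OF b] by (intro G.add.coset_join2 B) auto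
    moreover have "cls m \<zero>\<^bsub>obj C m\<^esub> = coboundaries C m"
      unfolding cls_def using subgroup.one_closed[OF B] by (intro G.add.coset_join2 B) auto
    ultimately show ?thesis by simp
  qed
  interpret C0: abelian_group "obj C n" by (rule G)
  interpret C1: abelian_group "obj C (n + 1)" by (rule G)
  note d = abelian_group_homD[OF C.diff_abelian_group_hom[of n]]
  note h0 = abelian_group_homD[OF hom[of n]] and h1 = abelian_group_homD[OF hom[of "n + 1"]]
  have zero_cocycle: "\<zero>\<^bsub>obj C m\<^esub> \<in> cocycles C m" for m
    using subgroup.one_closed[OF C.cocycles_subgroup, of m] by simp
  have x_cocycle: "x \<in> cocycles C (n + 1)"
    using x dx by (simp add: cocycles_def)
  \<comment> \<open>Injectivity in degree \<open>n + 1\<close> is used here: \<open>h x\<close> is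
    the coboundary of \<open>- y\<close>, so the class of \<open>x\<close> has the same image as the
    zero class.\<close>
  have "h (n + 1) x = diff C n (\<ominus>\<^bsub>obj C n\<^esub> y)"
    using hx x y by (simp add: d h1 C1.add.inv_equality[symmetric])
  then have "h (n + 1) x \<in> coboundaries C (n + 1)"
    using y by (auto simp: coboundaries_def)
  then have "cohomology_map C h (n + 1) (cls (n + 1) x) = cohomology_map C h (n + 1) (cls (n + 1) \<zero>\<^bsub>obj C (n + 1)\<^esub>)"
    using x by (simp add: map h1 cls_zero)
  then have "cls (n + 1) x = cls (n + 1) \<zero>\<^bsub>obj C (n + 1)\<^esub>"
    using iso[of "n + 1"] x_cocycle zero_cocycle[of "n + 1"]
    by (auto simp: iso_def bij_betw_def car inj_on_eq_iff)
  then have "x \<in> cls (n + 1) \<zero>\<^bsub>obj C (n + 1)\<^esub>" using self[OF x] by simp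
  then have "x \<in> coboundaries C (n + 1)" using B_sub by (auto simp: mem)
  then obtain u where u: "u \<in> carrier (obj C n)" "x = diff C n u"
    by (auto simp: coboundaries_def)
  \<comment> \<open>\<open>d y\<close> equals \<open>- h x\<close>, while \<open>d (h u)\<close>
    equals \<open>h (d u) = h x\<close>, so \<open>?w\<close> is a cocycle. By surjectivity in
    degree \<open>n\<close> its class is the image of the class of some cocycle
    \<open>c\<close>.\<close>
  let ?w = "y \<oplus>\<^bsub>obj C n\<^esub> h n u"
  have w: "?w \<in> cocycles C n"
    using u y hx cochain_mapD(2)[OF hc u(1)]
    by (simp add: cocycles_def d h0 h1 C1.a_comm)
  then have "cls n ?w \<in> cohomology_map C h n ` (cls n ` cocycles C n)"
    using iso[of n] by (auto simp: iso_def bij_betw_def car)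
  then obtain c where c: "c \<in> cocycles C n" "cls n ?w = cls n (h n c)"
    by (auto simp: map cocycles_def)
  then have cc: "c \<in> carrier (obj C n)" "diff C n c = \<zero>\<^bsub>obj C (n + 1)\<^esub>"
    by (auto simp: cocycles_def)
  have "?w \<in> cls n (h n c)" using self[of ?w n] w c(2) by (simp add: cocycles_def)
  then obtain v where v: "v \<in> carrier (obj C (n - 1))" "?w = diff C (n - 1) v \<oplus>\<^bsub>obj C n\<^esub> h n c"
    by (auto simp: mem coboundaries_def)
  have dv: "diff C (n - 1) v \<in> carrier (obj C n)"
    using v(1) rmod_homD(1)[OF C.diff_hom[of "n - 1"]] by simp
  \<comment> \<open>The cone differential carries a minus sign, so the primitive is
    \<open>c - u\<close> and not \<open>u\<close>: the cocycle \<open>c\<close> does not affect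
    \<open>- d (c - u) = d u = x\<close>, and it absorbs the part of \<open>y + h u\<close> that is
    not a coboundary.\<close>
  show ?thesis
  proof (intro bexI conjI)
    show "\<ominus>\<^bsub>obj C (n + 1)\<^esub> diff C n (c \<ominus>\<^bsub>obj C n\<^esub> u) = x"
      using u cc by (simp add: d C1.minus_eq)
    have "y = ?w \<ominus>\<^bsub>obj C n\<^esub> h n u"
      using y u by (simp add: C0.minus_eq C0.a_assoc h0 C0.r_neg)
    also have "\<dots> = h n (c \<ominus>\<^bsub>obj C n\<^esub> u) \<oplus>\<^bsub>obj C n\<^esub> diff C (n - 1) v"
      unfolding v(2) using u cc dv by (simp add: C0.minus_eq C0.a_ac h0)
    finally show "h n (c \<ominus>\<^bsub>obj C n\<^esub> u) \<oplus>\<^bsub>obj C n\<^esub> diff C (n - 1) v = y" ..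
  qed (use u cc v in auto)
qed


section \<open>Series with coefficients in a finitely presented module\<close>

lemma series_map_hom:
  assumes "laurent R M P" "laurent R M' P" "abelian_group_hom M M' g"
  shows "abelian_group_hom (series_module P R M) (series_module P R M') (\<lambda>m i. g (m i))"
proof -
  interpret M: laurent R M P by fact
  interpret M': laurent R M' P by fact
  note g = abelian_group_homD[OF assms(3)]
  show ?thesis
    using g M.series_pointwise_closed[of _ g M']
    by (intro abelian_group_homI' M.series_abelian_group M'.series_abelian_group)
      (auto simp: series_module_simps)
qed

text \<open>\<open>g\<close> commutes with finite sums. The coefficients \<open>g (m i)\<close> may
  vanish more often than \<open>m i\<close>, so the sum is taken over the index set belonging to
  \<open>m\<close> on both sides.\<close>

lemma series_map_act:
  assumes "laurent R M P" "laurent R M' P" and g: "g \<in> rmod_hom R M M'"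
    and m: "m \<in> carrier (series_module P R M)" and s: "s \<in> carrier (laurent_ring P R)"
  shows "series_act R M' (\<lambda>i. g (m i)) s = (\<lambda>i. g (series_act R M m s i))"
proof
  fix n
  interpret M: laurent R M P by fact
  interpret M': laurent R M' P by fact
  note g' = rmod_homD[OF g]
  have hom: "abelian_group_hom M M' g"
    by (rule rmod_hom_abelian_group_hom[OF g M.right_module_axioms M'.right_module_axioms])
  let ?A = "{i. m i \<noteq> \<zero>\<^bsub>M\<^esub> \<and> s (n - i) \<noteq> \<zero>\<^bsub>R\<^esub>}"
  have car: "m i \<in> carrier M" "s i \<in> carrier R" for i
    using m s by (auto simp: series_module_simps laurent_ring_simps)
  have "series_act R M' (\<lambda>i. g (m i)) s n = (\<Oplus>\<^bsub>M'\<^esub>i\<in>?A. g (m i) \<triangleleft>\<^bsub>M'\<^esub> s (n - i))"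
    using car g' abelian_group_homD(5)[OF hom]
    by (intro M'.act_eq_finsum M.conv_finite[OF m s]) auto
  also have "\<dots> = g (\<Oplus>\<^bsub>M\<^esub>i\<in>?A. m i \<triangleleft>\<^bsub>M\<^esub> s (n - i))"
    using car by (subst abelian_group_hom_finsum[OF hom]) (auto simp: M.ract_closed g')
  finally show "series_act R M' (\<lambda>i. g (m i)) s n = g (series_act R M m s n)"
    by (simp add: series_act_def)
qed

section \<open>Free modules of finite rank and series over them\<close>

lemma free_rmodule_simps:
  "x \<in> carrier (free_rmodule R n) \<longleftrightarrow> x \<in> {..<n} \<rightarrow>\<^sub>E carrier R"
  "\<zero>\<^bsub>free_rmodule R n\<^esub> = (\<lambda>i\<in>{..<n}. \<zero>\<^bsub>R\<^esub>)"
  "x \<oplus>\<^bsub>free_rmodule R n\<^esub> y = (\<lambda>i\<in>{..<n}. x i \<oplus>\<^bsub>R\<^esub> y i)"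
  "x \<triangleleft>\<^bsub>free_rmodule R n\<^esub> r = (\<lambda>i\<in>{..<n}. x i \<otimes>\<^bsub>R\<^esub> r)"
  by (simp_all add: free_rmodule_def)

context ring
begin

lemma free_right_module: "right_module R (free_rmodule R n)"
proof -
  have "abelian_group (free_rmodule R n)"
  proof (rule abelian_groupI)
    fix x assume x: "x \<in> carrier (free_rmodule R n)"
    have "(\<lambda>i\<in>{..<n}. \<ominus> x i) \<in> carrier (free_rmodule R n)"
      using x by (auto simp: free_rmodule_simps PiE_iff)
    moreover have "(\<lambda>i\<in>{..<n}. \<ominus> x i) \<oplus>\<^bsub>free_rmodule R n\<^esub> x = \<zero>\<^bsub>free_rmodule R n\<^esub>"
      using x by (auto simp: free_rmodule_simps PiE_iff l_neg)
    ultimately show "\<exists>y\<in>carrier (free_rmodule R n). y \<oplus>\<^bsub>free_rmodule R n\<^esub> x = \<zero>\<^bsub>free_rmodule R n\<^esub>"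
      by blast
  qed (auto simp: free_rmodule_simps PiE_iff a_ac intro!: extensionalityI[of _ "{..<n}"])
  then show ?thesis
    by (intro right_module.intro right_module_axioms.intro ring_axioms)
      (auto simp: free_rmodule_simps PiE_iff l_distr r_distr m_assoc
        intro!: extensionalityI[of _ "{..<n}"])
qed

definition unit_vector :: "nat \<Rightarrow> nat \<Rightarrow> nat \<Rightarrow> 'a" where
  "unit_vector n k = (\<lambda>j\<in>{..<n}. if j = k then \<one> else \<zero>)"

text \<open>Keeping the first \<open>k\<close> coordinates builds a vector up one multiple of a unit
  vector at a time, so that statements on its expansion in the standard basis are proved by
  induction on \<open>k\<close>.\<close>

definition truncate_vector :: "nat \<Rightarrow> nat \<Rightarrow> (nat \<Rightarrow> 'a) \<Rightarrow> nat \<Rightarrow> 'a" where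
  "truncate_vector n k x = (\<lambda>j\<in>{..<n}. if j < k then x j else \<zero>)"

lemma unit_vector_closed: "unit_vector n k \<in> carrier (free_rmodule R n)"
  by (auto simp: unit_vector_def free_rmodule_simps)

lemma truncate_vector_closed:
  "x \<in> carrier (free_rmodule R n) \<Longrightarrow> truncate_vector n k x \<in> carrier (free_rmodule R n)"
  by (simp add: truncate_vector_def free_rmodule_simps PiE_iff)

lemma truncate_vector_0: "truncate_vector n 0 x = \<zero>\<^bsub>free_rmodule R n\<^esub>"
  by (auto simp: truncate_vector_def free_rmodule_simps)

lemma truncate_vector_Suc:
  assumes "x \<in> carrier (free_rmodule R n)" "k < n"
  shows "truncate_vector n (Suc k) x
    = truncate_vector n k x \<oplus>\<^bsub>free_rmodule R n\<^esub> unit_vector n k \<triangleleft>\<^bsub>free_rmodule R n\<^esub> x k"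
  using assms
  by (auto simp: truncate_vector_def unit_vector_def free_rmodule_simps PiE_iff fun_eq_iff
      less_Suc_eq)

lemma truncate_vector_self:
  "x \<in> carrier (free_rmodule R n) \<Longrightarrow> truncate_vector n n x = x"
  by (auto simp: truncate_vector_def free_rmodule_simps PiE_iff extensional_def)

end

locale laurent_ring_support = ring R + laurent_support P for R (structure) and P
begin

lemma laurentI: "right_module R M \<Longrightarrow> laurent R M P"
  by (intro laurent.intro laurent_support_axioms)

lemma free_laurent: "laurent R (free_rmodule R n) P"
  by (intro laurentI free_right_module)

lemma laurent_const_mult:
  assumes "r \<in> carrier R" "\<And>i. s i \<in> carrier R"
  shows "laurent_const R r \<otimes>\<^bsub>laurent_ring P R\<^esub> s = (\<lambda>i. r \<otimes> s i)"
proof -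
  interpret reg: laurent R "regular_module R" P
    by (intro laurentI regular_module_right_module ring_axioms)
  show ?thesis
    using reg.act_const[of r s] assms by (simp add: laurent_ring_simps const_series_regular)
qed

lemma free_component_closed:
  assumes "m \<in> carrier (series_module P R (free_rmodule R n))" "k < n"
  shows "(\<lambda>i. m i k) \<in> carrier (laurent_ring P R)"
proof -
  have "P {i. m i k \<noteq> \<zero>}"
  proof (rule supp_subset)
    show "P {i. m i \<noteq> \<zero>\<^bsub>free_rmodule R n\<^esub>}" using assms by (simp add: series_module_simps)
    show "{i. m i k \<noteq> \<zero>} \<subseteq> {i. m i \<noteq> \<zero>\<^bsub>free_rmodule R n\<^esub>}"
      using assms(2) by (auto simp: free_rmodule_simps)
  qed
  then show ?thesis
    using assms by (auto simp: series_module_simps laurent_ring_simps free_rmodule_simps PiE_iff)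
qed

text \<open>A series of vectors is the sum over the \<open>n\<close> coordinates of unit vector
  times coordinate series. Finiteness of the rank enters here: finitely many products of the form
  \<open>x s\<close> suffice.\<close>

lemma free_series_induct:
  assumes m: "m \<in> carrier (series_module P R (free_rmodule R n))"
    and zero: "Q \<zero>\<^bsub>series_module P R (free_rmodule R n)\<^esub>"
    and add: "\<And>m m'. \<lbrakk>m \<in> carrier (series_module P R (free_rmodule R n));
        m' \<in> carrier (series_module P R (free_rmodule R n)); Q m; Q m'\<rbrakk>
        \<Longrightarrow> Q (m \<oplus>\<^bsub>series_module P R (free_rmodule R n)\<^esub> m')"
    and act: "\<And>x s. \<lbrakk>x \<in> carrier (free_rmodule R n); s \<in> carrier (laurent_ring P R)\<rbrakk>
        \<Longrightarrow> Q (\<lambda>i. x \<triangleleft>\<^bsub>free_rmodule R n\<^esub> s i)"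
  shows "Q m"
proof -
  let ?F = "free_rmodule R n"
  interpret F: laurent R ?F P by (rule free_laurent)
  have mi: "m i \<in> carrier ?F" for i using m by (simp add: series_module_simps)
  have closed: "(\<lambda>i. truncate_vector n k (m i)) \<in> carrier F.Mz" for k
  proof -
    have "P {i. truncate_vector n k (m i) \<noteq> \<zero>\<^bsub>?F\<^esub>}"
    proof (rule supp_subset)
      show "P {i. m i \<noteq> \<zero>\<^bsub>?F\<^esub>}" using m by (simp add: series_module_simps)
    qed (auto simp: truncate_vector_def free_rmodule_simps)
    then show ?thesis using mi by (simp add: series_module_simps truncate_vector_closed)
  qed
  have "Q (\<lambda>i. truncate_vector n k (m i))" if "k \<le> n" for k
    using that
  proof (induction k)
    case 0
    then show ?case using zero by (simp add: truncate_vector_0 series_module_simps)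
  next
    case (Suc k)
    have s: "(\<lambda>i. m i k) \<in> carrier (laurent_ring P R)"
      using free_component_closed[OF m, of k] Suc by simp
    \<comment> \<open>Written as a product of a constant series with a scalar series, it belongs to
      the module of series by \<open>act_closed\<close>.\<close>
    have eq: "(\<lambda>i. unit_vector n k \<triangleleft>\<^bsub>?F\<^esub> m i k)
        = series_act R ?F (const_series ?F (unit_vector n k)) (\<lambda>i. m i k)"
      using s by (subst F.act_const) (auto simp: unit_vector_closed laurent_ring_simps)
    have "(\<lambda>i. unit_vector n k \<triangleleft>\<^bsub>?F\<^esub> m i k) \<in> carrier F.Mz"
      unfolding eq by (intro F.act_closed F.const_closed unit_vector_closed s)
    moreover have "Q (\<lambda>i. unit_vector n k \<triangleleft>\<^bsub>?F\<^esub> m i k)"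
      by (rule act[OF unit_vector_closed s])
    ultimately have "Q ((\<lambda>i. truncate_vector n k (m i)) \<oplus>\<^bsub>F.Mz\<^esub> (\<lambda>i. unit_vector n k \<triangleleft>\<^bsub>?F\<^esub> m i k))"
      using Suc closed by (intro add) auto
    then show ?case
      using Suc mi by (simp add: series_module_simps truncate_vector_Suc)
  qed
  from this[of n] show ?thesis using mi by (simp add: truncate_vector_self)
qed

text \<open>Series of vectors are \<open>n\<close>-tuples of series, so the map is forced: the unit
  vectors paired with the coordinate series, summed over the coordinates.\<close>

lemma free_series_universal:
  assumes G: "abelian_group G"
    and \<beta>: "balanced R (free_rmodule R n) (ring_bimodule (laurent_const R) (laurent_ring P R)) G \<beta>"
  obtains \<phi> where "abelian_group_hom (series_module P R (free_rmodule R n)) G \<phi>"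
    "\<And>x s. \<lbrakk>x \<in> carrier (free_rmodule R n); s \<in> carrier (laurent_ring P R)\<rbrakk>
      \<Longrightarrow> \<phi> (\<lambda>i. x \<triangleleft>\<^bsub>free_rmodule R n\<^esub> s i) = \<beta> x s"
proof -
  let ?F = "free_rmodule R n" and ?S = "laurent_ring P R"
  interpret F: laurent R ?F P by (rule free_laurent)
  interpret G: abelian_group G by fact
  have b: "\<beta> x s \<in> carrier G"
    "x' \<in> carrier ?F \<Longrightarrow> \<beta> (x \<oplus>\<^bsub>?F\<^esub> x') s = \<beta> x s \<oplus>\<^bsub>G\<^esub> \<beta> x' s"
    "s' \<in> carrier ?S \<Longrightarrow> \<beta> x (s \<oplus>\<^bsub>?S\<^esub> s') = \<beta> x s \<oplus>\<^bsub>G\<^esub> \<beta> x s'"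
    "r \<in> carrier R \<Longrightarrow> \<beta> (x \<triangleleft>\<^bsub>?F\<^esub> r) s = \<beta> x (\<lambda>i. r \<otimes> s i)"
    if "x \<in> carrier ?F" "s \<in> carrier ?S" for x x' s s' r
  proof -
    note b' = balancedD[OF \<beta>, unfolded ring_bimodule_simps]
    show "\<beta> x s \<in> carrier G"
      "x' \<in> carrier ?F \<Longrightarrow> \<beta> (x \<oplus>\<^bsub>?F\<^esub> x') s = \<beta> x s \<oplus>\<^bsub>G\<^esub> \<beta> x' s"
      "s' \<in> carrier ?S \<Longrightarrow> \<beta> x (s \<oplus>\<^bsub>?S\<^esub> s') = \<beta> x s \<oplus>\<^bsub>G\<^esub> \<beta> x s'"
      using b'(1-3) that by auto
    show "\<beta> (x \<triangleleft>\<^bsub>?F\<^esub> r) s = \<beta> x (\<lambda>i. r \<otimes> s i)" if r: "r \<in> carrier R"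
      using b'(4)[of x r s] laurent_const_mult[of r s] r \<open>x \<in> carrier ?F\<close> \<open>s \<in> carrier ?S\<close>
      by (simp add: laurent_ring_simps(1))
  qed
  define \<phi> where "\<phi> m = (\<Oplus>\<^bsub>G\<^esub>j\<in>{..<n}. \<beta> (unit_vector n j) (\<lambda>i. m i j))" for m
  show ?thesis
  proof (rule that[of \<phi>])
    show "abelian_group_hom F.Mz G \<phi>"
    proof (intro abelian_group_homI' F.series_abelian_group G)
      fix m m' assume m: "m \<in> carrier F.Mz" "m' \<in> carrier F.Mz"
      note comp = free_component_closed[OF m(1)] free_component_closed[OF m(2)]
      have sum: "(\<lambda>i. (m \<oplus>\<^bsub>F.Mz\<^esub> m') i j) = (\<lambda>i. m i j) \<oplus>\<^bsub>?S\<^esub> (\<lambda>i. m' i j)" if "j < n" for j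
        using that by (simp add: series_module_simps laurent_ring_simps free_rmodule_simps)
      have "\<phi> (m \<oplus>\<^bsub>F.Mz\<^esub> m') = (\<Oplus>\<^bsub>G\<^esub>j\<in>{..<n}. \<beta> (unit_vector n j) (\<lambda>i. m i j)
          \<oplus>\<^bsub>G\<^esub> \<beta> (unit_vector n j) (\<lambda>i. m' i j))"
        unfolding \<phi>_def using comp
        by (intro G.finsum_cong') (auto simp: sum b unit_vector_closed)
      also have "\<dots> = \<phi> m \<oplus>\<^bsub>G\<^esub> \<phi> m'"
        unfolding \<phi>_def using comp
        by (intro G.finsum_addf) (auto simp: b unit_vector_closed)
      finally show "\<phi> (m \<oplus>\<^bsub>F.Mz\<^esub> m') = \<phi> m \<oplus>\<^bsub>G\<^esub> \<phi> m'" .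
    next
      fix m assume m: "m \<in> carrier F.Mz"
      show "\<phi> m \<in> carrier G"
        unfolding \<phi>_def using free_component_closed[OF m]
        by (intro G.finsum_closed) (auto simp: b unit_vector_closed)
    qed
    \<comment> \<open>For a product \<open>x s\<close>, balance moves the coordinate
      \<open>x j\<close> from the series into the first argument of \<beta>. Additivity there
      reassembles \<open>x\<close> from the multiples of the unit vectors, one truncation at a
      time.\<close>
    fix x s assume x: "x \<in> carrier ?F" and s: "s \<in> carrier ?S"
    have xj: "x j \<in> carrier R" if "j < n" for j
      using x that by (auto simp: free_rmodule_simps PiE_iff)
    have hom: "abelian_group_hom ?F G (\<lambda>x. \<beta> x s)"
      using s by (intro abelian_group_homI' F.M.abelian_group_axioms G) (auto simp: b)
    have car: "\<beta> (unit_vector n j \<triangleleft>\<^bsub>?F\<^esub> x j) s \<in> carrier G" if "j < n" for j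
      using that s xj by (intro b F.ract_closed unit_vector_closed) auto
    have "(\<Oplus>\<^bsub>G\<^esub>j\<in>{..<k}. \<beta> (unit_vector n j \<triangleleft>\<^bsub>?F\<^esub> x j) s) = \<beta> (truncate_vector n k x) s"
      if "k \<le> n" for k
      using that
    proof (induction k)
      case 0
      then show ?case using abelian_group_homD(5)[OF hom] by (simp add: truncate_vector_0)
    next
      case (Suc k)
      have "(\<Oplus>\<^bsub>G\<^esub>j\<in>{..<Suc k}. \<beta> (unit_vector n j \<triangleleft>\<^bsub>?F\<^esub> x j) s)
          = \<beta> (unit_vector n k \<triangleleft>\<^bsub>?F\<^esub> x k) s \<oplus>\<^bsub>G\<^esub> \<beta> (truncate_vector n k x) s"
        using Suc car unfolding lessThan_Suc by (subst G.finsum_insert) auto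
      also have "\<dots> = \<beta> (truncate_vector n (Suc k) x) s"
        using Suc x s xj car[of k]
        by (simp add: truncate_vector_Suc b truncate_vector_closed F.ract_closed
            unit_vector_closed G.a_comm)
      finally show ?case .
    qed
    from this[of n] have "(\<Oplus>\<^bsub>G\<^esub>j\<in>{..<n}. \<beta> (unit_vector n j \<triangleleft>\<^bsub>?F\<^esub> x j) s) = \<beta> x s"
      using x by (simp add: truncate_vector_self)
    moreover have "\<phi> (\<lambda>i. x \<triangleleft>\<^bsub>?F\<^esub> s i) = (\<Oplus>\<^bsub>G\<^esub>j\<in>{..<n}. \<beta> (unit_vector n j \<triangleleft>\<^bsub>?F\<^esub> x j) s)"
      unfolding \<phi>_def using car s xj
      by (intro G.finsum_cong') (auto simp: free_rmodule_simps(4) b(4)[unfolded free_rmodule_simps(4)] unit_vector_closed)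
    ultimately show "\<phi> (\<lambda>i. x \<triangleleft>\<^bsub>?F\<^esub> s i) = \<beta> x s" by simp
  qed
qed

text \<open>Coefficients are lifted independently, but zero coefficients are lifted to zero. The
  support therefore does not grow, and the lift satisfies the same condition
  \<open>P\<close>.\<close>

lemma series_lift:
  assumes "right_module R M" and g: "g \<in> rmod_hom R (free_rmodule R n) M"
    and m: "m \<in> carrier (series_module P R M)"
    and lift: "\<And>i. m i \<in> g ` carrier (free_rmodule R n)"
  obtains s where "s \<in> carrier (series_module P R (free_rmodule R n))" "m = (\<lambda>i. g (s i))"
proof -
  let ?F = "free_rmodule R n"
  interpret F: laurent R ?F P by (rule free_laurent)
  have g0: "g \<zero>\<^bsub>?F\<^esub> = \<zero>\<^bsub>M\<^esub>"
    by (rule abelian_group_homD(5)[OF rmod_hom_abelian_group_hom[OF g free_right_module assms(1)]])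
  have "\<exists>x\<in>carrier ?F. g x = m i \<and> (m i = \<zero>\<^bsub>M\<^esub> \<longrightarrow> x = \<zero>\<^bsub>?F\<^esub>)" for i
  proof (cases "m i = \<zero>\<^bsub>M\<^esub>")
    case True
    then show ?thesis using g0 by (intro bexI[of _ "\<zero>\<^bsub>?F\<^esub>"]) auto
  qed (use lift[of i] in auto)
  then obtain s where s: "\<And>i. s i \<in> carrier ?F" "\<And>i. g (s i) = m i"
      "\<And>i. m i = \<zero>\<^bsub>M\<^esub> \<Longrightarrow> s i = \<zero>\<^bsub>?F\<^esub>"
    by metis
  have "P {i. s i \<noteq> \<zero>\<^bsub>?F\<^esub>}"
    using m s(3) by (intro supp_subset[of "{i. m i \<noteq> \<zero>\<^bsub>M\<^esub>}" "{i. s i \<noteq> \<zero>\<^bsub>?F\<^esub>}"])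
      (auto simp: series_module_simps)
  then have "s \<in> carrier F.Mz" using s by (simp add: series_module_simps)
  then show ?thesis using that[of s] s by auto
qed

text \<open>The series is lifted along a surjection from a free module of finite rank, where the
  corresponding induction is available, and the generators are mapped back to products
  \<open>x s\<close>.\<close>

lemma fp_series_induct:
  assumes M: "right_module R M" and fp: "finitely_presented R M"
    and m: "m \<in> carrier (series_module P R M)"
    and zero: "Q \<zero>\<^bsub>series_module P R M\<^esub>"
    and add: "\<And>m m'. \<lbrakk>m \<in> carrier (series_module P R M);
        m' \<in> carrier (series_module P R M); Q m; Q m'\<rbrakk> \<Longrightarrow> Q (m \<oplus>\<^bsub>series_module P R M\<^esub> m')"
    and act: "\<And>x s. \<lbrakk>x \<in> carrier M; s \<in> carrier (laurent_ring P R)\<rbrakk> \<Longrightarrow> Q (\<lambda>i. x \<triangleleft>\<^bsub>M\<^esub> s i)"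
  shows "Q m"
proof -
  obtain n g where g: "g \<in> rmod_hom R (free_rmodule R n) M"
      and surj: "g ` carrier (free_rmodule R n) = carrier M"
    using fp unfolding finitely_presented_def by blast
  let ?F = "free_rmodule R n"
  interpret F: laurent R ?F P by (rule free_laurent)
  have hom: "abelian_group_hom F.Mz (series_module P R M) (\<lambda>m i. g (m i))"
    by (intro series_map_hom free_laurent laurentI M
        rmod_hom_abelian_group_hom[OF g free_right_module])
  note h = abelian_group_homD[OF hom]
  obtain s where s: "s \<in> carrier F.Mz" "m = (\<lambda>i. g (s i))"
    using series_lift[OF M g m] surj m by (auto simp: series_module_simps)
  have "Q (\<lambda>i. g (s i))"
    using s(1)
  proof (rule free_series_induct)
    show "Q (\<lambda>i. g (\<zero>\<^bsub>F.Mz\<^esub> i))" using zero h(5) by simp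
    show "Q (\<lambda>i. g ((s \<oplus>\<^bsub>F.Mz\<^esub> t) i))"
      if "s \<in> carrier F.Mz" "t \<in> carrier F.Mz" "Q (\<lambda>i. g (s i))" "Q (\<lambda>i. g (t i))" for s t
      using add[OF h(3)[OF that(1)] h(3)[OF that(2)] that(3,4)] h(4)[OF that(1,2)] by simp
    show "Q (\<lambda>i. g (x \<triangleleft>\<^bsub>?F\<^esub> t i))" if "x \<in> carrier ?F" "t \<in> carrier (laurent_ring P R)" for x t
      using act[of "g x" t] rmod_homD[OF g] that by (simp add: laurent_ring_simps)
  qed
  then show ?thesis using s by simp
qed

text \<open>
  This is the isomorphism of \<open>M \<otimes>\<^sub>R R((z))\<close> with \<open>M((z))\<close>, which needs \<open>M\<close> to be finitely presented,
  in the form of a universal property of \<open>M((z))\<close>.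
\<close>

lemma fp_series_universal:
  assumes M: "right_module R M" and fp: "finitely_presented R M" and G: "abelian_group G"
    and \<beta>: "balanced R M (ring_bimodule (laurent_const R) (laurent_ring P R)) G \<beta>"
  obtains \<phi> where "abelian_group_hom (series_module P R M) G \<phi>"
    "\<And>x s. \<lbrakk>x \<in> carrier M; s \<in> carrier (laurent_ring P R)\<rbrakk> \<Longrightarrow> \<phi> (\<lambda>i. x \<triangleleft>\<^bsub>M\<^esub> s i) = \<beta> x s"
proof -
  let ?S = "laurent_ring P R"
  obtain k n f g where f: "f \<in> rmod_hom R (free_rmodule R k) (free_rmodule R n)"
      and g: "g \<in> rmod_hom R (free_rmodule R n) M"
      and surj: "g ` carrier (free_rmodule R n) = carrier M"
      and exact: "{x \<in> carrier (free_rmodule R n). g x = \<zero>\<^bsub>M\<^esub>} = f ` carrier (free_rmodule R k)"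
    using fp unfolding finitely_presented_def by blast
  let ?F = "free_rmodule R n" and ?E = "free_rmodule R k"
  interpret M: laurent R M P by (intro laurentI M)
  interpret F: laurent R ?F P by (rule free_laurent)
  interpret E: laurent R ?E P by (rule free_laurent)
  interpret G: abelian_group G by fact
  note g' = rmod_homD[OF g] and f' = rmod_homD[OF f]
  have g_hom: "abelian_group_hom F.Mz M.Mz (\<lambda>m i. g (m i))"
    by (intro series_map_hom free_laurent laurentI M
        rmod_hom_abelian_group_hom[OF g free_right_module])
  have f_hom: "abelian_group_hom E.Mz F.Mz (\<lambda>m i. f (m i))"
    by (intro series_map_hom free_laurent
        rmod_hom_abelian_group_hom[OF f free_right_module free_right_module])
  have "balanced R ?F (ring_bimodule (laurent_const R) ?S) G (\<lambda>x. \<beta> (g x))"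
    using g' balancedD[OF \<beta>] by (intro balancedI) auto
  from free_series_universal[OF G this] obtain \<phi> where
    \<phi>: "abelian_group_hom F.Mz G \<phi>" and \<phi>_act: "\<And>x s. \<lbrakk>x \<in> carrier ?F; s \<in> carrier ?S\<rbrakk>
      \<Longrightarrow> \<phi> (\<lambda>i. x \<triangleleft>\<^bsub>?F\<^esub> s i) = \<beta> (g x) s"
    by metis
  note \<phi>' = abelian_group_homD[OF \<phi>]
  have \<beta>_zero: "\<beta> \<zero>\<^bsub>M\<^esub> s = \<zero>\<^bsub>G\<^esub>" if "s \<in> carrier ?S" for s
  proof -
    have "abelian_group_hom M G (\<lambda>x. \<beta> x s)"
      using that balancedD[OF \<beta>]
      by (intro abelian_group_homI' M.M.abelian_group_axioms G) (auto simp: ring_bimodule_simps)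
    from abelian_group_homD(5)[OF this] show ?thesis .
  qed
  \<comment> \<open>On generators \<open>f (x s) = f x s\<close>, and \<phi> takes this to \<beta>
    at \<open>g (f x) = 0\<close>. By induction \<phi> vanishes on all series coming from the
    relations; finite generation of the relations is used through this induction.\<close>
  have image: "\<phi> (\<lambda>i. f (t i)) = \<zero>\<^bsub>G\<^esub>" if t: "t \<in> carrier E.Mz" for t
    using t
  proof (rule free_series_induct)
    note ft = abelian_group_homD[OF abelian_group_hom_compose[OF f_hom \<phi>]]
    show "\<phi> (\<lambda>i. f (\<zero>\<^bsub>E.Mz\<^esub> i)) = \<zero>\<^bsub>G\<^esub>" by (rule ft(5))
    show "\<phi> (\<lambda>i. f ((s \<oplus>\<^bsub>E.Mz\<^esub> t) i)) = \<zero>\<^bsub>G\<^esub>"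
      if "s \<in> carrier E.Mz" "t \<in> carrier E.Mz" "\<phi> (\<lambda>i. f (s i)) = \<zero>\<^bsub>G\<^esub>" "\<phi> (\<lambda>i. f (t i)) = \<zero>\<^bsub>G\<^esub>" for s t
      using ft(4)[OF that(1,2)] that(3,4) by simp
    show "\<phi> (\<lambda>i. f (x \<triangleleft>\<^bsub>?E\<^esub> s i)) = \<zero>\<^bsub>G\<^esub>" if x: "x \<in> carrier ?E" and s: "s \<in> carrier ?S" for x s
    proof -
      have "f x \<in> {x \<in> carrier ?F. g x = \<zero>\<^bsub>M\<^esub>}" unfolding exact using x by blast
      then have "g (f x) = \<zero>\<^bsub>M\<^esub>" by simp
      then show ?thesis
        using \<phi>_act[OF f'(1)[OF x] s] \<beta>_zero[OF s] s x f'(3) by (simp add: laurent_ring_simps)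
    qed
  qed
  \<comment> \<open>By exactness each coefficient lies in the image of \<open>f\<close>, and
    \<open>series_lift\<close> collects the preimages into a single series with an admissible
    support.\<close>
  have kernel: "\<phi> s = \<zero>\<^bsub>G\<^esub>" if s: "s \<in> carrier F.Mz" and gs: "\<And>i. g (s i) = \<zero>\<^bsub>M\<^esub>" for s
  proof -
    have "s i \<in> f ` carrier ?E" for i
      unfolding exact[symmetric] using s gs by (simp add: series_module_simps)
    then obtain t where "t \<in> carrier E.Mz" "s = (\<lambda>i. f (t i))"
      using series_lift[OF free_right_module f s] by metis
    then show ?thesis using image by simp
  qed
  interpret Fz: abelian_group F.Mz by (rule F.series_abelian_group)
  have well_defined: "\<phi> s = \<phi> t"
    if s: "s \<in> carrier F.Mz" and t: "t \<in> carrier F.Mz" and eq: "(\<lambda>i. g (s i)) = (\<lambda>i. g (t i))" for s t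
  proof -
    interpret Mz: abelian_group M.Mz by (rule M.series_abelian_group)
    have "(\<lambda>i. g ((s \<ominus>\<^bsub>F.Mz\<^esub> t) i)) = (\<lambda>i. g (s i)) \<ominus>\<^bsub>M.Mz\<^esub> (\<lambda>i. g (t i))"
      by (rule abelian_group_homD(7)[OF g_hom s t])
    also have "\<dots> = \<zero>\<^bsub>M.Mz\<^esub>"
      unfolding eq using abelian_group_homD(3)[OF g_hom t] by (simp add: Mz.minus_eq Mz.r_neg)
    finally have "\<And>i. g ((s \<ominus>\<^bsub>F.Mz\<^esub> t) i) = \<zero>\<^bsub>M\<^esub>"
      by (simp add: series_module_simps fun_eq_iff)
    then have "\<phi> s \<ominus>\<^bsub>G\<^esub> \<phi> t = \<zero>\<^bsub>G\<^esub>"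
      using kernel[of "s \<ominus>\<^bsub>F.Mz\<^esub> t"] s t \<phi>'(7) by simp
    then show ?thesis
      using \<phi>'(3)[OF s] \<phi>'(3)[OF t] by (metis G.add.inv_solve_right' G.minus_eq G.l_zero G.zero_closed)
  qed
  have "\<exists>s. s \<in> carrier F.Mz \<and> m = (\<lambda>i. g (s i))" if "m \<in> carrier M.Mz" for m
    using series_lift[OF M g that] surj that by (metis series_module_simps(1))
  \<comment> \<open>The lifts are chosen arbitrarily. They need not be additive, but
    \<open>well_defined\<close> shows that \<phi> does not depend on the choice.\<close>
  then obtain lift where lift: "\<And>m. m \<in> carrier M.Mz \<Longrightarrow> lift m \<in> carrier F.Mz"
      "\<And>m. m \<in> carrier M.Mz \<Longrightarrow> (\<lambda>i. g (lift m i)) = m"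
    by metis
  show ?thesis
  proof (rule that[of "\<lambda>m. \<phi> (lift m)"])
    show "abelian_group_hom M.Mz G (\<lambda>m. \<phi> (lift m))"
    proof (intro abelian_group_homI' M.series_abelian_group G)
      fix m m' assume m: "m \<in> carrier M.Mz" "m' \<in> carrier M.Mz"
      have "\<phi> (lift (m \<oplus>\<^bsub>M.Mz\<^esub> m')) = \<phi> (lift m \<oplus>\<^bsub>F.Mz\<^esub> lift m')"
        using m abelian_group_homD(4)[OF g_hom lift(1)[OF m(1)] lift(1)[OF m(2)]]
        by (intro well_defined) (auto simp: lift M.series_add_closed)
      then show "\<phi> (lift (m \<oplus>\<^bsub>M.Mz\<^esub> m')) = \<phi> (lift m) \<oplus>\<^bsub>G\<^esub> \<phi> (lift m')"
        using m by (simp add: \<phi>' lift)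
    qed (simp add: \<phi>' lift)
    fix x s assume x: "x \<in> carrier M" and s: "s \<in> carrier ?S"
    obtain y where y: "y \<in> carrier ?F" "x = g y" using x surj by blast
    have si: "s i \<in> carrier R" for i using s by (simp add: laurent_ring_simps)
    have ys: "(\<lambda>i. y \<triangleleft>\<^bsub>?F\<^esub> s i) \<in> carrier F.Mz"
      using F.act_closed[OF F.const_closed[OF y(1)] s] F.act_const[OF y(1) si] by simp
    have xs: "(\<lambda>i. x \<triangleleft>\<^bsub>M\<^esub> s i) \<in> carrier M.Mz"
      using M.act_closed[OF M.const_closed[OF x] s] M.act_const[OF x si] by simp
    have "\<phi> (lift (\<lambda>i. x \<triangleleft>\<^bsub>M\<^esub> s i)) = \<phi> (\<lambda>i. y \<triangleleft>\<^bsub>?F\<^esub> s i)"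
      using xs ys y g'(3) si by (intro well_defined lift) (simp_all add: lift)
    then show "\<phi> (lift (\<lambda>i. x \<triangleleft>\<^bsub>M\<^esub> s i)) = \<beta> x s"
      using \<phi>_act[OF y(1) s] y by simp
  qed
qed

end


section \<open>Novikov tensor products as modules of series\<close>

context laurent_ring_support
begin

abbreviation (input) "Lp \<equiv> laurent_polynomials R"
abbreviation (input) "Nov \<equiv> laurent_ring P R"
abbreviation (input) "LB \<equiv> laurent_bimodule R"
abbreviation (input) "NB \<equiv> ring_bimodule (\<lambda>p. p) (laurent_ring P R)"
abbreviation (input) "TL M \<equiv> tensor R M (laurent_bimodule R)"
abbreviation (input) "Ser M \<equiv> series_module P R M"

lemma Nov_ring: "ring Nov"
  by (rule laurent.laurent_ring_ring[OF free_laurent])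

lemma finite_laurent_ring_support: "laurent_ring_support R finite"
  by (intro laurent_ring_support.intro ring_axioms laurent_support_finite)

lemma Lp_ring: "ring Lp"
  unfolding laurent_polynomials_def
  by (rule laurent_ring_support.Nov_ring[OF finite_laurent_ring_support])

lemma Lp_closed: "p \<in> carrier Lp \<Longrightarrow> p i \<in> carrier R"
  by (simp add: laurent_polynomials_def laurent_ring_simps)

lemma Lp_subset_Nov: "p \<in> carrier Lp \<Longrightarrow> p \<in> carrier Nov"
  by (simp add: laurent_polynomials_def laurent_ring_simps supp_finite)

lemma Lp_simps:
  "p \<otimes>\<^bsub>Lp\<^esub> q = p \<otimes>\<^bsub>Nov\<^esub> q" "p \<oplus>\<^bsub>Lp\<^esub> q = p \<oplus>\<^bsub>Nov\<^esub> q" "\<one>\<^bsub>Lp\<^esub> = \<one>\<^bsub>Nov\<^esub>"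
  by (simp_all add: laurent_polynomials_def laurent_ring_simps)

lemma laurent_const_closed: "r \<in> carrier R \<Longrightarrow> laurent_const R r \<in> carrier Lp"
  by (auto simp: laurent_polynomials_def laurent_ring_simps laurent_const_def)

lemma laurent_z_closed: "laurent_z R \<in> carrier Lp"
  by (auto simp: laurent_polynomials_def laurent_ring_simps laurent_z_def)

lemma laurent_z_mult:
  assumes "\<And>i. p i \<in> carrier R"
  shows "laurent_z R \<otimes>\<^bsub>Nov\<^esub> p = (\<lambda>i. p (i - 1))"
proof
  fix n
  interpret reg: laurent R "regular_module R" P
    by (intro laurentI regular_module_right_module ring_axioms)
  have "series_act R (regular_module R) (laurent_z R) p n
      = (\<Oplus>\<^bsub>regular_module R\<^esub>i\<in>{1}. laurent_z R i \<triangleleft>\<^bsub>regular_module R\<^esub> p (n - i))"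
    using assms by (intro reg.act_eq_finsum) (auto simp: laurent_z_def split: if_splits)
  then show "(laurent_z R \<otimes>\<^bsub>Nov\<^esub> p) n = p (n - 1)"
    using assms by (simp add: laurent_ring_simps finsum_regular_module laurent_z_def)
qed

lemma tensor_factors_LB: "right_module R M \<Longrightarrow> tensor_factors R Lp M LB"
  by (intro tensor_factors_ring_bimodule Lp_ring laurent_const_closed)

lemma tensor_factors_NB: "right_module Lp Y \<Longrightarrow> tensor_factors Lp Nov Y NB"
  by (intro tensor_factors_ring_bimodule Nov_ring Lp_subset_Nov)

lemma TL_right_module: "right_module R M \<Longrightarrow> right_module Lp (TL M)"
  by (rule tensor_factors.tensor_right_module[OF tensor_factors_LB])

lemma act_hom:
  assumes "right_module R M" "s \<in> carrier Nov"
  shows "abelian_group_hom (Ser M) (Ser M) (\<lambda>m. series_act R M m s)"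
  using ract_abelian_group_hom[OF laurent.series_right_module[OF laurentI[OF assms(1)]] assms(2)]
  by (simp add: series_module_simps)

text \<open>The canonical map \<open>x \<otimes> p \<mapsto> x p\<close> from polynomials to series
  with coefficients in \<open>M\<close>. It is selected from the existence statement of the
  universal property and determined on the tensor product by its values on elementary
  tensors.\<close>

definition expand :: "('a, 'm) rmodule \<Rightarrow> ('m \<times> (int \<Rightarrow> 'a) \<Rightarrow>\<^sub>0 int) set \<Rightarrow> int \<Rightarrow> 'm" where
  "expand M = (SOME \<psi>. abelian_group_hom (TL M) (Ser M) \<psi> \<and>
     (\<forall>x\<in>carrier M. \<forall>p\<in>carrier Lp. \<psi> (tens R M LB x p) = (\<lambda>i. x \<triangleleft>\<^bsub>M\<^esub> p i)))"

context
  fixes M :: "('a, 'm) rmodule"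
  assumes M: "right_module R M"
begin

interpretation M: laurent R M P by (rule laurentI[OF M])
interpretation TL: tensor_factors R Lp M LB by (rule tensor_factors_LB[OF M])

lemma act_const': "\<lbrakk>x \<in> carrier M; p \<in> carrier Nov\<rbrakk>
    \<Longrightarrow> series_act R M (const_series M x) p = (\<lambda>i. x \<triangleleft>\<^bsub>M\<^esub> p i)"
  by (rule M.act_const) (simp_all add: laurent_ring_simps)

lemma elementary_series_closed:
  "\<lbrakk>x \<in> carrier M; p \<in> carrier Nov\<rbrakk> \<Longrightarrow> (\<lambda>i. x \<triangleleft>\<^bsub>M\<^esub> p i) \<in> carrier (Ser M)"
  using M.act_closed[OF M.const_closed] by (simp add: act_const'[symmetric])

lemma expand:
  shows expand_hom: "abelian_group_hom (TL M) (Ser M) (expand M)"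
    and expand_tens: "\<lbrakk>x \<in> carrier M; p \<in> carrier Lp\<rbrakk> \<Longrightarrow> expand M (tens R M LB x p) = (\<lambda>i. x \<triangleleft>\<^bsub>M\<^esub> p i)"
proof -
  have "balanced R M LB (Ser M) (\<lambda>x p i. x \<triangleleft>\<^bsub>M\<^esub> p i)"
  proof (rule balancedI)
    fix x r p assume x: "x \<in> carrier M" and r: "r \<in> carrier R" and p: "p \<in> carrier LB"
    then have p': "\<And>i. p i \<in> carrier R" by (simp add: ring_bimodule_simps Lp_closed)
    show "(\<lambda>i. x \<triangleleft>\<^bsub>M\<^esub> r \<triangleleft>\<^bsub>M\<^esub> p i) = (\<lambda>i. x \<triangleleft>\<^bsub>M\<^esub> lact LB r p i)"
      using x r p' by (simp add: ring_bimodule_simps Lp_simps laurent_const_mult M.ract_assoc)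
  qed (auto simp: ring_bimodule_simps Lp_subset_Nov Lp_closed elementary_series_closed Lp_simps
      laurent_ring_simps(4) series_module_simps(3) M.ract_add_left M.ract_add_right)
  from TL.tensor_universal[OF M.series_abelian_group this]
  have "\<exists>\<psi>. abelian_group_hom (TL M) (Ser M) \<psi> \<and>
      (\<forall>x\<in>carrier M. \<forall>p\<in>carrier Lp. \<psi> (tens R M LB x p) = (\<lambda>i. x \<triangleleft>\<^bsub>M\<^esub> p i))"
    by (metis ring_bimodule_simps(1))
  then have "abelian_group_hom (TL M) (Ser M) (expand M) \<and>
      (\<forall>x\<in>carrier M. \<forall>p\<in>carrier Lp. expand M (tens R M LB x p) = (\<lambda>i. x \<triangleleft>\<^bsub>M\<^esub> p i))"
    unfolding expand_def by (rule someI_ex)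
  then show "abelian_group_hom (TL M) (Ser M) (expand M)"
    "\<lbrakk>x \<in> carrier M; p \<in> carrier Lp\<rbrakk> \<Longrightarrow> expand M (tens R M LB x p) = (\<lambda>i. x \<triangleleft>\<^bsub>M\<^esub> p i)"
    by auto
qed

text \<open>For an elementary tensor \<open>x \<otimes> q\<close> the claim is associativity of the
  series action, applied to the constant series \<open>x\<close>.\<close>

lemma expand_ract:
  assumes w: "w \<in> carrier (TL M)" and p: "p \<in> carrier Lp"
  shows "expand M (w \<triangleleft>\<^bsub>TL M\<^esub> p) = series_act R M (expand M w) p"
proof (rule TL.tensor_hom_eqI[OF abelian_group_hom_compose[OF TL.tensor_ract_hom[OF p] expand_hom]
      abelian_group_hom_compose[OF expand_hom act_hom[OF M Lp_subset_Nov[OF p]]] w])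
  fix x q assume x: "x \<in> carrier M" and q: "q \<in> carrier LB"
  then have q': "q \<in> carrier Lp" by (simp add: ring_bimodule_simps)
  have qp: "q \<otimes>\<^bsub>Lp\<^esub> p \<in> carrier Lp"
    using q' p Lp_ring by (simp add: ring.is_monoid monoid.m_closed)
  have "expand M (tens R M LB x q \<triangleleft>\<^bsub>TL M\<^esub> p) = series_act R M (const_series M x) (q \<otimes>\<^bsub>Lp\<^esub> p)"
    using x q' p qp
    by (simp only: TL.tens_ract ring_bimodule_simps expand_tens act_const' Lp_subset_Nov)
  also have "\<dots> = series_act R M (series_act R M (const_series M x) q) p"
    unfolding Lp_simps using x q' p by (intro M.act_assoc M.const_closed Lp_subset_Nov)
  finally show "expand M (tens R M LB x q \<triangleleft>\<^bsub>TL M\<^esub> p) = series_act R M (expand M (tens R M LB x q)) p"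
    using x q' by (simp only: expand_tens act_const' Lp_subset_Nov)
qed

lemma laurent_one_closed: "\<one>\<^bsub>Lp\<^esub> \<in> carrier Lp"
  using Lp_ring by (simp add: ring.is_monoid monoid.one_closed)

lemma expand_tens_one:
  assumes x: "x \<in> carrier M"
  shows "expand M (tens R M LB x \<one>\<^bsub>Lp\<^esub>) = const_series M x"
proof -
  have "expand M (tens R M LB x \<one>\<^bsub>Lp\<^esub>) = series_act R M (const_series M x) \<one>\<^bsub>Lp\<^esub>"
    using x by (simp only: expand_tens laurent_one_closed act_const' Lp_subset_Nov)
  also have "\<dots> = const_series M x"
    unfolding Lp_simps by (rule M.act_one[OF M.const_closed[OF x]])
  finally show ?thesis .
qed

lemma shift_hom: "abelian_group_hom (Ser M) (Ser M) (\<lambda>m i. m (i - 1))"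
proof (intro abelian_group_homI' M.series_abelian_group)
  fix m assume m: "m \<in> carrier (Ser M)"
  have "P {i. m (i - 1) \<noteq> \<zero>\<^bsub>M\<^esub>}"
  proof (rule supp_subset)
    have "P {i. m i \<noteq> \<zero>\<^bsub>M\<^esub>}" using m by (simp add: series_module_simps)
    then show "P {i + j | i j. i \<in> {i. m i \<noteq> \<zero>\<^bsub>M\<^esub>} \<and> j \<in> {1}}"
      by (rule supp_sum) (simp add: supp_finite)
    show "{i. m (i - 1) \<noteq> \<zero>\<^bsub>M\<^esub>} \<subseteq> {i + j | i j. i \<in> {i. m i \<noteq> \<zero>\<^bsub>M\<^esub>} \<and> j \<in> {1}}"
    proof
      fix i assume "i \<in> {i. m (i - 1) \<noteq> \<zero>\<^bsub>M\<^esub>}"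
      then show "i \<in> {i + j | i j. i \<in> {i. m i \<noteq> \<zero>\<^bsub>M\<^esub>} \<and> j \<in> {1}}"
        by (intro CollectI exI[of _ "i - 1"] exI[of _ 1]) simp
    qed
  qed
  then show "(\<lambda>i. m (i - 1)) \<in> carrier (Ser M)" using m by (simp add: series_module_simps)
qed (simp add: series_module_simps)

text \<open>Shifting the index of summation by one; conceptually, multiplication by \<open>z\<close>
  commutes with the right action.\<close>

lemma act_shift:
  assumes m: "m \<in> carrier (Ser M)" and s: "s \<in> carrier Nov"
  shows "series_act R M (\<lambda>i. m (i - 1)) s = (\<lambda>i. series_act R M m s (i - 1))"
proof
  fix n
  let ?A = "{i. m i \<noteq> \<zero>\<^bsub>M\<^esub> \<and> s (n - 1 - i) \<noteq> \<zero>}"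
  have car: "m i \<in> carrier M" "s i \<in> carrier R" for i
    using m s by (auto simp: series_module_simps laurent_ring_simps)
  have "series_act R M (\<lambda>i. m (i - 1)) s n = (\<Oplus>\<^bsub>M\<^esub>i\<in>(\<lambda>i. i + 1) ` ?A. m (i - 1) \<triangleleft>\<^bsub>M\<^esub> s (n - i))"
  proof (rule M.act_eq_finsum)
    fix i assume "m (i - 1) \<noteq> \<zero>\<^bsub>M\<^esub>" "s (n - i) \<noteq> \<zero>"
    then show "i \<in> (\<lambda>i. i + 1) ` ?A" by (intro image_eqI[of _ _ "i - 1"]) auto
  qed (use car M.conv_finite[OF m s] in simp_all)
  also have "\<dots> = (\<Oplus>\<^bsub>M\<^esub>i\<in>?A. m (i + 1 - 1) \<triangleleft>\<^bsub>M\<^esub> s (n - (i + 1)))"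
    using car by (intro M.M.finsum_reindex) (auto simp: M.ract_closed inj_on_def)
  also have "\<dots> = series_act R M m s (n - 1)"
    by (simp add: series_act_def algebra_simps)
  finally show "series_act R M (\<lambda>i. m (i - 1)) s n = series_act R M m s (n - 1)" .
qed

end

section \<open>Compatibility of the expansion with \<open>z\<close> and with module
  homomorphisms\<close>

lemma z_mult_hom:
  shows "abelian_group_hom LB LB (\<lambda>p. laurent_z R \<otimes>\<^bsub>Lp\<^esub> p)"
    and "\<lbrakk>r \<in> carrier R; p \<in> carrier LB\<rbrakk> \<Longrightarrow> laurent_z R \<otimes>\<^bsub>Lp\<^esub> lact LB r p = lact LB r (laurent_z R \<otimes>\<^bsub>Lp\<^esub> p)"
    and "\<lbrakk>p \<in> carrier LB; q \<in> carrier Lp\<rbrakk>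
      \<Longrightarrow> laurent_z R \<otimes>\<^bsub>Lp\<^esub> (p \<triangleleft>\<^bsub>LB\<^esub> q) = (laurent_z R \<otimes>\<^bsub>Lp\<^esub> p) \<triangleleft>\<^bsub>LB\<^esub> q"
proof -
  interpret Lp: ring Lp by (rule Lp_ring)
  note z = laurent_z_closed
  show "abelian_group_hom LB LB (\<lambda>p. laurent_z R \<otimes>\<^bsub>Lp\<^esub> p)"
    using tensor_factors.axioms(3)[OF tensor_factors_LB[OF free_right_module]]
    by (intro abelian_group_homI') (auto simp: ring_bimodule_simps z Lp.r_distr)
  show "laurent_z R \<otimes>\<^bsub>Lp\<^esub> lact LB r p = lact LB r (laurent_z R \<otimes>\<^bsub>Lp\<^esub> p)"
    if "r \<in> carrier R" "p \<in> carrier LB"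
  proof -
    have p: "p i \<in> carrier R" for i using that by (simp add: ring_bimodule_simps Lp_closed)
    then show ?thesis
      using that(1) by (simp add: ring_bimodule_simps Lp_simps laurent_const_mult laurent_z_mult)
  qed
  show "laurent_z R \<otimes>\<^bsub>Lp\<^esub> (p \<triangleleft>\<^bsub>LB\<^esub> q) = (laurent_z R \<otimes>\<^bsub>Lp\<^esub> p) \<triangleleft>\<^bsub>LB\<^esub> q"
    if "p \<in> carrier LB" "q \<in> carrier Lp"
    using that by (simp only: ring_bimodule_simps Lp.m_assoc z)
qed

lemma tensor_factors_hom_LB:
  assumes "right_module R M" "right_module R M'" "f \<in> rmod_hom R M M'"
  shows "tensor_factors_hom R Lp M LB M' LB f (\<lambda>p. p)"
  using assms
  by (intro tensor_factors_hom.intro tensor_factors_hom_axioms.intro tensor_factors_LB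
      abelian_group_homI' tensor_factors.axioms(3)[OF tensor_factors_LB] refl)

lemma expand_shift:
  assumes M: "right_module R M" and w: "w \<in> carrier (TL M)"
  shows "expand M (tensor_map R M LB (\<lambda>x. x) (\<lambda>p. laurent_z R \<otimes>\<^bsub>Lp\<^esub> p) w) = (\<lambda>i. expand M w (i - 1))"
proof -
  interpret TL: tensor_factors R Lp M LB by (rule tensor_factors_LB[OF M])
  interpret z: tensor_factors_hom R Lp M LB M LB "\<lambda>x. x" "\<lambda>p. laurent_z R \<otimes>\<^bsub>Lp\<^esub> p"
    by (intro tensor_factors_hom.intro tensor_factors_hom_axioms.intro TL.tensor_factors_axioms
        z_mult_hom rmod_homI refl)
  show ?thesis
  proof (rule TL.tensor_hom_eqI[OF abelian_group_hom_compose[OF z.tensor_map_hom expand_hom[OF M]]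
        abelian_group_hom_compose[OF expand_hom[OF M] shift_hom[OF M]] w])
    fix x p assume x: "x \<in> carrier M" and p: "p \<in> carrier LB"
    then have p': "p \<in> carrier Lp" by (simp add: ring_bimodule_simps)
    have zp: "laurent_z R \<otimes>\<^bsub>Lp\<^esub> p \<in> carrier Lp"
      using p' Lp_ring laurent_z_closed by (simp add: ring.is_monoid monoid.m_closed)
    have "laurent_z R \<otimes>\<^bsub>Lp\<^esub> p = (\<lambda>i. p (i - 1))"
      using Lp_closed[OF p'] by (simp add: Lp_simps laurent_z_mult)
    then show "expand M (tensor_map R M LB (\<lambda>x. x) (\<lambda>p. laurent_z R \<otimes>\<^bsub>Lp\<^esub> p) (tens R M LB x p))
        = (\<lambda>i. expand M (tens R M LB x p) (i - 1))"
      unfolding z.tensor_map_tens expand_tens[OF M x p'] expand_tens[OF M x zp] by simp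
  qed
qed

lemma expand_map:
  assumes M: "right_module R M" and M': "right_module R M'" and f: "f \<in> rmod_hom R M M'"
    and w: "w \<in> carrier (TL M)"
  shows "expand M' (tensor_map R M' LB f (\<lambda>p. p) w) = (\<lambda>i. f (expand M w i))"
proof -
  interpret TL: tensor_factors R Lp M LB by (rule tensor_factors_LB[OF M])
  interpret f: tensor_factors_hom R Lp M LB M' LB f "\<lambda>p. p"
    by (rule tensor_factors_hom_LB[OF M M' f])
  have f_hom: "abelian_group_hom (Ser M) (Ser M') (\<lambda>m i. f (m i))"
    by (intro series_map_hom laurentI M M' rmod_hom_abelian_group_hom[OF f])
  show ?thesis
  proof (rule TL.tensor_hom_eqI[OF abelian_group_hom_compose[OF f.tensor_map_hom expand_hom[OF M']]
        abelian_group_hom_compose[OF expand_hom[OF M] f_hom] w])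
    fix x p assume x: "x \<in> carrier M" and p: "p \<in> carrier LB"
    then have p': "p \<in> carrier Lp" by (simp add: ring_bimodule_simps)
    show "expand M' (tensor_map R M' LB f (\<lambda>p. p) (tens R M LB x p))
        = (\<lambda>i. f (expand M (tens R M LB x p) i))"
      unfolding f.tensor_map_tens expand_tens[OF M x p'] expand_tens[OF M' rmod_homD(1)[OF f x] p']
      using rmod_homD(3)[OF f x] Lp_closed[OF p'] by simp
  qed
qed

text \<open>In the application \<open>j\<close> includes one summand of a term of the torus, and
  \<phi> is the corresponding part of the inverse of the comparison map. It is induced by
  \<open>x, s \<mapsto> j (x \<otimes> 1) \<otimes> s\<close>, which is balanced over
  \<open>R\<close> because a constant can be moved across both tensor signs.\<close>

lemma fp_expand_universal:
  assumes M: "right_module R M" and fp: "finitely_presented R M" and Y: "right_module Lp Y"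
    and j: "j \<in> rmod_hom Lp (TL M) Y"
  obtains \<phi> where "abelian_group_hom (Ser M) (tensor Lp Y NB) \<phi>"
    "\<And>w s. \<lbrakk>w \<in> carrier (TL M); s \<in> carrier Nov\<rbrakk>
      \<Longrightarrow> \<phi> (series_act R M (expand M w) s) = tens Lp Y NB (j w) s"
proof -
  interpret Lp: ring Lp by (rule Lp_ring)
  interpret Nov: ring Nov by (rule Nov_ring)
  interpret M: laurent R M P by (rule laurentI[OF M])
  interpret TL: tensor_factors R Lp M LB by (rule tensor_factors_LB[OF M])
  interpret TN: tensor_factors Lp Nov Y NB by (rule tensor_factors_NB[OF Y])
  note j' = rmod_homD[OF j]
  note tl = balancedD[OF TL.tens_balanced] and tn = balancedD[OF TN.tens_balanced]
  have j_hom: "abelian_group_hom (TL M) Y j"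
    by (rule rmod_hom_abelian_group_hom[OF j TL.tensor_right_module Y])
  have one: "\<one>\<^bsub>Lp\<^esub> \<in> carrier LB" by (simp add: ring_bimodule_simps)
  \<comment> \<open>\<open>x \<otimes> p\<close> is \<open>(x \<otimes> 1) p\<close>; linearity of
    \<open>j\<close> and the relation over the Laurent polynomials carry \<open>p\<close> across the
    second tensor sign.\<close>
  have scalar: "tens Lp Y NB (j (tens R M LB x p)) s = tens Lp Y NB (j (tens R M LB x \<one>\<^bsub>Lp\<^esub>)) (p \<otimes>\<^bsub>Nov\<^esub> s)"
    if x: "x \<in> carrier M" and p: "p \<in> carrier Lp" and s: "s \<in> carrier Nov" for x p s
  proof -
    have xt: "tens R M LB x \<one>\<^bsub>Lp\<^esub> \<in> carrier (TL M)" using x one by (rule TL.tens_closed)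
    have "tens R M LB x p = tens R M LB x \<one>\<^bsub>Lp\<^esub> \<triangleleft>\<^bsub>TL M\<^esub> p"
      using p by (simp only: TL.tens_ract ring_bimodule_simps Lp.l_one)
    then have "j (tens R M LB x p) = j (tens R M LB x \<one>\<^bsub>Lp\<^esub>) \<triangleleft>\<^bsub>Y\<^esub> p"
      using j'(3)[OF xt p] by simp
    then show ?thesis
      using tn(4)[OF j'(1)[OF xt] p, of s] s by (simp only: ring_bimodule_simps)
  qed
  have const_one: "laurent_const R r \<otimes>\<^bsub>Lp\<^esub> \<one>\<^bsub>Lp\<^esub> = laurent_const R r" if "r \<in> carrier R" for r
    using laurent_const_closed[OF that] by simp
  have "balanced R M (ring_bimodule (laurent_const R) Nov) (tensor Lp Y NB)
      (\<lambda>x s. tens Lp Y NB (j (tens R M LB x \<one>\<^bsub>Lp\<^esub>)) s)"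
  proof (rule balancedI)
    fix x r s assume x: "x \<in> carrier M" and r: "r \<in> carrier R"
      and s: "s \<in> carrier (ring_bimodule (laurent_const R) Nov)"
    then have s': "s \<in> carrier Nov" by (simp add: ring_bimodule_simps)
    have "tens R M LB (x \<triangleleft>\<^bsub>M\<^esub> r) \<one>\<^bsub>Lp\<^esub> = tens R M LB x (laurent_const R r)"
      using tl(4)[OF x r one] const_one[OF r] by (simp only: ring_bimodule_simps)
    then show "tens Lp Y NB (j (tens R M LB (x \<triangleleft>\<^bsub>M\<^esub> r) \<one>\<^bsub>Lp\<^esub>)) s
        = tens Lp Y NB (j (tens R M LB x \<one>\<^bsub>Lp\<^esub>)) (lact (ring_bimodule (laurent_const R) Nov) r s)"
      using scalar[OF x laurent_const_closed[OF r] s'] by (simp add: ring_bimodule_simps)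
  qed (use one in \<open>auto simp: ring_bimodule_simps tl tn[unfolded ring_bimodule_simps] j'\<close>)
  from fp_series_universal[OF M fp TN.tensor_abelian_group this] obtain \<phi> where
    \<phi>: "abelian_group_hom (Ser M) (tensor Lp Y NB) \<phi>" and \<phi>_act: "\<And>x s. \<lbrakk>x \<in> carrier M; s \<in> carrier Nov\<rbrakk>
      \<Longrightarrow> \<phi> (\<lambda>i. x \<triangleleft>\<^bsub>M\<^esub> s i) = tens Lp Y NB (j (tens R M LB x \<one>\<^bsub>Lp\<^esub>)) s"
    by metis
  show ?thesis
  proof (rule that[OF \<phi>])
    fix w s assume w: "w \<in> carrier (TL M)" and s: "s \<in> carrier Nov"
    have tn_hom: "abelian_group_hom Y (tensor Lp Y NB) (\<lambda>y. tens Lp Y NB y s)"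
      using s tn by (intro abelian_group_homI' right_moduleD(2)[OF Y] TN.tensor_abelian_group)
        (auto simp: ring_bimodule_simps)
    show "\<phi> (series_act R M (expand M w) s) = tens Lp Y NB (j w) s"
    proof (rule TL.tensor_hom_eqI[OF abelian_group_hom_compose[OF expand_hom[OF M]
            abelian_group_hom_compose[OF act_hom[OF M s] \<phi>]]
          abelian_group_hom_compose[OF j_hom tn_hom] w])
      fix x p assume x: "x \<in> carrier M" and p: "p \<in> carrier LB"
      then have p': "p \<in> carrier Lp" by (simp add: ring_bimodule_simps)
      have ps: "p \<otimes>\<^bsub>Nov\<^esub> s \<in> carrier Nov" using Lp_subset_Nov[OF p'] s by simp
      have "series_act R M (expand M (tens R M LB x p)) s
          = series_act R M (series_act R M (const_series M x) p) s"
        using x p' by (simp only: expand_tens[OF M] act_const'[OF M] Lp_subset_Nov)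
      also have "\<dots> = (\<lambda>i. x \<triangleleft>\<^bsub>M\<^esub> (p \<otimes>\<^bsub>Nov\<^esub> s) i)"
        using M.act_assoc[OF M.const_closed[OF x] Lp_subset_Nov[OF p'] s] act_const'[OF M x ps] by simp
      finally show "\<phi> (series_act R M (expand M (tens R M LB x p)) s) = tens Lp Y NB (j (tens R M LB x p)) s"
        using \<phi>_act[OF x ps] scalar[OF x p' s] by simp
    qed
  qed
qed

text \<open>Identifies a term of the extended torus with pairs of series. The outer tensor product
  provides the map to series, and its inverse comes from the universal property of series, applied
  to each summand. Both composites are tested on generators.\<close>

lemma novikov_tensor_series:
  assumes M: "right_module R M" and N: "right_module R N"
    and fpM: "finitely_presented R M" and fpN: "finitely_presented R N"
  obtains \<Psi> where
    "abelian_group_hom (tensor Lp (rmod_sum (TL M) (TL N)) NB) (rmod_sum (Ser M) (Ser N)) \<Psi>"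
    "\<And>v w s. \<lbrakk>v \<in> carrier (TL M); w \<in> carrier (TL N); s \<in> carrier Nov\<rbrakk>
      \<Longrightarrow> \<Psi> (tens Lp (rmod_sum (TL M) (TL N)) NB (v, w) s)
        = (series_act R M (expand M v) s, series_act R N (expand N w) s)"
    "bij_betw \<Psi> (carrier (tensor Lp (rmod_sum (TL M) (TL N)) NB)) (carrier (Ser M) \<times> carrier (Ser N))"
proof -
  let ?Y = "rmod_sum (TL M) (TL N)"
  let ?T = "tensor Lp ?Y NB"
  let ?E = "rmod_sum (Ser M) (Ser N)"
  interpret M: laurent R M P by (rule laurentI[OF M])
  interpret N: laurent R N P by (rule laurentI[OF N])
  interpret TM: right_module Lp "TL M" by (rule TL_right_module[OF M])
  interpret TN: right_module Lp "TL N" by (rule TL_right_module[OF N])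
  have Y: "right_module Lp ?Y" by (rule rmod_sum_right_module[OF TM.right_module_axioms TN.right_module_axioms])
  have E: "abelian_group ?E"
    by (rule right_moduleD(2)[OF rmod_sum_right_module[OF M.series_right_module N.series_right_module]])
  interpret T: tensor_factors Lp Nov ?Y NB by (rule tensor_factors_NB[OF Y])
  note tn = balancedD[OF T.tens_balanced]
  note eM = abelian_group_homD[OF expand_hom[OF M]] and eN = abelian_group_homD[OF expand_hom[OF N]]
  have "balanced Lp ?Y NB ?E (\<lambda>y s. (series_act R M (expand M (fst y)) s, series_act R N (expand N (snd y)) s))"
  proof (rule balancedI)
    fix y p s assume y: "y \<in> carrier ?Y" and p: "p \<in> carrier Lp" and s: "s \<in> carrier NB"
    then show "(series_act R M (expand M (fst (y \<triangleleft>\<^bsub>?Y\<^esub> p))) s, series_act R N (expand N (snd (y \<triangleleft>\<^bsub>?Y\<^esub> p))) s)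
        = (series_act R M (expand M (fst y)) (lact NB p s), series_act R N (expand N (snd y)) (lact NB p s))"
      by (auto simp: ring_bimodule_simps expand_ract M N M.act_assoc N.act_assoc Lp_subset_Nov eM eN)
  qed (auto simp: ring_bimodule_simps eM eN M.act_closed N.act_closed M.act_add_left N.act_add_left
      M.act_add_right N.act_add_right)
  from T.tensor_universal[OF E this] obtain \<Psi> where \<Psi>: "abelian_group_hom ?T ?E \<Psi>"
    and \<Psi>': "\<And>y s. \<lbrakk>y \<in> carrier ?Y; s \<in> carrier NB\<rbrakk> \<Longrightarrow> \<Psi> (tens Lp ?Y NB y s)
        = (series_act R M (expand M (fst y)) s, series_act R N (expand N (snd y)) s)"
    by metis
  have \<Psi>_tens: "\<Psi> (tens Lp ?Y NB (v, w) s) = (series_act R M (expand M v) s, series_act R N (expand N w) s)"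
    if "v \<in> carrier (TL M)" "w \<in> carrier (TL N)" "s \<in> carrier Nov" for v w s
    using \<Psi>'[of "(v, w)" s] that by (simp add: ring_bimodule_simps)
  have "(\<lambda>v. (v, \<zero>\<^bsub>TL N\<^esub>)) \<in> rmod_hom Lp (TL M) ?Y"
    by (rule rmod_homI) (auto simp: TN.ract_zero_left)
  from fp_expand_universal[OF M fpM Y this] obtain \<phi> where \<phi>: "abelian_group_hom (Ser M) ?T \<phi>"
    and \<phi>_act: "\<And>v s. \<lbrakk>v \<in> carrier (TL M); s \<in> carrier Nov\<rbrakk>
      \<Longrightarrow> \<phi> (series_act R M (expand M v) s) = tens Lp ?Y NB (v, \<zero>\<^bsub>TL N\<^esub>) s"
    by metis
  have "(\<lambda>w. (\<zero>\<^bsub>TL M\<^esub>, w)) \<in> rmod_hom Lp (TL N) ?Y"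
    by (rule rmod_homI) (auto simp: TM.ract_zero_left)
  from fp_expand_universal[OF N fpN Y this] obtain \<phi>' where \<phi>': "abelian_group_hom (Ser N) ?T \<phi>'"
    and \<phi>'_act: "\<And>w s. \<lbrakk>w \<in> carrier (TL N); s \<in> carrier Nov\<rbrakk>
      \<Longrightarrow> \<phi>' (series_act R N (expand N w) s) = tens Lp ?Y NB (\<zero>\<^bsub>TL M\<^esub>, w) s"
    by metis
  have fst_hom: "abelian_group_hom ?E (Ser M) fst"
    by (rule abelian_group_homI'[OF E M.series_abelian_group]) auto
  have snd_hom: "abelian_group_hom ?E (Ser N) snd"
    by (rule abelian_group_homI'[OF E N.series_abelian_group]) auto
  \<comment> \<open>The candidate inverse adds the maps belonging to the two summands, since a pair
    \<open>(v, w)\<close> is \<open>(v, 0) + (0, w)\<close>.\<close>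
  define \<Phi> where "\<Phi> q = \<phi> (fst q) \<oplus>\<^bsub>?T\<^esub> \<phi>' (snd q)" for q
  have \<Phi>: "abelian_group_hom ?E ?T \<Phi>"
    unfolding \<Phi>_def
    by (rule abelian_group_hom_add[OF abelian_group_hom_compose[OF fst_hom \<phi>]
          abelian_group_hom_compose[OF snd_hom \<phi>']])
  note h = abelian_group_homD[OF \<Psi>] and k = abelian_group_homD[OF \<phi>] and k' = abelian_group_homD[OF \<phi>']
  have left: "\<Phi> (\<Psi> u) = u" if u: "u \<in> carrier ?T" for u
  proof (rule T.tensor_hom_eqI[OF abelian_group_hom_compose[OF \<Psi> \<Phi>] _ u])
    show "abelian_group_hom ?T ?T (\<lambda>u. u)"
      by (intro abelian_group_homI' T.tensor_abelian_group refl)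
    fix y s assume y: "y \<in> carrier ?Y" and s: "s \<in> carrier NB"
    obtain v w where vw: "y = (v, w)" "v \<in> carrier (TL M)" "w \<in> carrier (TL N)"
      using y by auto
    have "\<Phi> (\<Psi> (tens Lp ?Y NB y s)) = tens Lp ?Y NB (v, \<zero>\<^bsub>TL N\<^esub>) s \<oplus>\<^bsub>?T\<^esub> tens Lp ?Y NB (\<zero>\<^bsub>TL M\<^esub>, w) s"
      using vw s by (simp add: \<Phi>_def \<Psi>_tens \<phi>_act \<phi>'_act ring_bimodule_simps)
    also have "\<dots> = tens Lp ?Y NB y s"
      using vw s tn(2)[of "(v, \<zero>\<^bsub>TL N\<^esub>)" "(\<zero>\<^bsub>TL M\<^esub>, w)" s] by simp
    finally show "\<Phi> (\<Psi> (tens Lp ?Y NB y s)) = tens Lp ?Y NB y s" .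
  qed
  interpret E: abelian_group ?E by (rule E)
  interpret SM: abelian_group "Ser M" by (rule M.series_abelian_group)
  interpret SN: abelian_group "Ser N" by (rule N.series_abelian_group)
  interpret Lp: ring Lp by (rule Lp_ring)
  have act_zero: "series_act R M (expand M \<zero>\<^bsub>TL M\<^esub>) s = \<zero>\<^bsub>Ser M\<^esub>"
      "series_act R N (expand N \<zero>\<^bsub>TL N\<^esub>) s = \<zero>\<^bsub>Ser N\<^esub>" if "s \<in> carrier Nov" for s
    using abelian_group_homD(5)[OF act_hom[OF M that]] abelian_group_homD(5)[OF act_hom[OF N that]]
    by (simp_all add: eM(5) eN(5))
  have one: "\<one>\<^bsub>Lp\<^esub> \<in> carrier LB" by (simp add: ring_bimodule_simps)
  have tens_one: "tens R M LB x \<one>\<^bsub>Lp\<^esub> \<in> carrier (TL M)" if "x \<in> carrier M" for x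
    by (rule tensor_factors.tens_closed[OF tensor_factors_LB[OF M] that one])
  have tens_one': "tens R N LB x \<one>\<^bsub>Lp\<^esub> \<in> carrier (TL N)" if "x \<in> carrier N" for x
    by (rule tensor_factors.tens_closed[OF tensor_factors_LB[OF N] that one])
  \<comment> \<open>Series \<open>x s\<close> generate additively, and each of them is the expansion
    of \<open>x \<otimes> 1\<close> acted on by \<open>s\<close>, for which \<phi> and \<Psi> are
    known explicitly.\<close>
  have right1: "\<Psi> (\<phi> m) = (m, \<zero>\<^bsub>Ser N\<^esub>)" if "m \<in> carrier (Ser M)" for m
    using M fpM that
  proof (rule fp_series_induct)
    show "\<Psi> (\<phi> \<zero>\<^bsub>Ser M\<^esub>) = (\<zero>\<^bsub>Ser M\<^esub>, \<zero>\<^bsub>Ser N\<^esub>)" by (simp add: k(5) h(5))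
    fix x s assume x: "x \<in> carrier M" and s: "s \<in> carrier Nov"
    have "(\<lambda>i. x \<triangleleft>\<^bsub>M\<^esub> s i) = series_act R M (expand M (tens R M LB x \<one>\<^bsub>Lp\<^esub>)) s"
      using x s by (simp only: expand_tens_one[OF M] act_const'[OF M])
    then show "\<Psi> (\<phi> (\<lambda>i. x \<triangleleft>\<^bsub>M\<^esub> s i)) = ((\<lambda>i. x \<triangleleft>\<^bsub>M\<^esub> s i), \<zero>\<^bsub>Ser N\<^esub>)"
      using tens_one[OF x] s by (simp only: \<phi>_act \<Psi>_tens TN.M.zero_closed act_zero)
  qed (simp add: k h)
  have right2: "\<Psi> (\<phi>' m) = (\<zero>\<^bsub>Ser M\<^esub>, m)" if "m \<in> carrier (Ser N)" for m
    using N fpN that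
  proof (rule fp_series_induct)
    show "\<Psi> (\<phi>' \<zero>\<^bsub>Ser N\<^esub>) = (\<zero>\<^bsub>Ser M\<^esub>, \<zero>\<^bsub>Ser N\<^esub>)" by (simp add: k'(5) h(5))
    fix x s assume x: "x \<in> carrier N" and s: "s \<in> carrier Nov"
    have "(\<lambda>i. x \<triangleleft>\<^bsub>N\<^esub> s i) = series_act R N (expand N (tens R N LB x \<one>\<^bsub>Lp\<^esub>)) s"
      using x s by (simp only: expand_tens_one[OF N] act_const'[OF N])
    then show "\<Psi> (\<phi>' (\<lambda>i. x \<triangleleft>\<^bsub>N\<^esub> s i)) = (\<zero>\<^bsub>Ser M\<^esub>, (\<lambda>i. x \<triangleleft>\<^bsub>N\<^esub> s i))"
      using tens_one'[OF x] s by (simp only: \<phi>'_act \<Psi>_tens TM.M.zero_closed act_zero)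
  qed (simp add: k' h)
  have right: "\<Psi> (\<Phi> q) = q" if "q \<in> carrier ?E" for q
    using that by (cases q) (simp add: \<Phi>_def h k k' right1 right2)
  have "bij_betw \<Psi> (carrier ?T) (carrier ?E)"
  proof (rule bij_betw_byWitness[where f' = \<Phi>])
    show "\<forall>u\<in>carrier ?T. \<Phi> (\<Psi> u) = u" "\<forall>q\<in>carrier ?E. \<Psi> (\<Phi> q) = q"
      using left right by blast+
    show "\<Psi> ` carrier ?T \<subseteq> carrier ?E" "\<Phi> ` carrier ?E \<subseteq> carrier ?T"
      using h(3) abelian_group_homD(3)[OF \<Phi>] by blast+
  qed
  then show ?thesis using that[OF \<Psi> \<Psi>_tens] by simp
qed

end


section \<open>Novikov cohomology of mapping tori\<close>

lemma series_minus:
  assumes "laurent R M P" and m: "m \<in> carrier (series_module P R M)"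
  shows "\<ominus>\<^bsub>series_module P R M\<^esub> m = (\<lambda>i. \<ominus>\<^bsub>M\<^esub> m i)"
proof -
  interpret laurent R M P by fact
  interpret S: abelian_group Mz by (rule series_abelian_group)
  have neg: "(\<lambda>i. \<ominus>\<^bsub>M\<^esub> m i) \<in> carrier Mz"
    by (rule series_pointwise_closed[OF m]) simp_all
  have "(\<lambda>i. \<ominus>\<^bsub>M\<^esub> m i) \<oplus>\<^bsub>Mz\<^esub> m = \<zero>\<^bsub>Mz\<^esub>"
    using m by (simp add: series_module_simps M.l_neg)
  then show ?thesis by (rule S.minus_equality[OF _ m neg])
qed

lemma series_diff:
  assumes "laurent R M P" and "m' \<in> carrier (series_module P R M)"
  shows "m \<ominus>\<^bsub>series_module P R M\<^esub> m' = (\<lambda>i. m i \<ominus>\<^bsub>M\<^esub> m' i)"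
  using assms by (simp add: a_minus_def series_minus series_module_simps(3))

lemma abelian_group_hom_pair:
  assumes "abelian_group_hom A B f" "abelian_group_hom A D g" "abelian_group (rmod_sum B D)"
  shows "abelian_group_hom A (rmod_sum B D) (\<lambda>x. (f x, g x))"
  using abelian_group_homD[OF assms(1)] abelian_group_homD[OF assms(2)] assms(3)
  by (intro abelian_group_homI') auto

lemma rmod_sum_fst_hom:
  assumes "abelian_group (rmod_sum A B)" "abelian_group A"
  shows "abelian_group_hom (rmod_sum A B) A fst"
  by (rule abelian_group_homI'[OF assms]) auto

lemma rmod_sum_snd_hom:
  assumes "abelian_group (rmod_sum A B)" "abelian_group B"
  shows "abelian_group_hom (rmod_sum A B) B snd"
  by (rule abelian_group_homI'[OF assms]) auto

text \<open>The condition \<open>P\<close> stays open, so that the passage from tensor products to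
  coefficients is made once for both Novikov rings. They only separate at the exactness statement on
  series.\<close>

locale torus = laurent_ring_support R P + cochain_complex R C
  for R :: "('r, 'e) ring_scheme" (structure) and P and C :: "('r, 'm) cochain" +
  fixes h :: "int \<Rightarrow> 'm \<Rightarrow> 'm"
  assumes h: "cochain_map R C C h"
begin

abbreviation (input) "Cn \<equiv> obj C"
abbreviation (input) "d \<equiv> diff C"

lemma C_group: "abelian_group (Cn n)"
  by (rule right_moduleD(2)[OF obj_module])

lemma d_hom: "abelian_group_hom (Cn n) (Cn (n + 1)) (d n)"
  by (rule diff_abelian_group_hom)

lemma h_rmod_hom: "h n \<in> rmod_hom R (Cn n) (Cn n)"
  by (rule cochain_mapD(1)[OF h])

lemma h_hom: "abelian_group_hom (Cn n) (Cn n) (h n)"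
  by (rule rmod_hom_abelian_group_hom[OF h_rmod_hom obj_module obj_module])

section \<open>The mapping torus and its scalar extension as cochain complexes\<close>

lemma mapping_torus_simps:
  "obj (mapping_torus R C h) n = rmod_sum (TL (Cn (n + 1))) (TL (Cn n))"
  "diff (mapping_torus R C h) n (v, w) = (\<ominus>\<^bsub>TL (Cn (n + 2))\<^esub> tensor_map R (Cn (n + 2)) LB (d (n + 1)) (\<lambda>p. p) v,
     torus_map R C h (n + 1) v \<oplus>\<^bsub>TL (Cn (n + 1))\<^esub> tensor_map R (Cn (n + 1)) LB (d n) (\<lambda>p. p) w)"
  by (simp_all add: mapping_torus_def cone_def)

lemma tensor_LB_cochain_complex: "cochain_complex Lp (tensor_complex R C LB)"
  by (intro tensor_complex_cochain_complex cochain_complex_axioms tensor_factors_LB obj_module)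

lemma torus_map_cochain_map:
  "cochain_map Lp (tensor_complex R C LB) (tensor_complex R C LB) (torus_map R C h)"
proof -
  have factors: "tensor_factors R Lp (Cn n) LB" for n
    by (rule tensor_factors_LB[OF obj_module])
  have id: "abelian_group_hom LB LB (\<lambda>p. p)"
    by (intro abelian_group_homI' tensor_factors.axioms(3)[OF factors] refl)
  have id_map: "cochain_map R C C (\<lambda>n x. x)"
    by (auto simp: cochain_map_def rmod_hom_def)
  have "cochain_map Lp (tensor_complex R C LB) (tensor_complex R C LB)
      (\<lambda>n w. tensor_map R (Cn n) LB (h n) (\<lambda>p. p) w \<ominus>\<^bsub>obj (tensor_complex R C LB) n\<^esub>
        tensor_map R (Cn n) LB (\<lambda>x. x) (\<lambda>p. laurent_z R \<otimes>\<^bsub>Lp\<^esub> p) w)"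
    by (intro cochain_map_minus tensor_LB_cochain_complex
        tensor_map_cochain_map[OF cochain_complex_axioms factors h id refl refl]
        tensor_map_cochain_map[OF cochain_complex_axioms factors id_map z_mult_hom])
  then show ?thesis
    by (simp add: torus_map_def[abs_def])
qed

lemma mapping_torus_cochain_complex: "cochain_complex Lp (mapping_torus R C h)"
  unfolding mapping_torus_def
  by (intro cone_cochain_complex tensor_LB_cochain_complex torus_map_cochain_map)

lemma novikov_complex_eq: "novikov_complex R Nov B = tensor_complex Lp B NB"
  by (simp add: novikov_complex_def)

lemma novikov_cochain_complex: "cochain_complex Nov (novikov_complex R Nov (mapping_torus R C h))"
  unfolding novikov_complex_eq
  by (intro tensor_complex_cochain_complex mapping_torus_cochain_complex tensor_factors_NB
      cochain_complex.obj_module[OF mapping_torus_cochain_complex])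

text \<open>The cone differential of \<open>h - z\<close>, written out at the coefficient of
  \<open>z^i\<close>: multiplication by \<open>z\<close> contributes the coefficient at
  \<open>i - 1\<close>.\<close>

definition series_diff_map :: "int \<Rightarrow> (int \<Rightarrow> 'm) \<times> (int \<Rightarrow> 'm) \<Rightarrow> (int \<Rightarrow> 'm) \<times> (int \<Rightarrow> 'm)" where
  "series_diff_map n q = (\<lambda>i. \<ominus>\<^bsub>Cn (n + 2)\<^esub> d (n + 1) (fst q i),
     \<lambda>i. (h (n + 1) (fst q i) \<ominus>\<^bsub>Cn (n + 1)\<^esub> fst q (i - 1)) \<oplus>\<^bsub>Cn (n + 1)\<^esub> d n (snd q i))"

lemma C_laurent: "laurent R (Cn n) P"
  by (rule laurentI[OF obj_module])

lemma Ser_group: "abelian_group (Ser (Cn n))"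
  by (rule laurent.series_abelian_group[OF C_laurent])

lemma Ser_sum_group: "abelian_group (rmod_sum (Ser (Cn m)) (Ser (Cn n)))"
  by (rule right_moduleD(2)[OF rmod_sum_right_module[OF
        laurent.series_right_module[OF C_laurent] laurent.series_right_module[OF C_laurent]]])

lemma d_series_hom: "abelian_group_hom (Ser (Cn n)) (Ser (Cn (n + 1))) (\<lambda>m i. d n (m i))"
  by (rule series_map_hom[OF C_laurent C_laurent d_hom])

lemma h_series_hom: "abelian_group_hom (Ser (Cn n)) (Ser (Cn n)) (\<lambda>m i. h n (m i))"
  by (rule series_map_hom[OF C_laurent C_laurent h_hom])

text \<open>Expressed through the operations of the groups of series, the differential is assembled
  from additive maps, which gives \<open>series_diff_map_hom\<close>. The form by coefficients is
  the one used for solving equations.\<close>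

lemma series_diff_map_eq:
  assumes "q \<in> carrier (rmod_sum (Ser (Cn (n + 1))) (Ser (Cn n)))"
  shows "series_diff_map n q = (\<ominus>\<^bsub>Ser (Cn (n + 2))\<^esub> (\<lambda>i. d (n + 1) (fst q i)),
     ((\<lambda>i. h (n + 1) (fst q i)) \<ominus>\<^bsub>Ser (Cn (n + 1))\<^esub> (\<lambda>i. fst q (i - 1)))
       \<oplus>\<^bsub>Ser (Cn (n + 1))\<^esub> (\<lambda>i. d n (snd q i)))"
proof -
  have q: "fst q \<in> carrier (Ser (Cn (n + 1)))" using assms by auto
  have "(\<lambda>i. d (n + 1) (fst q i)) \<in> carrier (Ser (Cn (n + 2)))"
    using abelian_group_homD(3)[OF d_series_hom q] by simp
  moreover have "(\<lambda>i. fst q (i - 1)) \<in> carrier (Ser (Cn (n + 1)))"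
    by (rule abelian_group_homD(3)[OF shift_hom[OF obj_module] q])
  ultimately show ?thesis
    by (simp add: series_diff_map_def series_minus[OF C_laurent] series_diff[OF C_laurent]
        series_module_simps(3))
qed

lemma series_diff_map_hom:
  "abelian_group_hom (rmod_sum (Ser (Cn (n + 1))) (Ser (Cn n)))
     (rmod_sum (Ser (Cn (n + 2))) (Ser (Cn (n + 1)))) (series_diff_map n)"
proof -
  let ?E = "rmod_sum (Ser (Cn (n + 1))) (Ser (Cn n))"
  let ?E' = "rmod_sum (Ser (Cn (n + 2))) (Ser (Cn (n + 1)))"
  let ?D = "\<lambda>q. (\<ominus>\<^bsub>Ser (Cn (n + 2))\<^esub> (\<lambda>i. d (n + 1) (fst q i)),
     ((\<lambda>i. h (n + 1) (fst q i)) \<ominus>\<^bsub>Ser (Cn (n + 1))\<^esub> (\<lambda>i. fst q (i - 1)))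
       \<oplus>\<^bsub>Ser (Cn (n + 1))\<^esub> (\<lambda>i. d n (snd q i)))"
  have d1: "abelian_group_hom (Ser (Cn (n + 1))) (Ser (Cn (n + 2))) (\<lambda>m i. d (n + 1) (m i))"
    using d_series_hom[of "n + 1"] by simp
  note F = rmod_sum_fst_hom[OF Ser_sum_group Ser_group, of "n + 1" n]
    and S = rmod_sum_snd_hom[OF Ser_sum_group Ser_group, of "n + 1" n]
  have "abelian_group_hom ?E ?E' ?D"
    by (intro abelian_group_hom_pair[OF _ _ Ser_sum_group]
        abelian_group_hom_uminus[OF abelian_group_hom_compose[OF F d1]]
        abelian_group_hom_add[OF abelian_group_hom_diff[OF abelian_group_hom_compose[OF F h_series_hom]
            abelian_group_hom_compose[OF F shift_hom[OF obj_module]]]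
          abelian_group_hom_compose[OF S d_series_hom]])
  note D = abelian_group_homD[OF this]
  interpret E: abelian_group ?E by (rule Ser_sum_group)
  show ?thesis
  proof (rule abelian_group_homI'[OF Ser_sum_group Ser_sum_group])
    show "series_diff_map n q \<in> carrier ?E'" if "q \<in> carrier ?E" for q
      unfolding series_diff_map_eq[OF that] by (rule D(3)[OF that])
    show "series_diff_map n (q \<oplus>\<^bsub>?E\<^esub> q') = series_diff_map n q \<oplus>\<^bsub>?E'\<^esub> series_diff_map n q'"
      if q: "q \<in> carrier ?E" and q': "q' \<in> carrier ?E" for q q'
      unfolding series_diff_map_eq[OF q] series_diff_map_eq[OF q'] series_diff_map_eq[OF E.a_closed[OF q q']]
      by (rule D(4)[OF q q'])
  qed
qed

lemma expand_torus_map: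
  assumes w: "w \<in> carrier (TL (Cn n))"
  shows "expand (Cn n) (torus_map R C h n w)
    = (\<lambda>i. h n (expand (Cn n) w i)) \<ominus>\<^bsub>Ser (Cn n)\<^esub> (\<lambda>i. expand (Cn n) w (i - 1))"
proof -
  have factors: "tensor_factors R Lp (Cn n) LB"
    by (rule tensor_factors_LB[OF obj_module])
  interpret hh: tensor_factors_hom R Lp "Cn n" LB "Cn n" LB "h n" "\<lambda>p. p"
    by (rule tensor_factors_hom_LB[OF obj_module obj_module h_rmod_hom])
  interpret z: tensor_factors_hom R Lp "Cn n" LB "Cn n" LB "\<lambda>x. x" "\<lambda>p. laurent_z R \<otimes>\<^bsub>Lp\<^esub> p"
    by (intro tensor_factors_hom.intro tensor_factors_hom_axioms.intro factors
        z_mult_hom rmod_homI refl)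
  show ?thesis
    using abelian_group_homD(7)[OF expand_hom[OF obj_module]
        abelian_group_homD(3)[OF hh.tensor_map_hom w] abelian_group_homD(3)[OF z.tensor_map_hom w]]
    by (simp add: torus_map_def expand_map[OF obj_module obj_module h_rmod_hom w]
        expand_shift[OF obj_module w])
qed

lemma act_series_map:
  assumes "f \<in> rmod_hom R (Cn m) (Cn n)" "x \<in> carrier (Ser (Cn m))" "s \<in> carrier Nov"
  shows "series_act R (Cn n) (\<lambda>i. f (x i)) s = (\<lambda>i. f (series_act R (Cn m) x s i))"
  by (rule series_map_act[OF C_laurent C_laurent assms])

text \<open>\<open>expand\<close> and the action of \<open>s\<close> are both additive and commute
  with \<open>d\<close>, with \<open>h\<close> and with the shift. On elementary tensors this says
  that the comparison with series is compatible with the differentials.\<close>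

lemma series_diff_map_tens:
  assumes v: "v \<in> carrier (TL (Cn (n + 1)))" and w: "w \<in> carrier (TL (Cn n))" and s: "s \<in> carrier Nov"
    and vw: "diff (mapping_torus R C h) n (v, w) = (v', w')"
  shows "(series_act R (Cn (n + 2)) (expand (Cn (n + 2)) v') s, series_act R (Cn (n + 1)) (expand (Cn (n + 1)) w') s)
    = series_diff_map n (series_act R (Cn (n + 1)) (expand (Cn (n + 1)) v) s, series_act R (Cn n) (expand (Cn n) w) s)"
proof -
  let ?e = "\<lambda>k. expand (Cn k)" and ?a = "\<lambda>k m. series_act R (Cn k) m s"
  have e: "abelian_group_hom (TL (Cn k)) (Ser (Cn k)) (?e k)" for k
    by (rule expand_hom[OF obj_module])
  have a: "abelian_group_hom (Ser (Cn k)) (Ser (Cn k)) (?a k)" for k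
    by (rule act_hom[OF obj_module s])
  have d1: "d (n + 1) \<in> rmod_hom R (Cn (n + 1)) (Cn (n + 2))"
    using diff_hom[of "n + 1"] by simp
  have d1_hom: "abelian_group_hom (Ser (Cn (n + 1))) (Ser (Cn (n + 2))) (\<lambda>m i. d (n + 1) (m i))"
    using d_series_hom[of "n + 1"] by simp
  interpret d1: tensor_factors_hom R Lp "Cn (n + 1)" LB "Cn (n + 2)" LB "d (n + 1)" "\<lambda>p. p"
    by (rule tensor_factors_hom_LB[OF obj_module obj_module d1])
  interpret d0: tensor_factors_hom R Lp "Cn n" LB "Cn (n + 1)" LB "d n" "\<lambda>p. p"
    by (rule tensor_factors_hom_LB[OF obj_module obj_module diff_hom])
  let ?v = "?e (n + 1) v" and ?w = "?e n w"
  have ev: "?v \<in> carrier (Ser (Cn (n + 1)))" and ew: "?w \<in> carrier (Ser (Cn n))"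
    using abelian_group_homD(3)[OF e] v w by auto
  have v': "v' = \<ominus>\<^bsub>TL (Cn (n + 2))\<^esub> tensor_map R (Cn (n + 2)) LB (d (n + 1)) (\<lambda>p. p) v"
    and w': "w' = torus_map R C h (n + 1) v \<oplus>\<^bsub>TL (Cn (n + 1))\<^esub> tensor_map R (Cn (n + 1)) LB (d n) (\<lambda>p. p) w"
    using vw by (simp_all add: mapping_torus_simps)
  have dv: "(\<lambda>i. d (n + 1) (?v i)) \<in> carrier (Ser (Cn (n + 2)))"
    by (rule abelian_group_homD(3)[OF d1_hom ev])
  have dw: "(\<lambda>i. d n (?w i)) \<in> carrier (Ser (Cn (n + 1)))"
    by (rule abelian_group_homD(3)[OF d_series_hom ew])
  have hv: "(\<lambda>i. h (n + 1) (?v i)) \<in> carrier (Ser (Cn (n + 1)))"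
    by (rule abelian_group_homD(3)[OF h_series_hom ev])
  have zv: "(\<lambda>i. ?v (i - 1)) \<in> carrier (Ser (Cn (n + 1)))"
    by (rule abelian_group_homD(3)[OF shift_hom[OF obj_module] ev])
  have "?e (n + 2) v' = \<ominus>\<^bsub>Ser (Cn (n + 2))\<^esub> (\<lambda>i. d (n + 1) (?v i))"
    unfolding v' abelian_group_homD(6)[OF e abelian_group_homD(3)[OF d1.tensor_map_hom v]]
      expand_map[OF obj_module obj_module d1 v] ..
  then have 1: "?a (n + 2) (?e (n + 2) v') = \<ominus>\<^bsub>Ser (Cn (n + 2))\<^esub> (\<lambda>i. d (n + 1) (?a (n + 1) ?v i))"
    by (simp add: abelian_group_homD(6)[OF a dv] act_series_map[OF d1 ev s])
  have tv: "torus_map R C h (n + 1) v \<in> carrier (TL (Cn (n + 1)))"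
    using rmod_homD(1)[OF cochain_mapD(1)[OF torus_map_cochain_map], of v "n + 1"] v by simp
  have "?e (n + 1) w' = ((\<lambda>i. h (n + 1) (?v i)) \<ominus>\<^bsub>Ser (Cn (n + 1))\<^esub> (\<lambda>i. ?v (i - 1)))
      \<oplus>\<^bsub>Ser (Cn (n + 1))\<^esub> (\<lambda>i. d n (?w i))"
    unfolding w' abelian_group_homD(4)[OF e tv abelian_group_homD(3)[OF d0.tensor_map_hom w]]
      expand_map[OF obj_module obj_module diff_hom w] expand_torus_map[OF v] ..
  then have 2: "?a (n + 1) (?e (n + 1) w') = ((\<lambda>i. h (n + 1) (?a (n + 1) ?v i)) \<ominus>\<^bsub>Ser (Cn (n + 1))\<^esub> (\<lambda>i. ?a (n + 1) ?v (i - 1)))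
      \<oplus>\<^bsub>Ser (Cn (n + 1))\<^esub> (\<lambda>i. d n (?a n ?w i))"
    using abelian_groupE(1)[OF Ser_group] abelian_group.minus_closed[OF Ser_group hv zv]
    by (simp add: abelian_group_homD(4)[OF a _ dw] abelian_group_homD(7)[OF a hv zv]
        act_series_map[OF h_rmod_hom ev s] act_series_map[OF diff_hom ew s] act_shift[OF obj_module ev s])
  have "(?a (n + 1) ?v, ?a n ?w) \<in> carrier (rmod_sum (Ser (Cn (n + 1))) (Ser (Cn n)))"
    using abelian_group_homD(3)[OF a ev] abelian_group_homD(3)[OF a ew] by simp
  from series_diff_map_eq[OF this] 1 2 show ?thesis by simp
qed

text \<open>The comparison with series is bijective in every degree and commutes with the
  differentials, so acyclicity reduces to the system of equations for coefficients in
  \<open>exact\<close>.\<close>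

lemma novikov_complex_acyclic:
  assumes fp: "\<And>n. finitely_presented R (Cn n)"
    and exact: "\<And>n x y. \<lbrakk>x \<in> carrier (Ser (Cn (n + 1))); y \<in> carrier (Ser (Cn n));
      \<And>i. d (n + 1) (x i) = \<zero>\<^bsub>Cn (n + 2)\<^esub>;
      \<And>i. (h (n + 1) (x i) \<ominus>\<^bsub>Cn (n + 1)\<^esub> x (i - 1)) \<oplus>\<^bsub>Cn (n + 1)\<^esub> d n (y i) = \<zero>\<^bsub>Cn (n + 1)\<^esub>\<rbrakk>
      \<Longrightarrow> \<exists>u\<in>carrier (Ser (Cn n)). \<exists>v\<in>carrier (Ser (Cn (n - 1))).
        (\<forall>i. \<ominus>\<^bsub>Cn (n + 1)\<^esub> d n (u i) = x i) \<and>
        (\<forall>i. (h n (u i) \<ominus>\<^bsub>Cn n\<^esub> u (i - 1)) \<oplus>\<^bsub>Cn n\<^esub> d (n - 1) (v i) = y i)"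
  shows "acyclic_complex Nov (novikov_complex R Nov (mapping_torus R C h))"
proof (rule acyclic_complexI[OF novikov_cochain_complex])
  let ?B = "mapping_torus R C h"
  let ?A = "novikov_complex R Nov ?B"
  interpret A: cochain_complex Nov ?A by (rule novikov_cochain_complex)
  have objA: "obj ?A k = tensor Lp (rmod_sum (TL (Cn (k + 1))) (TL (Cn k))) NB" for k
    by (simp add: novikov_complex_eq mapping_torus_simps)
  have "\<exists>\<Psi>. abelian_group_hom (obj ?A k) (rmod_sum (Ser (Cn (k + 1))) (Ser (Cn k))) \<Psi> \<and>
      (\<forall>v\<in>carrier (TL (Cn (k + 1))). \<forall>w\<in>carrier (TL (Cn k)). \<forall>s\<in>carrier Nov.
        \<Psi> (tens Lp (rmod_sum (TL (Cn (k + 1))) (TL (Cn k))) NB (v, w) s)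
          = (series_act R (Cn (k + 1)) (expand (Cn (k + 1)) v) s, series_act R (Cn k) (expand (Cn k) w) s)) \<and>
      bij_betw \<Psi> (carrier (obj ?A k)) (carrier (Ser (Cn (k + 1))) \<times> carrier (Ser (Cn k)))" for k
    unfolding objA by (rule novikov_tensor_series[OF obj_module obj_module fp fp, of "k + 1" k]) blast
  then obtain \<Psi> where
    \<Psi>: "\<And>k. abelian_group_hom (obj ?A k) (rmod_sum (Ser (Cn (k + 1))) (Ser (Cn k))) (\<Psi> k)" and
    \<Psi>_tens: "\<And>k v w s. \<lbrakk>v \<in> carrier (TL (Cn (k + 1))); w \<in> carrier (TL (Cn k)); s \<in> carrier Nov\<rbrakk>
      \<Longrightarrow> \<Psi> k (tens Lp (rmod_sum (TL (Cn (k + 1))) (TL (Cn k))) NB (v, w) s)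
          = (series_act R (Cn (k + 1)) (expand (Cn (k + 1)) v) s, series_act R (Cn k) (expand (Cn k) w) s)" and
    bij: "\<And>k. bij_betw (\<Psi> k) (carrier (obj ?A k)) (carrier (Ser (Cn (k + 1))) \<times> carrier (Ser (Cn k)))"
    by metis
  \<comment> \<open>Both sides are additive in \<open>w\<close>, so elementary tensors suffice, and
    these are handled by \<open>series_diff_map_tens\<close>.\<close>
  have \<Psi>_diff: "\<Psi> (k + 1) (diff ?A k w) = series_diff_map k (\<Psi> k w)" if w: "w \<in> carrier (obj ?A k)" for k w
  proof -
    let ?Y = "\<lambda>k. rmod_sum (TL (Cn (k + 1))) (TL (Cn k))"
    have factors: "tensor_factors Lp Nov (obj ?B k) NB" for k
      by (intro tensor_factors_NB cochain_complex.obj_module[OF mapping_torus_cochain_complex])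
    interpret T: tensor_factors Lp Nov "?Y k" NB
      using factors[of k] by (simp add: mapping_torus_simps)
    interpret dT: tensor_factors_hom Lp Nov "obj ?B k" NB "obj ?B (k + 1)" NB "diff ?B k" "\<lambda>y. y"
      by (rule tensor_diff[OF mapping_torus_cochain_complex factors])
    have \<Psi>1: "abelian_group_hom (obj ?A (k + 1)) (rmod_sum (Ser (Cn (k + 2))) (Ser (Cn (k + 1)))) (\<Psi> (k + 1))"
      using \<Psi>[of "k + 1"] by simp
    show ?thesis
    proof (rule T.tensor_hom_eqI[OF abelian_group_hom_compose[OF A.diff_abelian_group_hom[of k, unfolded objA[of k]] \<Psi>1]
          abelian_group_hom_compose[OF \<Psi>[of k, unfolded objA[of k]] series_diff_map_hom] w[unfolded objA]])
      fix y s assume y: "y \<in> carrier (?Y k)" and s: "s \<in> carrier NB"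
      then have s': "s \<in> carrier Nov" by (simp add: ring_bimodule_simps)
      obtain v w where vw: "y = (v, w)" "v \<in> carrier (TL (Cn (k + 1)))" "w \<in> carrier (TL (Cn k))"
        using y by auto
      obtain v' w' where vw': "diff ?B k (v, w) = (v', w')" by (cases "diff ?B k (v, w)")
      have "diff ?B k (v, w) \<in> carrier (obj ?B (k + 1))"
        using y vw by (intro dT.f'(1)) (simp add: mapping_torus_simps(1))
      then have car: "v' \<in> carrier (TL (Cn (k + 1 + 1)))" "w' \<in> carrier (TL (Cn (k + 1)))"
        by (simp_all add: vw' mapping_torus_simps(1))
      have "diff ?A k (tens Lp (?Y k) NB y s) = tens Lp (?Y (k + 1)) NB (v', w') s"
        using dT.tensor_map_tens[of "(v, w)" s] vw' vw(1)
        by (simp add: novikov_complex_eq mapping_torus_simps(1))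
      then have "\<Psi> (k + 1) (diff ?A k (tens Lp (?Y k) NB y s))
          = (series_act R (Cn (k + 2)) (expand (Cn (k + 2)) v') s, series_act R (Cn (k + 1)) (expand (Cn (k + 1)) w') s)"
        using \<Psi>_tens[OF car s'] by simp
      also have "\<dots> = series_diff_map k (\<Psi> k (tens Lp (?Y k) NB y s))"
        unfolding vw(1) \<Psi>_tens[OF vw(2,3) s'] by (rule series_diff_map_tens[OF vw(2,3) s' vw'])
      finally show "\<Psi> (k + 1) (diff ?A k (tens Lp (?Y k) NB y s)) = series_diff_map k (\<Psi> k (tens Lp (?Y k) NB y s))" .
    qed
  qed
  fix n w assume w: "w \<in> carrier (obj ?A n)" and dw: "diff ?A n w = \<zero>\<^bsub>obj ?A (n + 1)\<^esub>"
  obtain x y where xy: "\<Psi> n w = (x, y)" "x \<in> carrier (Ser (Cn (n + 1)))" "y \<in> carrier (Ser (Cn n))"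
    using abelian_group_homD(3)[OF \<Psi> w] by auto
  have "series_diff_map n (x, y) = \<Psi> (n + 1) \<zero>\<^bsub>obj ?A (n + 1)\<^esub>"
    using \<Psi>_diff[OF w] dw xy by simp
  also have "\<dots> = (\<lambda>i. \<zero>\<^bsub>Cn (n + 2)\<^esub>, \<lambda>i. \<zero>\<^bsub>Cn (n + 1)\<^esub>)"
    by (simp add: abelian_group_homD(5)[OF \<Psi>] series_module_simps)
  finally have eq: "\<And>i. \<ominus>\<^bsub>Cn (n + 2)\<^esub> d (n + 1) (x i) = \<zero>\<^bsub>Cn (n + 2)\<^esub>"
    "\<And>i. (h (n + 1) (x i) \<ominus>\<^bsub>Cn (n + 1)\<^esub> x (i - 1)) \<oplus>\<^bsub>Cn (n + 1)\<^esub> d n (y i) = \<zero>\<^bsub>Cn (n + 1)\<^esub>"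
    by (auto simp: series_diff_map_def fun_eq_iff)
  have dx: "d (n + 1) (x i) = \<zero>\<^bsub>Cn (n + 2)\<^esub>" for i
  proof -
    interpret C2: abelian_group "Cn (n + 2)" by (rule C_group)
    have "d (n + 1) (x i) \<in> carrier (Cn (n + 2))"
      using abelian_group_homD(3)[OF d_hom[of "n + 1"]] xy(2) by (simp add: series_module_simps)
    then show ?thesis using C2.minus_minus[of "d (n + 1) (x i)"] eq(1)[of i] by simp
  qed
  obtain u v where uv: "u \<in> carrier (Ser (Cn n))" "v \<in> carrier (Ser (Cn (n - 1)))"
    "\<And>i. \<ominus>\<^bsub>Cn (n + 1)\<^esub> d n (u i) = x i"
    "\<And>i. (h n (u i) \<ominus>\<^bsub>Cn n\<^esub> u (i - 1)) \<oplus>\<^bsub>Cn n\<^esub> d (n - 1) (v i) = y i"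
    using exact[OF xy(2,3) dx eq(2)] by blast
  \<comment> \<open>Surjectivity in degree \<open>n - 1\<close> provides a preimage of the
    primitive; injectivity in degree \<open>n\<close> shows that its coboundary is \<open>w\<close>
    itself.\<close>
  have "(u, v) \<in> \<Psi> (n - 1) ` carrier (obj ?A (n - 1))"
    using bij[of "n - 1"] uv by (simp add: bij_betw_def)
  then obtain w' where w': "w' \<in> carrier (obj ?A (n - 1))" "\<Psi> (n - 1) w' = (u, v)" by auto
  have "\<Psi> n (diff ?A (n - 1) w') = \<Psi> n w"
    using \<Psi>_diff[OF w'(1)] uv by (simp add: w'(2) xy(1) series_diff_map_def)
  moreover have "diff ?A (n - 1) w' \<in> carrier (obj ?A n)"
    using rmod_homD(1)[OF A.diff_hom w'(1)] by simp
  ultimately have "diff ?A (n - 1) w' = w"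
    using bij_betw_imp_inj_on[OF bij[of n]] w by (simp add: inj_on_eq_iff)
  then show "\<exists>y\<in>carrier (obj ?A (n - 1)). diff ?A (n - 1) y = w" using w'(1) by blast
qed

end

text \<open>Coefficientwise, the equation \<open>(h - z) u = y\<close> determines \<open>u\<close> by recursion from the top degree.\<close>

lemma (in cochain_complex) torus_exact_neg:
  assumes h: "cochain_map R A A h"
    and x: "x \<in> carrier (series_module bdd_above R (obj A (n + 1)))"
    and y: "y \<in> carrier (series_module bdd_above R (obj A n))"
    and eq: "\<And>i. (h (n + 1) (x i) \<ominus>\<^bsub>obj A (n + 1)\<^esub> x (i - 1)) \<oplus>\<^bsub>obj A (n + 1)\<^esub> diff A n (y i) = \<zero>\<^bsub>obj A (n + 1)\<^esub>"
  shows "\<exists>u\<in>carrier (series_module bdd_above R (obj A n)). \<exists>v\<in>carrier (series_module bdd_above R (obj A (n - 1))).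
      (\<forall>i. \<ominus>\<^bsub>obj A (n + 1)\<^esub> diff A n (u i) = x i) \<and>
      (\<forall>i. (h n (u i) \<ominus>\<^bsub>obj A n\<^esub> u (i - 1)) \<oplus>\<^bsub>obj A n\<^esub> diff A (n - 1) (v i) = y i)"
proof -
  interpret A0: abelian_group "obj A n" by (rule right_moduleD(2)[OF obj_module])
  interpret A1: abelian_group "obj A (n + 1)" by (rule right_moduleD(2)[OF obj_module])
  interpret Am: abelian_group "obj A (n - 1)" by (rule right_moduleD(2)[OF obj_module])
  have hom: "abelian_group_hom (obj A m) (obj A m) (h m)" for m
    by (rule rmod_hom_abelian_group_hom[OF cochain_mapD(1)[OF h] obj_module obj_module])
  note h0 = abelian_group_homD[OF hom[of n]] and h1 = abelian_group_homD[OF hom[of "n + 1"]]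
  note d = abelian_group_homD[OF diff_abelian_group_hom[of n]]
  have car: "x i \<in> carrier (obj A (n + 1))" "y i \<in> carrier (obj A n)" for i
    using x y by (auto simp: series_module_simps)
  obtain b b' where "\<And>i. x i \<noteq> \<zero>\<^bsub>obj A (n + 1)\<^esub> \<Longrightarrow> i \<le> b" "\<And>i. y i \<noteq> \<zero>\<^bsub>obj A n\<^esub> \<Longrightarrow> i \<le> b'"
    using x y unfolding series_module_simps bdd_above_def by blast
  \<comment> \<open>A bound beyond both supports: \<open>x\<close> and \<open>y\<close> vanish from
    \<open>k\<close> upwards, which allows the recursion to start with zero at
    \<open>k\<close>.\<close>
  then obtain k where k: "\<And>i. i \<ge> k \<Longrightarrow> x i = \<zero>\<^bsub>obj A (n + 1)\<^esub>" "\<And>i. i \<ge> k \<Longrightarrow> y i = \<zero>\<^bsub>obj A n\<^esub>"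
    by (metis max.bounded_iff add1_zle_eq not_le order_refl)
  \<comment> \<open>\<open>a j\<close> will be the coefficient of \<open>u\<close> in degree
    \<open>k - j\<close>. Solving \<open>h (u i) - u (i - 1) = y i\<close> for the lower coefficient
    turns the descent in degree into a recursion on natural numbers.\<close>
  define a where "a = rec_nat \<zero>\<^bsub>obj A n\<^esub> (\<lambda>j u. h n u \<ominus>\<^bsub>obj A n\<^esub> y (k - int j))"
  have a_simps: "a 0 = \<zero>\<^bsub>obj A n\<^esub>" "a (Suc j) = h n (a j) \<ominus>\<^bsub>obj A n\<^esub> y (k - int j)" for j
    by (simp_all add: a_def)
  have a_car: "a j \<in> carrier (obj A n)" for j
    by (induction j) (simp_all add: a_simps h0 car)
  \<comment> \<open>Applying \<open>- d\<close> to the recursion gives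
    \<open>h (x i) + d (y i)\<close> by the induction hypothesis, where \<open>i = k - j\<close>,
    and the cocycle equation identifies this with \<open>x (i - 1)\<close>.\<close>
  have d_a: "\<ominus>\<^bsub>obj A (n + 1)\<^esub> diff A n (a j) = x (k - int j)" for j
  proof (induction j)
    case 0
    then show ?case by (simp add: a_simps d k)
  next
    case (Suc j)
    let ?i = "k - int j"
    have "h (n + 1) (x ?i) \<oplus>\<^bsub>obj A (n + 1)\<^esub> diff A n (y ?i) = x (?i - 1)"
      by (rule A1.cancel_diff[OF h1(3)[OF car(1)] car(1) d(3)[OF car(2)] eq])
    moreover have "\<ominus>\<^bsub>obj A (n + 1)\<^esub> diff A n (a (Suc j))
        = h (n + 1) (\<ominus>\<^bsub>obj A (n + 1)\<^esub> diff A n (a j)) \<oplus>\<^bsub>obj A (n + 1)\<^esub> diff A n (y ?i)"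
    proof -
      have "diff A n (a (Suc j)) = h (n + 1) (diff A n (a j)) \<ominus>\<^bsub>obj A (n + 1)\<^esub> diff A n (y ?i)"
        unfolding a_simps(2) cochain_mapD(2)[OF h a_car] by (rule d(7)[OF h0(3)[OF a_car] car(2)])
      then show ?thesis
        using h1(3)[OF d(3)[OF a_car]] h1(6)[OF d(3)[OF a_car]] d(3)[OF car(2)]
        by (simp add: A1.minus_eq A1.minus_add A1.a_comm)
    qed
    ultimately show ?case
      unfolding Suc by (simp add: algebra_simps)
  qed
  define u where "u i = a (nat (k - i))" for i
  have u_car: "u i \<in> carrier (obj A n)" for i by (simp add: u_def a_car)
  have u_zero: "u i = \<zero>\<^bsub>obj A n\<^esub>" if "i \<ge> k" for i
    using that by (simp add: u_def a_simps)
  have u_rec: "u (i - 1) = h n (u i) \<ominus>\<^bsub>obj A n\<^esub> y i" for i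
  proof (cases "i \<le> k")
    case True
    then have "nat (k - (i - 1)) = Suc (nat (k - i))" "k - int (nat (k - i)) = i" by auto
    then show ?thesis by (simp add: u_def a_simps)
  next
    \<comment> \<open>For \<open>i > k\<close> also \<open>i - 1 \<ge> k\<close>, so all three terms
      vanish.\<close>
    case False
    then show ?thesis using u_zero[of i] u_zero[of "i - 1"] k(2)[of i]
      by (simp add: h0 A0.minus_eq A0.r_neg)
  qed
  have "bdd_above {i. u i \<noteq> \<zero>\<^bsub>obj A n\<^esub>}"
    using u_zero by (intro bdd_aboveI[of _ k]) (metis (mono_tags) mem_Collect_eq linear)
  then have u_Ser: "u \<in> carrier (series_module bdd_above R (obj A n))"
    using u_car by (simp add: series_module_simps)
  have du: "\<ominus>\<^bsub>obj A (n + 1)\<^esub> diff A n (u i) = x i" for i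
  proof (cases "i \<le> k")
    case True
    then show ?thesis using d_a[of "nat (k - i)"] by (simp add: u_def)
  next
    case False
    then show ?thesis using u_zero[of i] k(1)[of i] by (simp add: d)
  qed
  \<comment> \<open>The series \<open>u\<close> already accounts for all of \<open>y\<close>, so the
    second component of the primitive can be zero.\<close>
  have "diff A (n - 1) \<zero>\<^bsub>obj A (n - 1)\<^esub> = \<zero>\<^bsub>obj A n\<^esub>"
    using abelian_group_homD(5)[OF diff_abelian_group_hom[of "n - 1"]] by simp
  moreover have "h n (u i) \<ominus>\<^bsub>obj A n\<^esub> u (i - 1) = y i" for i
    using car u_car by (simp add: u_rec A0.minus_eq A0.minus_add h0 A0.r_neg A0.a_assoc[symmetric])
  ultimately have "(h n (u i) \<ominus>\<^bsub>obj A n\<^esub> u (i - 1)) \<oplus>\<^bsub>obj A n\<^esub> diff A (n - 1) \<zero>\<^bsub>obj A (n - 1)\<^esub> = y i" for i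
    using car by simp
  moreover have "(\<lambda>i. \<zero>\<^bsub>obj A (n - 1)\<^esub>) \<in> carrier (series_module bdd_above R (obj A (n - 1)))"
    by (simp add: series_module_simps)
  ultimately show ?thesis using u_Ser du by (intro bexI[of _ u] bexI[of _ "\<lambda>i. \<zero>\<^bsub>obj A (n - 1)\<^esub>"]) auto
qed

text \<open>
  The coefficients of a primitive are found by recursion from the bottom degree, each step being
  an instance of the exactness of the mapping cone of \<open>h\<close>.
\<close>

lemma (in cochain_complex) torus_exact_pos:
  assumes h: "quasi_isomorphism R A A h"
    and x: "x \<in> carrier (series_module bdd_below R (obj A (n + 1)))"
    and y: "y \<in> carrier (series_module bdd_below R (obj A n))"
    and dx: "\<And>i. diff A (n + 1) (x i) = \<zero>\<^bsub>obj A (n + 2)\<^esub>"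
    and eq: "\<And>i. (h (n + 1) (x i) \<ominus>\<^bsub>obj A (n + 1)\<^esub> x (i - 1)) \<oplus>\<^bsub>obj A (n + 1)\<^esub> diff A n (y i) = \<zero>\<^bsub>obj A (n + 1)\<^esub>"
  shows "\<exists>u\<in>carrier (series_module bdd_below R (obj A n)). \<exists>v\<in>carrier (series_module bdd_below R (obj A (n - 1))).
      (\<forall>i. \<ominus>\<^bsub>obj A (n + 1)\<^esub> diff A n (u i) = x i) \<and>
      (\<forall>i. (h n (u i) \<ominus>\<^bsub>obj A n\<^esub> u (i - 1)) \<oplus>\<^bsub>obj A n\<^esub> diff A (n - 1) (v i) = y i)"
proof -
  interpret A0: abelian_group "obj A n" by (rule right_moduleD(2)[OF obj_module])
  interpret A1: abelian_group "obj A (n + 1)" by (rule right_moduleD(2)[OF obj_module])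
  interpret Am: abelian_group "obj A (n - 1)" by (rule right_moduleD(2)[OF obj_module])
  have hc: "cochain_map R A A h" using h by (simp add: quasi_isomorphism_def)
  have hom: "abelian_group_hom (obj A m) (obj A m) (h m)" for m
    by (rule rmod_hom_abelian_group_hom[OF cochain_mapD(1)[OF hc] obj_module obj_module])
  note h0 = abelian_group_homD[OF hom[of n]] and h1 = abelian_group_homD[OF hom[of "n + 1"]]
  note d = abelian_group_homD[OF diff_abelian_group_hom[of n]]
  have dm: "abelian_group_hom (obj A (n - 1)) (obj A n) (diff A (n - 1))"
    using diff_abelian_group_hom[of "n - 1"] by simp
  note dm' = abelian_group_homD[OF dm]
  have car: "x i \<in> carrier (obj A (n + 1))" "y i \<in> carrier (obj A n)" for i
    using x y by (auto simp: series_module_simps)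
  obtain b b' where b: "\<And>i. x i \<noteq> \<zero>\<^bsub>obj A (n + 1)\<^esub> \<Longrightarrow> b \<le> i" "\<And>i. y i \<noteq> \<zero>\<^bsub>obj A n\<^esub> \<Longrightarrow> b' \<le> i"
    using x y unfolding series_module_simps bdd_below_def by blast
  \<comment> \<open>One less than both lower bounds, so that \<open>x\<close> and \<open>y\<close>
    still vanish at \<open>k\<close> itself, where the recursion starts.\<close>
  define k where "k = min b b' - 1"
  have k: "x i = \<zero>\<^bsub>obj A (n + 1)\<^esub>" "y i = \<zero>\<^bsub>obj A n\<^esub>" if "i \<le> k" for i
    using b[of i] that by (auto simp: k_def)
  \<comment> \<open>The pair is a candidate for the coefficients \<open>(u, v)\<close> in degree
    \<open>k + j\<close>. The clause for \<open>j = 0\<close> pins the start to zero, which later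
    bounds the supports from below.\<close>
  define Q where "Q j p \<longleftrightarrow> fst p \<in> carrier (obj A n) \<and> snd p \<in> carrier (obj A (n - 1)) \<and>
      \<ominus>\<^bsub>obj A (n + 1)\<^esub> diff A n (fst p) = x (k + int j) \<and>
      (j = 0 \<longrightarrow> p = (\<zero>\<^bsub>obj A n\<^esub>, \<zero>\<^bsub>obj A (n - 1)\<^esub>))" for j :: nat and p
  \<comment> \<open>The equation for the second component, with the previous coefficient of
    \<open>u\<close> moved to the other side.\<close>
  define step where "step j p p' \<longleftrightarrow> h n (fst p') \<oplus>\<^bsub>obj A n\<^esub> diff A (n - 1) (snd p')
      = y (k + int (Suc j)) \<oplus>\<^bsub>obj A n\<^esub> fst p" for j and p p' :: "'m \<times> 'm"
  have start: "\<exists>p. Q 0 p"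
    by (simp add: Q_def d k)
  have succ: "\<exists>p'. Q (Suc j) p' \<and> step j p p'" if p: "Q j p" for j p
  proof -
    let ?i = "k + int (Suc j)"
    have fp: "fst p \<in> carrier (obj A n)" and dp: "\<ominus>\<^bsub>obj A (n + 1)\<^esub> diff A n (fst p) = x (?i - 1)"
      using p by (auto simp: Q_def)
    \<comment> \<open>The previous coefficient has coboundary \<open>- x (i - 1)\<close>. Adding it
      to \<open>y i\<close> therefore converts the cocycle equation of the torus into the cocycle
      equation of the cone of \<open>h\<close>, for which primitives exist.\<close>
    have "diff A n (fst p) = \<ominus>\<^bsub>obj A (n + 1)\<^esub> x (?i - 1)"
      unfolding dp[symmetric] using fp by (simp add: d)
    then have "h (n + 1) (x ?i) \<oplus>\<^bsub>obj A (n + 1)\<^esub> diff A n (y ?i \<oplus>\<^bsub>obj A n\<^esub> fst p)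
        = (h (n + 1) (x ?i) \<ominus>\<^bsub>obj A (n + 1)\<^esub> x (?i - 1)) \<oplus>\<^bsub>obj A (n + 1)\<^esub> diff A n (y ?i)"
      using car fp by (simp add: d h1 A1.minus_eq A1.a_ac)
    then have "h (n + 1) (x ?i) \<oplus>\<^bsub>obj A (n + 1)\<^esub> diff A n (y ?i \<oplus>\<^bsub>obj A n\<^esub> fst p) = \<zero>\<^bsub>obj A (n + 1)\<^esub>"
      by (simp only: eq)
    from quasi_isomorphism_cone_exact[OF cochain_complex_axioms h car(1) A0.a_closed[OF car(2) fp] dx this]
    obtain u v where "u \<in> carrier (obj A n)" "v \<in> carrier (obj A (n - 1))"
      "\<ominus>\<^bsub>obj A (n + 1)\<^esub> diff A n u = x ?i"
      "h n u \<oplus>\<^bsub>obj A n\<^esub> diff A (n - 1) v = y ?i \<oplus>\<^bsub>obj A n\<^esub> fst p"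
      by blast
    then show ?thesis by (intro exI[of _ "(u, v)"]) (simp add: Q_def step_def)
  qed
  obtain f where f: "\<And>j. Q j (f j)" "\<And>j. step j (f j) (f (Suc j))"
    using dependent_nat_choice[of Q step] start succ by blast
  \<comment> \<open>\<open>nat\<close> sends every degree up to \<open>k\<close> to
    \<open>0\<close>, so in all these degrees the coefficients are those of the zero starting
    pair.\<close>
  define u where "u i = fst (f (nat (i - k)))" for i
  define v where "v i = snd (f (nat (i - k)))" for i
  have uv_car: "u i \<in> carrier (obj A n)" "v i \<in> carrier (obj A (n - 1))" for i
    using f(1) by (auto simp: u_def v_def Q_def)
  have uv_zero: "u i = \<zero>\<^bsub>obj A n\<^esub>" "v i = \<zero>\<^bsub>obj A (n - 1)\<^esub>" if "i \<le> k" for i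
    using f(1)[of 0] that by (auto simp: u_def v_def Q_def)
  have bdd: "bdd_below {i. u i \<noteq> \<zero>\<^bsub>obj A n\<^esub>}" "bdd_below {i. v i \<noteq> \<zero>\<^bsub>obj A (n - 1)\<^esub>}"
    using uv_zero by (auto intro!: bdd_belowI[of _ k]) (meson linear)+
  show ?thesis
  proof (intro bexI conjI allI)
    show "u \<in> carrier (series_module bdd_below R (obj A n))"
      "v \<in> carrier (series_module bdd_below R (obj A (n - 1)))"
      using uv_car bdd by (simp_all add: series_module_simps)
    fix i
    show "\<ominus>\<^bsub>obj A (n + 1)\<^esub> diff A n (u i) = x i"
    proof (cases "i \<le> k")
      case True
      then show ?thesis by (simp add: uv_zero k d)
    next
      case False
      then show ?thesis using f(1)[of "nat (i - k)"] by (simp add: u_def Q_def)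
    qed
    show "(h n (u i) \<ominus>\<^bsub>obj A n\<^esub> u (i - 1)) \<oplus>\<^bsub>obj A n\<^esub> diff A (n - 1) (v i) = y i"
    proof (cases "i \<le> k")
      case True
      then show ?thesis by (simp add: uv_zero k h0 dm' A0.minus_eq A0.r_neg)
    next
      case False
      then have i: "nat (i - k) = Suc (nat (i - 1 - k))" "k + int (Suc (nat (i - 1 - k))) = i" by auto
      have "h n (u i) \<oplus>\<^bsub>obj A n\<^esub> diff A (n - 1) (v i) = y i \<oplus>\<^bsub>obj A n\<^esub> u (i - 1)"
        using f(2)[of "nat (i - 1 - k)"] unfolding step_def i(2) by (simp add: u_def v_def i(1))
      moreover have "(h n (u i) \<ominus>\<^bsub>obj A n\<^esub> u (i - 1)) \<oplus>\<^bsub>obj A n\<^esub> diff A (n - 1) (v i)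
          = (h n (u i) \<oplus>\<^bsub>obj A n\<^esub> diff A (n - 1) (v i)) \<ominus>\<^bsub>obj A n\<^esub> u (i - 1)"
        using uv_car by (simp add: A0.minus_eq A0.a_ac h0 dm')
      ultimately show ?thesis
        using uv_car car by (simp add: A0.minus_eq A0.a_assoc A0.r_neg)
    qed
  qed
qed

theorem theorem2p5:
  fixes R :: "('r, 'e) ring_scheme"
    and C :: "('r, 'm) cochain"
    and h :: "int \<Rightarrow> 'm \<Rightarrow> 'm"
  assumes "ring R"
    and "cochain_complex R C"
    and "\<And>n. finitely_presented R (obj C n)"
    and "cochain_map R C C h"
  shows "acyclic_complex (novikov_neg R)
           (novikov_complex R (novikov_neg R) (mapping_torus R C h)) \<and>
         (quasi_isomorphism R C C h \<longrightarrow>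
           acyclic_complex (novikov_pos R)
             (novikov_complex R (novikov_pos R) (mapping_torus R C h)))"
proof (intro conjI impI)
  have torus: "torus R P C h" if "laurent_support P" for P
    using assms that
    by (intro torus.intro laurent_ring_support.intro torus_axioms.intro)
  interpret C: cochain_complex R C by fact
  show "acyclic_complex (novikov_neg R) (novikov_complex R (novikov_neg R) (mapping_torus R C h))"
    unfolding novikov_neg_def
    by (rule torus.novikov_complex_acyclic[OF torus[OF laurent_support_bdd_above] assms(3)])
      (rule C.torus_exact_neg[OF assms(4)])
  assume "quasi_isomorphism R C C h"
  then show "acyclic_complex (novikov_pos R) (novikov_complex R (novikov_pos R) (mapping_torus R C h))"
    unfolding novikov_pos_def
    by (intro torus.novikov_complex_acyclic[OF torus[OF laurent_support_bdd_below] assms(3)])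
      (rule C.torus_exact_pos)
qed

end
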